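(* Let $h$ be the heat kernel on $\mathbb{H}\times(0,\infty)$ associated with the sub-Laplacian $L=-(X^2+Y^2)$ on the Heisenberg group $\mathbb{H}$. Then the Schwartz function $\phi(\omega)=Lh(\omega,1)$ (with $L$ acting in the variable $\omega\in\mathbb{H}$) is admissible, and $\phi$ and all of its derivatives have "Gaussian" decay.
   Context: The Heisenberg group $\mathbb{H}$ is $\mathbb{R}^3$ with group law $(p_1,q_1,t_1)\ast(p_2,q_2,t_2)=\big(p_1+p_2,\,q_1+q_2,\,t_1+t_2+\tfrac12(p_1q_2-q_1p_2)\big)$; its Haar measure is Lebesgue measure on $\mathbb{R}^3$, and its Schwartz functions are the Schwartz functions on $\mathbb{R}^3$. For $a>0$, the dilation automorphism is $a\cdot(p,q,t)=\delta_a(p,q,t)=(ap,aq,a^2t)$. The left-invariant vector fields $X,Y$ act by $Xf=\partial_pf-\tfrac12q\,\partial_tf$, $Yf=\partial_qf+\tfrac12p\,\partial_tf$. Convolution is $(f\ast g)(\omega)=\int_{\mathbb{H}}f(\upsilon)\,g(\upsilon^{-1}\omega)\,d\upsilon$. Heat kernel: $h$ is the unique $C^\infty$ function on $\mathbb{H}\times(0,\infty)$ (where $t\in(0,\infty)$ is a time variable, distinct from the central coordinate of $\mathbb{H}$) with: (1) $(\frac{d}{dt}+L)h=0$ on $\mathbb{H}\times(0,\infty)$; (2) $h(\omega,t)\ge0$ and $h(\omega,t)=h(\omega^{-1},t)$; (3) $\int_{\mathbb{H}}h(\omega,t)\,d\omega=1$ for all $t>0$; (4) $h(\cdot,s)\ast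 h(\cdot,t)=h(\cdot,s+t)$ for all $s,t>0$; (5) $r^4h(r\omega,r^2t)=h(\omega,t)$ for all $\omega\in\mathbb{H}$, $t,r>0$. Let $G=\mathbb{H}\rtimes(0,\infty)$ with product $(\omega,a)(\omega',a')=(\omega\,(a\omega'),aa')$ and left Haar measure $d\mu_G(\omega,a)=a^{-5}\,d\omega\,da$. The quasi-regular representation $\pi$ of $G$ on $L^2(\mathbb{H})$ is $(\pi(\omega,a)f)(\upsilon)=a^{-2}f\big(a^{-1}(\omega^{-1}\upsilon)\big)$. Admissible: $\phi\in L^2(\mathbb{H})$ is called admissible if the operator $V_\phi f(\omega,a)=\langle f,\pi(\omega,a)\phi\rangle$ maps $L^2(\mathbb{H})$ into $L^2(G)$ isometrically up to a constant, i.e. there is a positive constant $C_\phi$, depending only on $\phi$, such that $\|f\|_2^2=C_\phi\int_{\mathbb{H}}\int_0^\infty|V_\phi f(\omega,a)|^2a^{-5}\,da\,d\omega$ for all $f\in L^2(\mathbb{H})$. Gaussian decay: a function $F$ on $\mathbb{H}$ has "Gaussian" decay if for some $C,c>0$, $|F(p,q,t)|\le C\exp\!\big(-c\,(p^4+q^4+t^2)^{1/2}\big)$ for all $(p,q,t)\in\mathbb{H}$ (the constants may depend on the function $F$). *)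

theory Defs
  imports "HOL-Analysis.Analysis"
begin

section \<open>Derivatives, smooth functions and Schwartz functions\<close>

definition dir_deriv :: "'a::euclidean_space \<Rightarrow> ('a \<Rightarrow> real) \<Rightarrow> 'a \<Rightarrow> real" where
  "dir_deriv v f x = frechet_derivative f (at x) v"

fun Ck_on :: "nat \<Rightarrow> ('a::euclidean_space \<Rightarrow> real) \<Rightarrow> 'a set \<Rightarrow> bool" where
  "Ck_on 0 f S \<longleftrightarrow> continuous_on S f"
| "Ck_on (Suc k) f S \<longleftrightarrow>
     (\<forall>x\<in>S. f differentiable (at x)) \<and> (\<forall>v\<in>Basis. Ck_on k (dir_deriv v f) S)"

text \<open>The following notion is meant for open sets \<open>S\<close>.\<close>

definition smooth_on :: "('a::euclidean_space \<Rightarrow> real) \<Rightarrow> 'a set \<Rightarrow> bool" where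
  "smooth_on f S \<longleftrightarrow> (\<forall>k. Ck_on k f S)"

text \<open>\<open>iter_deriv vs f\<close> for \<open>vs\<close> ranging over the lists of basis vectors runs through all
  partial derivatives of \<open>f\<close> of all orders, \<open>f\<close> itself (\<open>vs = []\<close>) included.\<close>

definition iter_deriv :: "'a::euclidean_space list \<Rightarrow> ('a \<Rightarrow> real) \<Rightarrow> 'a \<Rightarrow> real" where
  "iter_deriv vs f = foldr dir_deriv vs f"

definition schwartz :: "('a::euclidean_space \<Rightarrow> real) \<Rightarrow> bool" where
  "schwartz f \<longleftrightarrow> smooth_on f UNIV \<and>
     (\<forall>k::nat. \<forall>vs\<in>lists Basis. \<exists>C. \<forall>x. (1 + norm x) ^ k * \<bar>iter_deriv vs f x\<bar> \<le> C)"

section \<open>The Heisenberg group\<close>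

type_synonym heis = "real \<times> real \<times> real"

fun heis_mult :: "heis \<Rightarrow> heis \<Rightarrow> heis" (infixl "\<odot>" 70) where
  "(p1, q1, t1) \<odot> (p2, q2, t2) = (p1 + p2, q1 + q2, t1 + t2 + (p1 * q2 - q1 * p2) / 2)"

fun heis_inv :: "heis \<Rightarrow> heis" where
  "heis_inv (p, q, t) = (- p, - q, - t)"

lemma heis_group:
  "(x \<odot> y) \<odot> z = x \<odot> (y \<odot> z)" "0 \<odot> x = x" "x \<odot> 0 = x"
  "heis_inv x \<odot> x = 0" "x \<odot> heis_inv x = 0"
  by (cases x; cases y; cases z; simp add: zero_prod_def field_simps)+

fun dilate :: "real \<Rightarrow> heis \<Rightarrow> heis" where
  "dilate a (p, q, t) = (a * p, a * q, a\<^sup>2 * t)"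

abbreviation d_p :: "(heis \<Rightarrow> real) \<Rightarrow> heis \<Rightarrow> real" where "d_p \<equiv> dir_deriv (1, 0, 0)"
abbreviation d_q :: "(heis \<Rightarrow> real) \<Rightarrow> heis \<Rightarrow> real" where "d_q \<equiv> dir_deriv (0, 1, 0)"
abbreviation d_t :: "(heis \<Rightarrow> real) \<Rightarrow> heis \<Rightarrow> real" where "d_t \<equiv> dir_deriv (0, 0, 1)"

definition X_field :: "(heis \<Rightarrow> real) \<Rightarrow> heis \<Rightarrow> real" where
  "X_field f = (\<lambda>(p, q, t). d_p f (p, q, t) - q / 2 * d_t f (p, q, t))"

definition Y_field :: "(heis \<Rightarrow> real) \<Rightarrow> heis \<Rightarrow> real" where
  "Y_field f = (\<lambda>(p, q, t). d_q f (p, q, t) + p / 2 * d_t f (p, q, t))"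

definition sub_laplacian :: "(heis \<Rightarrow> real) \<Rightarrow> heis \<Rightarrow> real" where
  "sub_laplacian f \<omega> = - (X_field (X_field f) \<omega> + Y_field (Y_field f) \<omega>)"

text \<open>The Haar measure of the Heisenberg group is \<^term>\<open>lborel :: heis measure\<close>. The second
  definition says that the convolution integral converges absolutely at every point.\<close>

definition heis_conv :: "(heis \<Rightarrow> real) \<Rightarrow> (heis \<Rightarrow> real) \<Rightarrow> heis \<Rightarrow> real" where
  "heis_conv f g \<omega> = (LINT \<upsilon>|lborel. f \<upsilon> * g (heis_inv \<upsilon> \<odot> \<omega>))"

definition heis_conv_exists :: "(heis \<Rightarrow> real) \<Rightarrow> (heis \<Rightarrow> real) \<Rightarrow> bool" where
  "heis_conv_exists f g \<longleftrightarrow> (\<forall>\<omega>. integrable lborel (\<lambda>\<upsilon>. f \<upsilon> * g (heis_inv \<upsilon> \<odot> \<omega>)))"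

section \<open>The heat kernel\<close>

text \<open>These properties determine \<open>h\<close> on \<open>UNIV \<times> {0<..}\<close>; the values of \<open>h\<close> at times \<open>t \<le> 0\<close>
  are irrelevant.\<close>

definition heat_kernel :: "(heis \<times> real \<Rightarrow> real) \<Rightarrow> bool" where
  "heat_kernel h \<longleftrightarrow>
     smooth_on h (UNIV \<times> {0<..}) \<and>
     (\<forall>\<omega>. \<forall>t>0. deriv (\<lambda>s. h (\<omega>, s)) t + sub_laplacian (\<lambda>\<upsilon>. h (\<upsilon>, t)) \<omega> = 0) \<and>
     (\<forall>\<omega>. \<forall>t>0. h (\<omega>, t) \<ge> 0 \<and> h (\<omega>, t) = h (heis_inv \<omega>, t)) \<and>
     (\<forall>t>0. integrable lborel (\<lambda>\<omega>. h (\<omega>, t)) \<and> (LINT \<omega>|lborel. h (\<omega>, t)) = 1) \<and>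
     (\<forall>s>0. \<forall>t>0. heis_conv_exists (\<lambda>\<omega>. h (\<omega>, s)) (\<lambda>\<omega>. h (\<omega>, t)) \<and>
        heis_conv (\<lambda>\<omega>. h (\<omega>, s)) (\<lambda>\<omega>. h (\<omega>, t)) = (\<lambda>\<omega>. h (\<omega>, s + t))) \<and>
     (\<forall>\<omega>. \<forall>t>0. \<forall>r>0. r ^ 4 * h (dilate r \<omega>, r\<^sup>2 * t) = h (\<omega>, t))"

section \<open>Admissible functions\<close>

text \<open>Elements of \<open>L\<^sup>2\<close> are represented by functions. The notions below do not
  depend on the representative.\<close>

definition L2 :: "'a measure \<Rightarrow> ('a \<Rightarrow> complex) set" where
  "L2 M = {f \<in> borel_measurable M. integrable M (\<lambda>x. (cmod (f x))\<^sup>2)}"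

definition L2_inner :: "'a measure \<Rightarrow> ('a \<Rightarrow> complex) \<Rightarrow> ('a \<Rightarrow> complex) \<Rightarrow> complex" where
  "L2_inner M f g = (LINT x|M. f x * cnj (g x))"

definition L2_norm :: "'a measure \<Rightarrow> ('a \<Rightarrow> complex) \<Rightarrow> real" where
  "L2_norm M f = sqrt (LINT x|M. (cmod (f x))\<^sup>2)"

text \<open>Left Haar measure of the semidirect product of the Heisenberg group with the dilations;
  the underlying set of this group is \<open>UNIV \<times> {0<..}\<close>.\<close>

definition haar_G :: "(heis \<times> real) measure" where
  "haar_G = density (restrict_space lborel (UNIV \<times> {0<..})) (\<lambda>(\<omega>, a). ennreal (1 / a ^ 5))"

definition quasi_regular :: "heis \<Rightarrow> real \<Rightarrow> (heis \<Rightarrow> complex) \<Rightarrow> heis \<Rightarrow> complex" where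
  "quasi_regular \<omega> a f \<upsilon> = of_real (1 / a\<^sup>2) * f (dilate (1 / a) (heis_inv \<omega> \<odot> \<upsilon>))"

definition wavelet_transform ::
    "(heis \<Rightarrow> complex) \<Rightarrow> (heis \<Rightarrow> complex) \<Rightarrow> heis \<times> real \<Rightarrow> complex" where
  "wavelet_transform \<phi> f = (\<lambda>(\<omega>, a). L2_inner lborel f (quasi_regular \<omega> a \<phi>))"

definition admissible :: "(heis \<Rightarrow> complex) \<Rightarrow> bool" where
  "admissible \<phi> \<longleftrightarrow> \<phi> \<in> L2 lborel \<and>
     (\<exists>C>0. \<forall>f\<in>L2 lborel.
        wavelet_transform \<phi> f \<in> L2 haar_G \<and>
        (L2_norm lborel f)\<^sup>2 =
          C * (LINT \<omega>|lborel. (LINT a:{0<..}|lborel.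
                 ((cmod (wavelet_transform \<phi> f (\<omega>, a)))\<^sup>2 * (1 / a ^ 5)))))"

section \<open>Gaussian decay\<close>

definition gaussian_decay :: "(heis \<Rightarrow> real) \<Rightarrow> bool" where
  "gaussian_decay F \<longleftrightarrow>
     (\<exists>C>0. \<exists>c>0. \<forall>p q t. \<bar>F (p, q, t)\<bar> \<le> C * exp (- c * sqrt (p ^ 4 + q ^ 4 + t\<^sup>2)))"

end

theory Submission
  imports Defs "HOL-Probability.Sinc_Integral"
begin

text \<open>
  By the semigroup law and symmetry, \<open>h (a\<inverse> b, 1)\<close> is the inner product of the left translates of
  \<open>h (\<cdot>, 1/2)\<close> by \<open>a\<close> and \<open>b\<close>. So it is a positive definite kernel, and its smoothness at the diagonal
  alone bounds all left-invariant derivatives of \<open>K = h (\<cdot>, 1)\<close> globally. By homogeneity the heat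
  equation says that \<open>K\<close> is an invariant density of an Ornstein--Uhlenbeck type operator; a Lyapunov function
  yields a Gaussian moment of \<open>K\<close>, and \<open>K * K\<close> turns it into a pointwise bound. Interpolation between \<open>K\<close>
  and its polynomially bounded derivatives transfers the Gaussian decay to all derivatives.

  For admissibility, \<open>\<phi> = - \<partial>\<^sub>s h (\<cdot>, 1)\<close> and \<open>\<phi> * \<phi> = \<partial>\<^sub>s \<partial>\<^sub>s h (\<cdot>, 2)\<close>, so that for \<open>N u = \<langle>f * h (\<cdot>, u), f\<rangle>\<close> the
  squared norm of the coefficients at scale \<open>a\<close>, weighted by \<open>a\<^sup>-\<^sup>5\<close>, is \<open>a\<^sup>3 N'' (2 a\<^sup>2)\<close>, the derivative of
  \<open>(u N' u - N u) / 8\<close> at \<open>u = 2 a\<^sup>2\<close>. Hence the integral over \<open>a\<close> is \<open>\<parallel>f\<parallel>\<^sup>2 / 8\<close>.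
\<close>

section \<open>Calculus of smooth functions\<close>

text \<open>Only the listed properties of \<open>h\<close> are available: no bound, no decay and no
  initial condition. This fixes the order of the argument. Even boundedness of \<open>K\<close> is
  drawn from positive definiteness, and coordinate derivatives are then merely polynomially bounded,
  because the passage from the left-invariant frame to the coordinate frame has coefficients linear
  in \<open>p\<close> and \<open>q\<close>. The Lyapunov function cannot be integrated against
  \<open>K\<close> before its moment is known to be finite, so it is composed with functions that
  make it compactly supported; their concavity gives the error term a sign. Decay has to precede
  admissibility: the semigroup law is differentiated in time by dominated convergence, and the
  majorant is the Gaussian bound of \<open>\<phi>\<close>, transported to nearby times by
  homogeneity. The missing initial condition is replaced by homogeneity together with total mass
  one, which turn the behaviour near time 0 into that of an approximate identity.\<close>

lemma dir_deriv_eq: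
  assumes "(f has_derivative f') (at x)"
  shows "dir_deriv v f x = f' v"
  unfolding dir_deriv_def using frechet_derivative_at[OF assms] by simp

lemma has_derivative_dir_deriv:
  assumes "f differentiable (at x)"
  shows "(f has_derivative (\<lambda>v. dir_deriv v f x)) (at x)"
  using assms unfolding dir_deriv_def by (simp add: frechet_derivative_works)

lemma linear_dir_deriv:
  assumes "f differentiable (at x)"
  shows "linear (\<lambda>v. dir_deriv v f x)"
  using has_derivative_linear[OF has_derivative_dir_deriv[OF assms]] .

lemma dir_deriv_add:
  assumes "f differentiable (at x)" "g differentiable (at x)"
  shows "dir_deriv v (\<lambda>x. f x + g x) x = dir_deriv v f x + dir_deriv v g x"
  by (rule dir_deriv_eq) (intro has_derivative_add has_derivative_dir_deriv assms)

lemma dir_deriv_mult: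
  assumes "f differentiable (at x)" "g differentiable (at x)"
  shows "dir_deriv v (\<lambda>x. f x * g x) x = f x * dir_deriv v g x + dir_deriv v f x * g x"
  by (rule dir_deriv_eq) (intro has_derivative_mult has_derivative_dir_deriv assms)

lemma dir_deriv_linear:
  assumes "bounded_linear f"
  shows "dir_deriv v f x = f v"
  by (rule dir_deriv_eq) (rule bounded_linear_imp_has_derivative[OF assms])

lemma dir_deriv_const [simp]: "dir_deriv v (\<lambda>_. c) x = 0"
  by (rule dir_deriv_eq) simp

lemma dir_deriv_cong_open:
  assumes "open S" "x \<in> S" "\<And>y. y \<in> S \<Longrightarrow> f y = g y" "f differentiable (at x)"
  shows "dir_deriv v f x = dir_deriv v g x" "g differentiable (at x)"
proof -
  have "(g has_derivative (\<lambda>v. dir_deriv v f x)) (at x)"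
    by (rule has_derivative_transform_within_open[OF has_derivative_dir_deriv[OF assms(4)]])
       (use assms in auto)
  then show "dir_deriv v f x = dir_deriv v g x" "g differentiable (at x)"
    using dir_deriv_eq[of g _ x v] by (auto intro: differentiableI)
qed

text \<open>\<open>Ck_on\<close> iterates \<open>dir_deriv\<close> as a total function, while the
  sum and product rules hold only at points of \<open>S\<close>. Openness of \<open>S\<close> lets
  an equality on \<open>S\<close> pass to the derivatives on \<open>S\<close>.\<close>

lemma Ck_on_cong:
  assumes "open S" "\<And>y. y \<in> S \<Longrightarrow> f y = g y" "Ck_on k f S"
  shows "Ck_on k g S"
  using assms
proof (induction k arbitrary: f g)
  case 0
  then show ?case by (metis Ck_on.simps(1) continuous_on_cong)
next
  case (Suc k)
  have d: "f differentiable (at x)" if "x \<in> S" for x using Suc.prems that by simp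
  have "Ck_on k (dir_deriv v g) S" if "v \<in> Basis" for v
    by (rule Suc.IH[of "dir_deriv v f"])
      (use Suc.prems that dir_deriv_cong_open(1)[OF Suc.prems(1)] d in auto)
  then show ?case
    using dir_deriv_cong_open(2)[OF Suc.prems(1) _ Suc.prems(2)] d by auto
qed

lemma Ck_on_continuous: "Ck_on k f S \<Longrightarrow> continuous_on S f"
  by (cases k) (auto intro!: continuous_at_imp_continuous_on differentiable_imp_continuous_within)

lemma Ck_on_SucD: "Ck_on (Suc k) f S \<Longrightarrow> Ck_on k f S"
proof (induction k arbitrary: f)
  case 0
  then show ?case using Ck_on_continuous[of "Suc 0" f S] by simp
next
  case (Suc k)
  have "Ck_on k (dir_deriv v f) S" if "v \<in> Basis" for v
    by (rule Suc.IH) (use Suc.prems that in auto)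
  then show ?case using Suc.prems by auto
qed

lemma Ck_on_const: "Ck_on k (\<lambda>_. c) S"
proof (induction k arbitrary: c)
  case (Suc k)
  have "dir_deriv v (\<lambda>_::'a. c) = (\<lambda>_. 0)" for v by auto
  then show ?case using Suc by simp
qed simp

lemma Ck_on_linear:
  assumes "bounded_linear f"
  shows "Ck_on k f S"
proof (cases k)
  case 0
  then show ?thesis by (simp add: linear_continuous_on[OF assms])
next
  case (Suc n)
  have "dir_deriv v f = (\<lambda>_. f v)" for v using dir_deriv_linear[OF assms] by auto
  then show ?thesis
    using Suc bounded_linear_imp_differentiable[OF assms] by (simp add: Ck_on_const)
qed

lemma Ck_on_add:
  assumes "open S" "Ck_on k f S" "Ck_on k g S"
  shows "Ck_on k (\<lambda>x. f x + g x) S"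
  using assms(2,3)
proof (induction k arbitrary: f g)
  case 0
  then show ?case by (auto intro: continuous_on_add)
next
  case (Suc k)
  have "Ck_on k (dir_deriv v (\<lambda>x. f x + g x)) S" if "v \<in> Basis" for v
    by (rule Ck_on_cong[OF assms(1) _ Suc.IH[of "dir_deriv v f" "dir_deriv v g"]])
       (use Suc.prems that in \<open>auto simp: dir_deriv_add\<close>)
  then show ?case using Suc.prems by auto
qed

lemma Ck_on_mult:
  assumes "open S" "Ck_on k f S" "Ck_on k g S"
  shows "Ck_on k (\<lambda>x. f x * g x) S"
  using assms(2,3)
proof (induction k arbitrary: f g)
  case 0
  then show ?case by (auto intro: continuous_on_mult)
next
  case (Suc k)
  have fg: "Ck_on k f S" "Ck_on k g S" using Suc.prems Ck_on_SucD by blast+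
  have "Ck_on k (dir_deriv v (\<lambda>x. f x * g x)) S" if "v \<in> Basis" for v
    by (rule Ck_on_cong[OF assms(1) _ Ck_on_add[OF assms(1) Suc.IH[of f "dir_deriv v g"] 
          Suc.IH[of "dir_deriv v f" g]]])
       (use Suc.prems that fg in \<open>auto simp: dir_deriv_mult\<close>)
  then show ?case using Suc.prems by auto
qed

lemma smooth_on_const: "smooth_on (\<lambda>_. c) S"
  by (simp add: smooth_on_def Ck_on_const)

lemma smooth_on_linear: "bounded_linear f \<Longrightarrow> smooth_on f S"
  by (simp add: smooth_on_def Ck_on_linear)

lemma smooth_on_add: "open S \<Longrightarrow> smooth_on f S \<Longrightarrow> smooth_on g S \<Longrightarrow> smooth_on (\<lambda>x. f x + g x) S"
  by (simp add: smooth_on_def Ck_on_add)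

lemma smooth_on_mult: "open S \<Longrightarrow> smooth_on f S \<Longrightarrow> smooth_on g S \<Longrightarrow> smooth_on (\<lambda>x. f x * g x) S"
  by (simp add: smooth_on_def Ck_on_mult)

lemma smooth_on_differentiable: "smooth_on f S \<Longrightarrow> x \<in> S \<Longrightarrow> f differentiable (at x)"
  unfolding smooth_on_def using Ck_on.simps(2) by blast

lemma smooth_on_continuous: "smooth_on f S \<Longrightarrow> continuous_on S f"
  unfolding smooth_on_def using Ck_on_continuous by blast

lemma smooth_on_dir_deriv_Basis: "smooth_on f S \<Longrightarrow> v \<in> Basis \<Longrightarrow> smooth_on (dir_deriv v f) S"
  unfolding smooth_on_def using Ck_on.simps(2) by blast

lemma dir_deriv_Basis_sum:
  assumes "f differentiable (at x)"
  shows "dir_deriv v f x = (\<Sum>b\<in>Basis. (v \<bullet> b) * dir_deriv b f x)"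
proof -
  interpret linear "\<lambda>v. dir_deriv v f x" by (rule linear_dir_deriv[OF assms])
  have "dir_deriv v f x = dir_deriv (\<Sum>b\<in>Basis. (v \<bullet> b) *\<^sub>R b) f x"
    by (simp add: euclidean_representation)
  also have "\<dots> = (\<Sum>b\<in>Basis. (v \<bullet> b) * dir_deriv b f x)"
    by (simp add: sum scale)
  finally show ?thesis .
qed

lemma smooth_on_iter_deriv:
  "smooth_on f S \<Longrightarrow> set vs \<subseteq> Basis \<Longrightarrow> smooth_on (iter_deriv vs f) S"
  unfolding iter_deriv_def by (induction vs) (auto intro: smooth_on_dir_deriv_Basis)

text \<open>The derivative of a slice along \<open>v\<close> is the slice of the derivative along
  \<open>(v, 0)\<close>, again a basis vector; hence the induction generalizes over the function on
  the product.\<close>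

lemma smooth_on_slice:
  fixes h :: "'a::euclidean_space \<times> real \<Rightarrow> real"
  assumes "smooth_on h (UNIV \<times> {0<..})" "s > 0"
  shows "smooth_on (\<lambda>x. h (x, s)) UNIV"
proof -
  have "Ck_on k (\<lambda>x. h (x, s)) UNIV" if "Ck_on k h (UNIV \<times> {0<..})" for k and h :: "'a \<times> real \<Rightarrow> real"
    using that
  proof (induction k arbitrary: h)
    case 0
    then show ?case using \<open>s > 0\<close>
      by (auto intro!: continuous_on_compose2[of "UNIV \<times> {0<..}" h] continuous_intros)
  next
    case (Suc k)
    have der: "((\<lambda>x. h (x, s)) has_derivative (\<lambda>v. dir_deriv (v, 0) h (x, s))) (at x)" for x
    proof -
      have 1: "(h has_derivative (\<lambda>v. dir_deriv v h (x, s))) (at (x, s))"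
        using Suc.prems \<open>s > 0\<close> by (intro has_derivative_dir_deriv) auto
      have 2: "((\<lambda>x. (x, s)) has_derivative (\<lambda>v. (v, 0))) (at x)"
        by (auto intro!: derivative_eq_intros)
      show ?thesis using has_derivative_compose[OF 2 1] by simp
    qed
    have "Ck_on k (dir_deriv v (\<lambda>x. h (x, s))) UNIV" if "v \<in> Basis" for v
    proof -
      have "(v, 0) \<in> (Basis :: ('a \<times> real) set)" using that by (auto simp: Basis_prod_def)
      then have "Ck_on k (\<lambda>x. dir_deriv (v, 0) h (x, s)) UNIV"
        using Suc.prems by (intro Suc.IH) auto
      moreover have "dir_deriv v (\<lambda>x. h (x, s)) = (\<lambda>x. dir_deriv (v, 0) h (x, s))"
        using dir_deriv_eq[OF der] by blast
      ultimately show ?thesis by simp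
    qed
    then show ?case using der by (auto intro: differentiableI)
  qed
  then show ?thesis using assms by (simp add: smooth_on_def)
qed

lemma has_derivative_time:
  fixes h :: "'a::euclidean_space \<times> real \<Rightarrow> real"
  assumes "smooth_on h (UNIV \<times> {0<..})" "s > 0"
  shows "((\<lambda>s. h (x, s)) has_real_derivative dir_deriv (0, 1) h (x, s)) (at s)"
proof -
  have d: "h differentiable (at (x, s))"
    using assms by (intro smooth_on_differentiable) auto
  have 2: "((\<lambda>s. (x, s)) has_derivative (\<lambda>r. (0, r))) (at s)"
    by (auto intro!: derivative_eq_intros)
  have "((\<lambda>s. h (x, s)) has_derivative (\<lambda>r. dir_deriv (0, r) h (x, s))) (at s)"
    using has_derivative_compose[OF 2 has_derivative_dir_deriv[OF d]] by simp
  moreover have "(\<lambda>r. dir_deriv (0, r) h (x, s)) = (*) (dir_deriv (0, 1) h (x, s))"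
  proof
    fix r
    have "(0, r) = r *\<^sub>R (0 :: 'a, 1 :: real)" by simp
    then have "dir_deriv (0, r) h (x, s) = r * dir_deriv (0, 1) h (x, s)"
      by (simp only: linear_cmul[OF linear_dir_deriv[OF d]] real_scaleR_def)
    then show "dir_deriv (0, r) h (x, s) = dir_deriv (0, 1) h (x, s) * r" by (metis mult.commute)
  qed
  ultimately show ?thesis unfolding has_field_derivative_def by metis
qed
section \<open>Haar measure of the Heisenberg group\<close>

lemma heis_mult_alt:
  "x \<odot> y = (fst x + fst y, fst (snd x) + fst (snd y),
     snd (snd x) + snd (snd y) + (fst x * fst (snd y) - fst (snd x) * fst y) / 2)"
  by (cases x; cases y) simp

lemma heis_inv_eq: "heis_inv x = - x"
  by (cases x) simp

lemma dilate_alt: "dilate a x = (a * fst x, a * fst (snd x), a\<^sup>2 * snd (snd x))"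
  by (cases x) simp

lemma continuous_on_heis_mult [continuous_intros]:
  "continuous_on S f \<Longrightarrow> continuous_on S g \<Longrightarrow> continuous_on S (\<lambda>x. f x \<odot> g x)"
  unfolding heis_mult_alt by (auto intro!: continuous_intros)

lemma continuous_on_dilate [continuous_intros]:
  "continuous_on S f \<Longrightarrow> continuous_on S g \<Longrightarrow> continuous_on S (\<lambda>x. dilate (f x) (g x))"
  unfolding dilate_alt by (auto intro!: continuous_intros)

lemma continuous_on_heis_inv [continuous_intros]:
  "continuous_on S f \<Longrightarrow> continuous_on S (\<lambda>x. heis_inv (f x))"
  unfolding heis_inv_eq by (auto intro!: continuous_intros)

lemma measurable_heis_mult [measurable]:
  assumes "f \<in> borel_measurable M" "g \<in> borel_measurable M"
  shows "(\<lambda>x. f x \<odot> g x) \<in> borel_measurable M"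
  using assms by (rule borel_measurable_continuous_Pair) (auto intro!: continuous_intros)

lemma measurable_heis_inv [measurable]:
  assumes "f \<in> borel_measurable M"
  shows "(\<lambda>x. heis_inv (f x)) \<in> borel_measurable M"
  unfolding heis_inv_eq using assms by measurable

lemma measurable_dilate [measurable]:
  assumes "f \<in> borel_measurable M" "g \<in> borel_measurable M"
  shows "(\<lambda>x. dilate (f x) (g x)) \<in> borel_measurable M"
  using assms by (rule borel_measurable_continuous_Pair) (auto intro!: continuous_intros)

lemma heis_inv_mult: "heis_inv (x \<odot> y) = heis_inv y \<odot> heis_inv x"
  by (cases x; cases y) (simp add: field_simps)

lemma heis_inv_inv [simp]: "heis_inv (heis_inv x) = x"
  by (cases x) simp

lemma heis_inv_mult_cancel [simp]:
  "heis_inv x \<odot> (x \<odot> y) = y" "x \<odot> (heis_inv x \<odot> y) = y"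
  "y \<odot> x \<odot> heis_inv x = y" "y \<odot> heis_inv x \<odot> x = y"
  by (simp_all add: heis_group(1)[symmetric] heis_group(2-5)) (simp_all add: heis_group)

lemma dilate_mult: "dilate a (x \<odot> y) = dilate a x \<odot> dilate a y"
  by (cases x; cases y) (simp add: power2_eq_square field_simps)

lemma dilate_inv: "dilate a (heis_inv x) = heis_inv (dilate a x)"
  by (cases x) simp

lemma dilate_dilate: "dilate a (dilate b x) = dilate (a * b) x"
  by (cases x) (simp add: power2_eq_square)

lemma dilate_one [simp]: "dilate 1 x = x"
  by (cases x) simp

lemma dilate_zero [simp]: "dilate a 0 = 0"
  by (simp add: zero_prod_def)

lemma dilate_null [simp]: "dilate 0 x = 0"
  by (cases x) (simp add: zero_prod_def)

text \<open>In iterated coordinates the group operations are triangular, so that their effect on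
  Lebesgue measure reduces to one-dimensional affine substitutions.\<close>

lemma nn_integral_lborel_heis:
  assumes [measurable]: "f \<in> borel_measurable (borel :: heis measure)"
  shows "(\<integral>\<^sup>+x. f x \<partial>lborel) = (\<integral>\<^sup>+p. \<integral>\<^sup>+q. \<integral>\<^sup>+t. f (p, q, t) \<partial>lborel \<partial>lborel \<partial>lborel)"
proof -
  have 1: "f \<in> borel_measurable (lborel \<Otimes>\<^sub>M (lborel \<Otimes>\<^sub>M lborel))"
    by (simp add: lborel_prod)
  have 2: "(\<lambda>y. f (p, y)) \<in> borel_measurable (lborel \<Otimes>\<^sub>M lborel)" for p
    by (simp add: lborel_prod) measurable
  have "(\<integral>\<^sup>+x. f x \<partial>lborel) = (\<integral>\<^sup>+x. f x \<partial>(lborel \<Otimes>\<^sub>M lborel))"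
    by (simp add: lborel_prod)
  also have "\<dots> = (\<integral>\<^sup>+p. \<integral>\<^sup>+y. f (p, y) \<partial>lborel \<partial>lborel)"
    by (rule lborel.nn_integral_fst[symmetric]) (simp add: lborel_prod)
  also have "\<dots> = (\<integral>\<^sup>+p. \<integral>\<^sup>+y. f (p, y) \<partial>(lborel \<Otimes>\<^sub>M lborel) \<partial>lborel)"
    by (simp add: lborel_prod)
  also have "\<dots> = (\<integral>\<^sup>+p. \<integral>\<^sup>+q. \<integral>\<^sup>+t. f (p, q, t) \<partial>lborel \<partial>lborel \<partial>lborel)"
    using lborel.nn_integral_fst[OF 2] by simp
  finally show ?thesis .
qed

lemma nn_integral_affine_lborel:
  assumes "f \<in> borel_measurable borel" "c \<noteq> 0"
  shows "(\<integral>\<^sup>+x. f (t + c * x) \<partial>lborel) = ennreal (1 / \<bar>c\<bar>) * (\<integral>\<^sup>+x. f x \<partial>lborel)"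
  using nn_integral_real_affine[OF assms, of t] assms(2)
  by (simp add: mult.assoc[symmetric] ennreal_mult[symmetric])

text \<open>For fixed \<open>p\<close> and \<open>q\<close> the twisting term of the group law is a
  constant shift of the central coordinate; the innermost integral absorbs it, after which
  \<open>q\<close> and \<open>p\<close> are shifted in turn.\<close>

lemma nn_integral_heis_left:
  assumes [measurable]: "f \<in> borel_measurable (borel :: heis measure)"
  shows "(\<integral>\<^sup>+x. f (y \<odot> x) \<partial>lborel) = (\<integral>\<^sup>+x. f x \<partial>lborel)"
proof -
  obtain a b c where y: "y = (a, b, c)" by (cases y)
  have 1: "(\<integral>\<^sup>+t. f (a + p, b + q, c + t + (a * q - b * p) / 2) \<partial>lborel) = (\<integral>\<^sup>+t. f (a + p, b + q, t) \<partial>lborel)" for p q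
    using nn_integral_affine_lborel[of "\<lambda>t. f (a + p, b + q, t)" 1 "c + (a * q - b * p) / 2"]
    by (simp add: ac_simps)
  have 2: "(\<integral>\<^sup>+q. \<integral>\<^sup>+t. f (a + p, b + q, t) \<partial>lborel \<partial>lborel) = (\<integral>\<^sup>+q. \<integral>\<^sup>+t. f (a + p, q, t) \<partial>lborel \<partial>lborel)" for p
    using nn_integral_affine_lborel[of "\<lambda>q. \<integral>\<^sup>+t. f (a + p, q, t) \<partial>lborel" 1 b]
    by simp
  have 3: "(\<integral>\<^sup>+p. \<integral>\<^sup>+q. \<integral>\<^sup>+t. f (a + p, q, t) \<partial>lborel \<partial>lborel \<partial>lborel) = (\<integral>\<^sup>+p. \<integral>\<^sup>+q. \<integral>\<^sup>+t. f (p, q, t) \<partial>lborel \<partial>lborel \<partial>lborel)"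
    using nn_integral_affine_lborel[of "\<lambda>p. \<integral>\<^sup>+q. \<integral>\<^sup>+t. f (p, q, t) \<partial>lborel \<partial>lborel" 1 a]
    by simp
  show ?thesis
    by (subst (1 2) nn_integral_lborel_heis) (simp_all add: y 1 2 3)
qed

lemma nn_integral_heis_inv:
  assumes [measurable]: "f \<in> borel_measurable (borel :: heis measure)"
  shows "(\<integral>\<^sup>+x. f (heis_inv x) \<partial>lborel) = (\<integral>\<^sup>+x. f x \<partial>lborel)"
proof -
  have 1: "(\<integral>\<^sup>+t. f (- p, - q, - t) \<partial>lborel) = (\<integral>\<^sup>+t. f (- p, - q, t) \<partial>lborel)" for p q
    using nn_integral_affine_lborel[of "\<lambda>t. f (- p, - q, t)" "-1" 0] by simp
  have 2: "(\<integral>\<^sup>+q. \<integral>\<^sup>+t. f (- p, - q, t) \<partial>lborel \<partial>lborel) = (\<integral>\<^sup>+q. \<integral>\<^sup>+t. f (- p, q, t) \<partial>lborel \<partial>lborel)" for p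
    using nn_integral_affine_lborel[of "\<lambda>q. \<integral>\<^sup>+t. f (- p, q, t) \<partial>lborel" "-1" 0]
    by simp
  have 3: "(\<integral>\<^sup>+p. \<integral>\<^sup>+q. \<integral>\<^sup>+t. f (- p, q, t) \<partial>lborel \<partial>lborel \<partial>lborel) = (\<integral>\<^sup>+p. \<integral>\<^sup>+q. \<integral>\<^sup>+t. f (p, q, t) \<partial>lborel \<partial>lborel \<partial>lborel)"
    using nn_integral_affine_lborel[of "\<lambda>p. \<integral>\<^sup>+q. \<integral>\<^sup>+t. f (p, q, t) \<partial>lborel \<partial>lborel" "-1" 0]
    by simp
  show ?thesis
    by (subst (1 2) nn_integral_lborel_heis) (simp_all add: 1 2 3)
qed

text \<open>Conjugation with the inversion turns right translations into left ones, so unimodularity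
  comes from the two preceding invariances.\<close>

lemma nn_integral_heis_right:
  assumes [measurable]: "f \<in> borel_measurable (borel :: heis measure)"
  shows "(\<integral>\<^sup>+x. f (x \<odot> y) \<partial>lborel) = (\<integral>\<^sup>+x. f x \<partial>lborel)"
proof -
  have "(\<integral>\<^sup>+x. f (x \<odot> y) \<partial>lborel) = (\<integral>\<^sup>+x. f (heis_inv (heis_inv y \<odot> heis_inv x)) \<partial>lborel)"
    by (simp add: heis_inv_mult)
  also have "\<dots> = (\<integral>\<^sup>+x. f (heis_inv (heis_inv y \<odot> x)) \<partial>lborel)"
    by (rule nn_integral_heis_inv[of "\<lambda>x. f (heis_inv (heis_inv y \<odot> x))"]) measurable
  also have "\<dots> = (\<integral>\<^sup>+x. f (heis_inv x) \<partial>lborel)"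
    by (rule nn_integral_heis_left[of "\<lambda>x. f (heis_inv x)"]) measurable
  also have "\<dots> = (\<integral>\<^sup>+x. f x \<partial>lborel)"
    by (rule nn_integral_heis_inv) measurable
  finally show ?thesis .
qed

text \<open>The weights 1, 1 and 2 of the coordinates add up to the homogeneous dimension 4.\<close>

lemma nn_integral_dilate:
  assumes [measurable]: "f \<in> borel_measurable (borel :: heis measure)" and "a > 0"
  shows "(\<integral>\<^sup>+x. f (dilate a x) \<partial>lborel) = ennreal (1 / a ^ 4) * (\<integral>\<^sup>+x. f x \<partial>lborel)"
proof -
  have 1: "(\<integral>\<^sup>+t. f (a * p, a * q, a\<^sup>2 * t) \<partial>lborel) = ennreal (1 / a\<^sup>2) * (\<integral>\<^sup>+t. f (a * p, a * q, t) \<partial>lborel)" for p q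
    using nn_integral_affine_lborel[of "\<lambda>t. f (a * p, a * q, t)" "a\<^sup>2" 0] \<open>a > 0\<close> by simp
  have 2: "(\<integral>\<^sup>+q. \<integral>\<^sup>+t. f (a * p, a * q, t) \<partial>lborel \<partial>lborel) = ennreal (1 / a) * (\<integral>\<^sup>+q. \<integral>\<^sup>+t. f (a * p, q, t) \<partial>lborel \<partial>lborel)" for p
    using nn_integral_affine_lborel[of "\<lambda>q. \<integral>\<^sup>+t. f (a * p, q, t) \<partial>lborel" a 0] \<open>a > 0\<close>
    by simp
  have 3: "(\<integral>\<^sup>+p. \<integral>\<^sup>+q. \<integral>\<^sup>+t. f (a * p, q, t) \<partial>lborel \<partial>lborel \<partial>lborel) = ennreal (1 / a) * (\<integral>\<^sup>+p. \<integral>\<^sup>+q. \<integral>\<^sup>+t. f (p, q, t) \<partial>lborel \<partial>lborel \<partial>lborel)"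
    using nn_integral_affine_lborel[of "\<lambda>p. \<integral>\<^sup>+q. \<integral>\<^sup>+t. f (p, q, t) \<partial>lborel \<partial>lborel" a 0] \<open>a > 0\<close>
    by simp
  have 4: "ennreal (1 / a\<^sup>2) * (ennreal (1 / a) * (ennreal (1 / a) * z)) = ennreal (1 / a ^ 4) * z" for z
    using \<open>a > 0\<close> by (simp add: mult.assoc[symmetric] ennreal_mult[symmetric]) (simp add: power2_eq_square power4_eq_xxxx)
  show ?thesis
    by (subst (1 2) nn_integral_lborel_heis) (simp_all add: 1 2 3 4 nn_integral_cmult)
qed

text \<open>Upgrades an identity of nonnegative integrals to invariance of the measure; the Bochner
  integral statements then follow for every value type.\<close>

lemma distr_lborel_eq:
  assumes [measurable]: "T \<in> borel_measurable borel"
    and "\<And>f. f \<in> borel_measurable (borel :: heis measure) \<Longrightarrow> (\<integral>\<^sup>+x. f (T x) \<partial>lborel) = (\<integral>\<^sup>+x. f x \<partial>lborel)"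
  shows "distr lborel lborel T = (lborel :: heis measure)"
proof (rule measure_eqI)
  fix A assume "A \<in> sets (distr lborel lborel T)"
  then have A [measurable]: "A \<in> sets borel" by simp
  have "emeasure (distr lborel lborel T) A = (\<integral>\<^sup>+x. indicator A x \<partial>distr lborel lborel T)"
    by (simp add: A)
  also have "\<dots> = (\<integral>\<^sup>+x. indicator A (T x) \<partial>lborel)"
    by (rule nn_integral_distr) measurable
  also have "\<dots> = (\<integral>\<^sup>+x. indicator A x \<partial>lborel)"
    by (rule assms(2)) measurable
  finally show "emeasure (distr lborel lborel T) A = emeasure lborel A"
    by (simp add: A)
qed simp

context
  fixes f :: "heis \<Rightarrow> 'b::{banach, second_countable_topology}"
  assumes f [measurable]: "f \<in> borel_measurable borel"
begin

lemma integral_heis_left: "(LINT x|lborel. f (y \<odot> x)) = (LINT x|lborel. f x)"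
  using integral_distr[of "\<lambda>x. y \<odot> x" lborel lborel f] distr_lborel_eq[of "\<lambda>x. y \<odot> x"] nn_integral_heis_left
  by simp

lemma integrable_heis_left: "integrable lborel (\<lambda>x. f (y \<odot> x)) \<longleftrightarrow> integrable lborel f"
  using integrable_distr_eq[of "\<lambda>x. y \<odot> x" lborel lborel f] distr_lborel_eq[of "\<lambda>x. y \<odot> x"] nn_integral_heis_left
  by simp

lemma integral_heis_right: "(LINT x|lborel. f (x \<odot> y)) = (LINT x|lborel. f x)"
  using integral_distr[of "\<lambda>x. x \<odot> y" lborel lborel f] distr_lborel_eq[of "\<lambda>x. x \<odot> y"] nn_integral_heis_right
  by simp

lemma integral_heis_inv: "(LINT x|lborel. f (heis_inv x)) = (LINT x|lborel. f x)"
  using integral_distr[of heis_inv lborel lborel f] distr_lborel_eq[of heis_inv] nn_integral_heis_inv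
  by simp

lemma integrable_heis_inv: "integrable lborel (\<lambda>x. f (heis_inv x)) \<longleftrightarrow> integrable lborel f"
  using integrable_distr_eq[of heis_inv lborel lborel f] distr_lborel_eq[of heis_inv] nn_integral_heis_inv
  by simp

lemma
  assumes "a > 0"
  shows integral_dilate: "(LINT x|lborel. f (dilate a x)) = (1 / a ^ 4) *\<^sub>R (LINT x|lborel. f x)"
    and integrable_dilate: "integrable lborel (\<lambda>x. f (dilate a x)) \<longleftrightarrow> integrable lborel f"
proof -
  \<comment> \<open>Weighting the image measure by \<open>a ^ 4\<close> undoes the Jacobian, so
    integrability and integral can both be read off from one identity of measures.\<close>
  have eq: "density (distr lborel lborel (dilate a)) (\<lambda>_. ennreal (a ^ 4)) = (lborel :: heis measure)"
  proof (rule measure_eqI)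
    fix A assume "A \<in> sets (density (distr lborel lborel (dilate a)) (\<lambda>_. ennreal (a ^ 4)))"
    then have A [measurable]: "A \<in> sets borel" by simp
    have "emeasure (density (distr lborel lborel (dilate a)) (\<lambda>_. ennreal (a ^ 4))) A =
        ennreal (a ^ 4) * (\<integral>\<^sup>+x. indicator A x \<partial>distr lborel lborel (dilate a))"
      by (subst emeasure_density) (simp_all add: nn_integral_cmult)
    also have "(\<integral>\<^sup>+x. indicator A x \<partial>distr lborel lborel (dilate a)) = (\<integral>\<^sup>+x. indicator A (dilate a x) \<partial>lborel)"
      by (rule nn_integral_distr) measurable
    also have "\<dots> = ennreal (1 / a ^ 4) * (\<integral>\<^sup>+x. indicator A x \<partial>lborel)"
      by (rule nn_integral_dilate[OF _ \<open>a > 0\<close>]) measurable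
    also have "ennreal (a ^ 4) * \<dots> = (\<integral>\<^sup>+x. indicator A x \<partial>lborel)"
      using \<open>a > 0\<close> by (simp add: mult.assoc[symmetric] ennreal_mult[symmetric])
    finally show "emeasure (density (distr lborel lborel (dilate a)) (\<lambda>_. ennreal (a ^ 4))) A = emeasure lborel A"
      by simp
  qed simp
  have "integrable lborel f \<longleftrightarrow> integrable (density (distr lborel lborel (dilate a)) (\<lambda>_. ennreal (a ^ 4))) f"
    by (simp add: eq)
  also have "\<dots> \<longleftrightarrow> integrable lborel (\<lambda>x. a ^ 4 *\<^sub>R f (dilate a x))"
    using \<open>a > 0\<close> by (subst integrable_density) (simp_all add: integrable_distr_eq)
  also have "\<dots> \<longleftrightarrow> integrable lborel (\<lambda>x. f (dilate a x))"
    using integrable_scaleR_right[of "1 / a ^ 4" lborel "\<lambda>x. a ^ 4 *\<^sub>R f (dilate a x)"] \<open>a > 0\<close>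
    by auto
  finally show "integrable lborel (\<lambda>x. f (dilate a x)) \<longleftrightarrow> integrable lborel f" by simp
  have "(LINT x|lborel. f x) = (LINT x|density (distr lborel lborel (dilate a)) (\<lambda>_. ennreal (a ^ 4)). f x)"
    by (simp add: eq)
  also have "\<dots> = (a ^ 4) *\<^sub>R (LINT x|lborel. f (dilate a x))"
    using \<open>a > 0\<close> by (subst integral_density) (simp_all add: integral_distr)
  finally show "(LINT x|lborel. f (dilate a x)) = (1 / a ^ 4) *\<^sub>R (LINT x|lborel. f x)"
    using \<open>a > 0\<close> by simp
qed

end
section \<open>Invariant vector fields and positive definite functions\<close>

lemma Basis_heis: "(Basis :: heis set) = {(1, 0, 0), (0, 1, 0), (0, 0, 1)}"
  by (auto simp: Basis_prod_def zero_prod_def)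

lemma sum_Basis_heis: "(\<Sum>b\<in>Basis. f b) = f (1, 0, 0) + f (0, 1, 0) + f (0 :: real, 0 :: real, 1 :: real)"
  for f :: "heis \<Rightarrow> real"
  by (simp add: Basis_heis ac_simps)

text \<open>The left-invariant field with value \<open>v\<close> at the identity; the central
  correction is what the twisting term of \<open>x \<odot> (r *\<^sub>R v)\<close> contributes to
  first order in \<open>r\<close>.\<close>

definition lfield :: "heis \<Rightarrow> (heis \<Rightarrow> real) \<Rightarrow> heis \<Rightarrow> real" where
  "lfield v f x = dir_deriv (v + (0, 0, (fst x * fst (snd v) - fst (snd x) * fst v) / 2)) f x"

text \<open>The right-invariant counterpart, generated by \<open>(r *\<^sub>R v) \<odot> x\<close>.
  It enters because the kernel \<open>b (g\<inverse> g')\<close> sees a translation of its first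
  argument from the left.\<close>

definition rfield :: "heis \<Rightarrow> (heis \<Rightarrow> real) \<Rightarrow> heis \<Rightarrow> real" where
  "rfield v f x = dir_deriv (v - (0, 0, (fst x * fst (snd v) - fst (snd x) * fst v) / 2)) f x"

lemma dir_deriv_heis:
  assumes "f differentiable (at x)"
  shows "dir_deriv v f x = fst v * d_p f x + fst (snd v) * d_q f x + snd (snd v) * d_t f x"
  by (subst dir_deriv_Basis_sum[OF assms]) (simp add: sum_Basis_heis inner_prod_def)

lemma bounded_linear_coords:
  "bounded_linear (\<lambda>x::heis. fst x)" "bounded_linear (\<lambda>x::heis. fst (snd x))" "bounded_linear (\<lambda>x::heis. snd (snd x))"
  by (intro bounded_linear_intros)+

lemmas smooth_on_coords = bounded_linear_coords[THEN smooth_on_linear]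

lemma smooth_on_partial:
  assumes "smooth_on f S"
  shows "smooth_on (d_p f) S" "smooth_on (d_q f) S" "smooth_on (d_t f) S"
  by (auto intro!: smooth_on_dir_deriv_Basis[OF assms] simp: Basis_heis)

lemma smooth_on_lfield:
  assumes "smooth_on f UNIV"
  shows "smooth_on (lfield v f) UNIV"
proof -
  have "lfield v f = (\<lambda>x. fst v * d_p f x + fst (snd v) * d_q f x
      + (snd (snd v) + (fst (snd v) / 2 * fst x + - fst v / 2 * fst (snd x))) * d_t f x)"
    unfolding lfield_def
    by (subst dir_deriv_heis) (use smooth_on_differentiable[OF assms] in \<open>auto simp: field_simps\<close>)
  then show ?thesis
    by (simp only:) (intro smooth_on_add smooth_on_mult smooth_on_const smooth_on_coords smooth_on_partial assms open_UNIV)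
qed

lemma smooth_on_rfield:
  assumes "smooth_on f UNIV"
  shows "smooth_on (rfield v f) UNIV"
proof -
  have "rfield v f = (\<lambda>x. fst v * d_p f x + fst (snd v) * d_q f x
      + (snd (snd v) + (- fst (snd v) / 2 * fst x + fst v / 2 * fst (snd x))) * d_t f x)"
    unfolding rfield_def
    by (subst dir_deriv_heis) (use smooth_on_differentiable[OF assms] in \<open>auto simp: field_simps\<close>)
  then show ?thesis
    by (simp only:) (intro smooth_on_add smooth_on_mult smooth_on_const smooth_on_coords smooth_on_partial assms open_UNIV)
qed

lemma has_real_derivative_line:
  fixes f :: "'a::euclidean_space \<Rightarrow> real"
  assumes "f differentiable (at (x + r *\<^sub>R w))"
  shows "((\<lambda>r. f (x + r *\<^sub>R w)) has_real_derivative dir_deriv w f (x + r *\<^sub>R w)) (at r)"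
proof -
  have 1: "((\<lambda>r. x + r *\<^sub>R w) has_derivative (\<lambda>s. s *\<^sub>R w)) (at r)"
    by (auto intro!: derivative_eq_intros)
  have "((\<lambda>r. f (x + r *\<^sub>R w)) has_derivative (\<lambda>s. dir_deriv (s *\<^sub>R w) f (x + r *\<^sub>R w))) (at r)"
    by (rule has_derivative_compose[OF 1 has_derivative_dir_deriv[OF assms]])
  then show ?thesis
    by (simp add: linear_cmul[OF linear_dir_deriv[OF assms]] has_field_derivative_def mult_commute_abs)
qed

text \<open>The group law is affine in each factor, so the integral curve is a straight line; since
  the twisting term vanishes on multiples of \<open>v\<close>, the field is constant along it and
  equals \<open>w\<close>. The formula therefore holds at every \<open>r\<close>, as the mean value
  theorem requires.\<close>

lemma has_real_derivative_lfield:
  assumes "f differentiable (at (x \<odot> (r *\<^sub>R v)))"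
  shows "((\<lambda>r. f (x \<odot> (r *\<^sub>R v))) has_real_derivative lfield v f (x \<odot> (r *\<^sub>R v))) (at r)"
proof -
  define w where "w = v + (0, 0, (fst x * fst (snd v) - fst (snd x) * fst v) / 2)"
  have eq: "x \<odot> (r *\<^sub>R v) = x + r *\<^sub>R w" for r
    by (cases x; cases v) (simp add: w_def field_simps)
  have "lfield v f (x \<odot> (r *\<^sub>R v)) = dir_deriv w f (x + r *\<^sub>R w)"
    unfolding lfield_def eq by (cases x; cases v) (simp add: w_def field_simps)
  then show ?thesis
    using has_real_derivative_line[of f x r w] assms by (simp add: eq)
qed

lemma has_real_derivative_rfield:
  assumes "f differentiable (at ((r *\<^sub>R v) \<odot> x))"
  shows "((\<lambda>r. f ((r *\<^sub>R v) \<odot> x)) has_real_derivative rfield v f ((r *\<^sub>R v) \<odot> x)) (at r)"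
proof -
  define w where "w = v - (0, 0, (fst x * fst (snd v) - fst (snd x) * fst v) / 2)"
  have eq: "(r *\<^sub>R v) \<odot> x = x + r *\<^sub>R w" for r
    by (cases x; cases v) (simp add: w_def field_simps)
  have "rfield v f ((r *\<^sub>R v) \<odot> x) = dir_deriv w f (x + r *\<^sub>R w)"
    unfolding rfield_def eq by (cases x; cases v) (simp add: w_def field_simps)
  then show ?thesis
    using has_real_derivative_line[of f x r w] assms by (simp add: eq)
qed

section \<open>Mixed differences and bordered positive semidefinite kernels\<close>

lemma heis_mult_zero [simp]: "x \<odot> 0 = x" "0 \<odot> x = x"
  by (simp_all add: heis_group)

lemma tendsto_sum_list:
  fixes f :: "'a \<Rightarrow> 'b \<Rightarrow> 'c::topological_monoid_add"
  assumes "\<And>x. x \<in> set xs \<Longrightarrow> ((\<lambda>r. f r x) \<longlongrightarrow> l x) F"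
  shows "((\<lambda>r. \<Sum>x\<leftarrow>xs. f r x) \<longlongrightarrow> (\<Sum>x\<leftarrow>xs. l x)) F"
  using assms by (induction xs) (auto intro!: tendsto_add)

text \<open>The mean value theorem is applied once in the left and once in the right translation
  parameter. Both intermediate parameters lie below \<open>r\<close>, and continuity of the mixed
  derivative gives the limit. The sign comes from the left translation being by
  \<open>- r\<close>.\<close>

lemma mixed_difference_tendsto:
  assumes b: "smooth_on b UNIV"
  shows "((\<lambda>r. (b ((- r *\<^sub>R v) \<odot> x \<odot> (r *\<^sub>R v)) - b ((- r *\<^sub>R v) \<odot> x) - b (x \<odot> (r *\<^sub>R v)) + b x) / r\<^sup>2)
     \<longlongrightarrow> - lfield v (rfield v b) x) (at_right 0)"
proof -
  define c where "c = rfield v b"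
  have c: "smooth_on c UNIV" unfolding c_def by (rule smooth_on_rfield[OF b])
  have db: "b differentiable (at x)" and dc: "c differentiable (at x)" for x
    using b c smooth_on_differentiable by auto
  define D where "D r = (b ((- r *\<^sub>R v) \<odot> x \<odot> (r *\<^sub>R v)) - b ((- r *\<^sub>R v) \<odot> x) - b (x \<odot> (r *\<^sub>R v)) + b x) / r\<^sup>2" for r
  have ex: "\<exists>s u. 0 < s \<and> s < r \<and> 0 < u \<and> u < r \<and> D r = - lfield v c ((- s *\<^sub>R v) \<odot> x \<odot> (u *\<^sub>R v))" if "r > 0" for r
  proof -
    define G where "G s = b ((- s *\<^sub>R v) \<odot> (x \<odot> (r *\<^sub>R v))) - b ((- s *\<^sub>R v) \<odot> x)" for s
    have 1: "((\<lambda>s. b ((- s *\<^sub>R v) \<odot> y)) has_real_derivative - c ((- s *\<^sub>R v) \<odot> y)) (at s)" for y s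
      using DERIV_chain2[OF has_real_derivative_rfield[where f = b and r = "- s" and v = v and x = y, OF db] DERIV_minus[OF DERIV_ident]]
      by (simp add: c_def)
    have "\<exists>s. s > 0 \<and> s < r \<and> G r - G 0 = (r - 0) * (- c ((- s *\<^sub>R v) \<odot> (x \<odot> (r *\<^sub>R v))) - - c ((- s *\<^sub>R v) \<odot> x))"
      unfolding G_def by (rule MVT2[OF that]) (intro derivative_intros 1)
    then obtain s where s: "s > 0" "s < r"
      "G r - G 0 = r * (- c ((- s *\<^sub>R v) \<odot> (x \<odot> (r *\<^sub>R v))) - - c ((- s *\<^sub>R v) \<odot> x))" by auto
    have "\<exists>u. u > 0 \<and> u < r \<and> c (((- s *\<^sub>R v) \<odot> x) \<odot> (r *\<^sub>R v)) - c (((- s *\<^sub>R v) \<odot> x) \<odot> (0 *\<^sub>R v)) = (r - 0) * lfield v c (((- s *\<^sub>R v) \<odot> x) \<odot> (u *\<^sub>R v))"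
      by (rule MVT2[OF that]) (intro has_real_derivative_lfield dc)
    then obtain u where u: "u > 0" "u < r"
      "c (((- s *\<^sub>R v) \<odot> x) \<odot> (r *\<^sub>R v)) - c ((- s *\<^sub>R v) \<odot> x) = r * lfield v c (((- s *\<^sub>R v) \<odot> x) \<odot> (u *\<^sub>R v))" by auto
    have "G r - G 0 = - r * (r * lfield v c (((- s *\<^sub>R v) \<odot> x) \<odot> (u *\<^sub>R v)))"
      unfolding s(3) u(3)[symmetric] by (simp add: heis_group(1) field_simps)
    then have "D r = - lfield v c (((- s *\<^sub>R v) \<odot> x) \<odot> (u *\<^sub>R v))"
      using that unfolding D_def G_def by (simp add: heis_group(1) power2_eq_square field_simps)
    then show ?thesis using s u by blast
  qed
  then obtain S U where SU: "\<And>r. r > 0 \<Longrightarrow> 0 < S r \<and> S r < r \<and> 0 < U r \<and> U r < r \<and> D r = - lfield v c ((- S r *\<^sub>R v) \<odot> x \<odot> (U r *\<^sub>R v))"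
    by metis
  have id: "((\<lambda>r::real. r) \<longlongrightarrow> 0) (at_right 0)" by (rule tendsto_ident_at)
  have S0: "(S \<longlongrightarrow> 0) (at_right 0)" and U0: "(U \<longlongrightarrow> 0) (at_right 0)"
    by (rule tendsto_sandwich[OF _ _ tendsto_const[of 0] id]; use SU in \<open>force simp: eventually_at_right_less intro!: eventually_at_rightI[of 0 1]\<close>)+
  have cont: "continuous_on UNIV (\<lambda>(s, u). - lfield v c ((- s *\<^sub>R v) \<odot> x \<odot> (u *\<^sub>R v)))"
    unfolding case_prod_beta
    by (intro continuous_intros continuous_on_compose2[OF smooth_on_continuous[OF smooth_on_lfield[OF c]]]) auto
  have "((\<lambda>r. (S r, U r)) \<longlongrightarrow> (0, 0)) (at_right 0)" by (intro tendsto_Pair S0 U0)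
  from continuous_on_tendsto_compose[OF cont this]
  have "((\<lambda>r. - lfield v c ((- S r *\<^sub>R v) \<odot> x \<odot> (U r *\<^sub>R v))) \<longlongrightarrow> - lfield v c x) (at_right 0)"
    by (simp add: heis_group)
  then have "(D \<longlongrightarrow> - lfield v c x) (at_right 0)"
    by (rule Lim_transform_eventually) (use SU in \<open>auto intro!: eventually_at_rightI[of 0 1]\<close>)
  then show ?thesis unfolding D_def c_def .
qed

text \<open>A function \<open>f\<close> is controlled by \<open>b\<close> when the kernel \<open>b (g\<inverse> g')\<close>, bordered by the translates of \<open>f\<close>
  and the constant \<open>C\<close>, is positive semidefinite. Taking limits of difference quotients preserves this.\<close>

definition pd_controls :: "real \<Rightarrow> (heis \<Rightarrow> real) \<Rightarrow> (heis \<Rightarrow> real) \<Rightarrow> bool" where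
  "pd_controls C f b \<longleftrightarrow> (\<forall>\<omega> l. \<forall>L :: (real \<times> heis) list.
     0 \<le> l\<^sup>2 * C + 2 * l * (\<Sum>x\<leftarrow>L. fst x * f (\<omega> \<odot> snd x))
       + (\<Sum>x\<leftarrow>L. \<Sum>y\<leftarrow>L. fst x * fst y * b (heis_inv (snd x) \<odot> snd y)))"

lemma heis_inv_scaleR: "heis_inv (r *\<^sub>R v) = (- r) *\<^sub>R v"
  by (simp add: heis_inv_eq)

text \<open>Every weighted point is replaced by the pair of weighted points of a difference quotient
  along \<open>v\<close>. This turns the border into a difference quotient of \<open>f\<close>. In
  the kernel, \<open>heis_inv (x \<odot> (r *\<^sub>R v)) \<odot> (y \<odot> (r *\<^sub>R
  v))\<close> translates the argument of \<open>b\<close> on both sides, hence the mixed second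
  difference. The constant \<open>C\<close> survives unchanged.\<close>

lemma pd_controls_step:
  assumes pd: "pd_controls C f b" and f: "smooth_on f UNIV" and b: "smooth_on b UNIV"
  shows "pd_controls C (lfield v f) (\<lambda>x. - lfield v (rfield v b) x)"
  unfolding pd_controls_def
proof (intro allI)
  fix \<omega> l and L :: "(real \<times> heis) list"
  define M where "M r = map (\<lambda>x. (fst x / r, snd x \<odot> (r *\<^sub>R v))) L @ map (\<lambda>x. (- fst x / r, snd x)) L" for r
  define A where "A r x = fst x * ((f (\<omega> \<odot> snd x \<odot> (r *\<^sub>R v)) - f (\<omega> \<odot> snd x)) / r)" for r and x :: "real \<times> heis"
  define B where "B r x y = fst x * fst y * ((b ((- r *\<^sub>R v) \<odot> (heis_inv (snd x) \<odot> snd y) \<odot> (r *\<^sub>R v)) - b ((- r *\<^sub>R v) \<odot> (heis_inv (snd x) \<odot> snd y))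
     - b (heis_inv (snd x) \<odot> snd y \<odot> (r *\<^sub>R v)) + b (heis_inv (snd x) \<odot> snd y)) / r\<^sup>2)" for r and x y :: "real \<times> heis"
  have 1: "(\<Sum>x\<leftarrow>M r. fst x * f (\<omega> \<odot> snd x)) = (\<Sum>x\<leftarrow>L. A r x)" for r
    unfolding M_def A_def
    by (simp add: o_def sum_list_addf[symmetric] heis_group(1) diff_divide_distrib right_diff_distrib)
  have 2: "(\<Sum>x\<leftarrow>M r. \<Sum>y\<leftarrow>M r. fst x * fst y * b (heis_inv (snd x) \<odot> snd y)) = (\<Sum>x\<leftarrow>L. \<Sum>y\<leftarrow>L. B r x y)" for r
    unfolding M_def
    by (simp add: o_def sum_list_addf[symmetric])
       ((rule arg_cong[where f = sum_list], rule map_cong[OF refl])+,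
        simp add: B_def heis_inv_mult heis_inv_scaleR heis_group(1) power2_eq_square
         diff_divide_distrib add_divide_distrib algebra_simps)
  have nn: "0 \<le> l\<^sup>2 * C + 2 * l * (\<Sum>x\<leftarrow>L. A r x) + (\<Sum>x\<leftarrow>L. \<Sum>y\<leftarrow>L. B r x y)" for r
    using pd[unfolded pd_controls_def, rule_format, where l = l and L = "M r" and \<omega> = \<omega>] unfolding 1 2 .
  have A: "((\<lambda>r. A r x) \<longlongrightarrow> fst x * lfield v f (\<omega> \<odot> snd x)) (at_right 0)" for x
  proof -
    have "((\<lambda>r. f (\<omega> \<odot> snd x \<odot> (r *\<^sub>R v))) has_real_derivative lfield v f (\<omega> \<odot> snd x)) (at 0)"
      using has_real_derivative_lfield[where f = f and r = 0 and v = v and x = "\<omega> \<odot> snd x",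
          OF smooth_on_differentiable[OF f UNIV_I]] by simp
    then have "((\<lambda>r. (f (\<omega> \<odot> snd x \<odot> (r *\<^sub>R v)) - f (\<omega> \<odot> snd x)) / r) \<longlongrightarrow> lfield v f (\<omega> \<odot> snd x)) (at_right 0)"
      by (simp add: has_field_derivative_iff) (rule filterlim_mono, auto simp: at_le)
    then show ?thesis unfolding A_def by (rule tendsto_mult_left)
  qed
  have B: "((\<lambda>r. B r x y) \<longlongrightarrow> fst x * fst y * - lfield v (rfield v b) (heis_inv (snd x) \<odot> snd y)) (at_right 0)" for x y
    unfolding B_def by (intro tendsto_mult_left mixed_difference_tendsto b)
  have "((\<lambda>r. l\<^sup>2 * C + 2 * l * (\<Sum>x\<leftarrow>L. A r x) + (\<Sum>x\<leftarrow>L. \<Sum>y\<leftarrow>L. B r x y)) \<longlongrightarrow>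
     l\<^sup>2 * C + 2 * l * (\<Sum>x\<leftarrow>L. fst x * lfield v f (\<omega> \<odot> snd x))
       + (\<Sum>x\<leftarrow>L. \<Sum>y\<leftarrow>L. fst x * fst y * - lfield v (rfield v b) (heis_inv (snd x) \<odot> snd y))) (at_right 0)"
    by (intro tendsto_add tendsto_const tendsto_mult_left tendsto_sum_list A B)
  then show "0 \<le> l\<^sup>2 * C + 2 * l * (\<Sum>x\<leftarrow>L. fst x * lfield v f (\<omega> \<odot> snd x))
       + (\<Sum>x\<leftarrow>L. \<Sum>y\<leftarrow>L. fst x * fst y * - lfield v (rfield v b) (heis_inv (snd x) \<odot> snd y))"
    by (rule tendsto_lowerbound) (auto intro: always_eventually nn)
qed

text \<open>A single point of weight 1 at the identity with \<open>l = 1\<close> and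
  \<open>l = -1\<close> suffices. This is Cauchy-Schwarz in its additive form; no optimal constant
  is aimed at.\<close>

lemma pd_controls_bounded:
  assumes "pd_controls C f b"
  shows "\<bar>f x\<bar> \<le> (C + b 0) / 2"
proof -
  have "0 \<le> l\<^sup>2 * C + 2 * l * f x + b 0" for l
    using assms[unfolded pd_controls_def, rule_format, where l = l and L = "[(1, 0)]" and \<omega> = x] by (simp add: heis_inv_eq)
  from this[of 1] this[of "-1"] show ?thesis by (simp add: abs_le_iff)
qed

text \<open>Only the number \<open>b 0\<close> enters the bound, so the controlling kernel may be
  differentiated repeatedly with nothing but its smoothness known.\<close>

lemma pd_controls_fields_bounded:
  assumes "pd_controls C f b" "smooth_on f UNIV" "smooth_on b UNIV"
  shows "\<exists>B. \<forall>x. \<bar>foldr lfield vs f x\<bar> \<le> B"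
proof -
  have "\<exists>b. pd_controls C (foldr lfield vs f) b \<and> smooth_on (foldr lfield vs f) UNIV \<and> smooth_on b UNIV"
  proof (induction vs)
    case Nil
    then show ?case using assms by auto
  next
    case (Cons v vs)
    then obtain b where b: "pd_controls C (foldr lfield vs f) b" "smooth_on (foldr lfield vs f) UNIV" "smooth_on b UNIV"
      by blast
    have "smooth_on (\<lambda>x. (-1) * lfield v (rfield v b) x) UNIV"
      by (intro smooth_on_mult smooth_on_const smooth_on_lfield smooth_on_rfield b open_UNIV)
    then show ?case
      using pd_controls_step[OF b, of v] smooth_on_lfield[OF b(2)] by auto
  qed
  then show ?thesis using pd_controls_bounded by blast
qed
section \<open>Gaussian decay and polynomial growth\<close>

text \<open>Homogeneous of degree 2 under dilations, like
  \<open>sqrt (p ^ 4 + q ^ 4 + t\<^sup>2)\<close>, which it dominates. Being a sum over the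
  coordinates, it makes exponentials factorize.\<close>

definition hnorm :: "heis \<Rightarrow> real" where
  "hnorm x = (fst x)\<^sup>2 + (fst (snd x))\<^sup>2 + \<bar>snd (snd x)\<bar>"

definition gauss :: "(heis \<Rightarrow> real) \<Rightarrow> bool" where
  "gauss f \<longleftrightarrow> (\<exists>C>0. \<exists>c>0. \<forall>x. \<bar>f x\<bar> \<le> C * exp (- c * hnorm x))"

definition poly_bounded :: "(heis \<Rightarrow> real) \<Rightarrow> bool" where
  "poly_bounded f \<longleftrightarrow> (\<exists>C n. \<forall>x. \<bar>f x\<bar> \<le> C * (1 + norm x) ^ n)"

lemma hnorm_nonneg [simp]: "0 \<le> hnorm x"
  by (simp add: hnorm_def)

lemma hnorm_dilate: "hnorm (dilate a x) = a\<^sup>2 * hnorm x"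
  by (cases x) (simp add: hnorm_def power_mult_distrib abs_mult algebra_simps)

lemma coord_le_norm: "\<bar>fst x\<bar> \<le> norm x" "\<bar>fst (snd x)\<bar> \<le> norm x" "\<bar>snd (snd x)\<bar> \<le> norm (x :: heis)"
proof -
  show "\<bar>fst x\<bar> \<le> norm x" using norm_fst_le[of "fst x" "snd x"] by simp
  have "norm (snd x) \<le> norm x" using norm_snd_le[of "snd x" "fst x"] by simp
  then show "\<bar>fst (snd x)\<bar> \<le> norm x" "\<bar>snd (snd x)\<bar> \<le> norm x"
    using norm_fst_le[of "fst (snd x)" "snd (snd x)"] norm_snd_le[of "snd (snd x)" "fst (snd x)"] by simp_all
qed

lemma norm_le_hnorm: "norm (x :: heis) \<le> 2 + hnorm x"
proof -
  have 1: "\<bar>a\<bar> \<le> 1 + a\<^sup>2" for a :: real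
    using zero_le_power2[of "\<bar>a\<bar> - 1/2"] by (simp add: power2_eq_square field_simps)
  have "norm x \<le> \<bar>fst x\<bar> + (\<bar>fst (snd x)\<bar> + \<bar>snd (snd x)\<bar>)"
    using norm_Pair_le[of "fst x" "snd x"] norm_Pair_le[of "fst (snd x)" "snd (snd x)"] by simp
  then show ?thesis using 1[of "fst x"] 1[of "fst (snd x)"] by (simp add: hnorm_def)
qed

text \<open>Follows from \<open>(1 + z / n) ^ n \<le> exp z\<close> with
  \<open>z = \<epsilon> * y\<close>, which also supplies the constant
  \<open>(n / \<epsilon>) ^ n\<close>.\<close>

lemma power_le_exp:
  assumes "\<epsilon> > 0"
  obtains C where "C > 0" "\<And>y::real. y \<ge> 0 \<Longrightarrow> y ^ n \<le> C * exp (\<epsilon> * y)"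
proof (cases "n = 0")
  case True
  then show ?thesis using that[of 1] assms by simp
next
  case False
  have "y ^ n \<le> (real n / \<epsilon>) ^ n * exp (\<epsilon> * y)" if "y \<ge> 0" for y
  proof -
    have "(\<epsilon> * y / real n) ^ n \<le> (1 + \<epsilon> * y / real n) ^ n"
      using assms that by (intro power_mono) auto
    also have "\<dots> \<le> exp (\<epsilon> * y)"
      using False assms that by (intro exp_ge_one_plus_x_over_n_power_n) (auto intro: order_trans[of _ 0])
    finally have "(real n / \<epsilon>) ^ n * (\<epsilon> * y / real n) ^ n \<le> (real n / \<epsilon>) ^ n * exp (\<epsilon> * y)"
      using assms by (intro mult_left_mono) auto
    then show ?thesis using False assms by (simp add: power_mult_distrib[symmetric])
  qed
  moreover have "(real n / \<epsilon>) ^ n > 0" using False assms by simp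
  ultimately show ?thesis using that by blast
qed

lemma poly_le_exp_hnorm:
  assumes "\<epsilon> > 0"
  obtains C where "C > 0" "\<And>x::heis. (1 + norm x) ^ n \<le> C * exp (\<epsilon> * hnorm x)"
proof -
  obtain C where C: "C > 0" "\<And>y::real. y \<ge> 0 \<Longrightarrow> y ^ n \<le> C * exp (\<epsilon> * y)"
    using power_le_exp[OF assms] by blast
  have "(1 + norm x) ^ n \<le> C * exp (\<epsilon> * 3) * exp (\<epsilon> * hnorm x)" for x :: heis
  proof -
    have "(1 + norm x) ^ n \<le> (3 + hnorm x) ^ n"
      using norm_le_hnorm[of x] by (intro power_mono) auto
    also have "\<dots> \<le> C * exp (\<epsilon> * (3 + hnorm x))" by (rule C(2)) simp
    finally show ?thesis by (simp add: distrib_left exp_add mult.assoc)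
  qed
  then show ?thesis using that[of "C * exp (\<epsilon> * 3)"] C(1) by simp
qed

text \<open>Half of the decay rate is spent on absorbing the polynomial.\<close>

lemma gauss_poly_mult:
  assumes "gauss f" "poly_bounded g"
  shows "gauss (\<lambda>x. g x * f x)"
proof -
  obtain C c where C: "C > 0" "c > 0" "\<And>x. \<bar>f x\<bar> \<le> C * exp (- c * hnorm x)"
    using assms(1) unfolding gauss_def by blast
  obtain B n where B: "\<And>x. \<bar>g x\<bar> \<le> B * (1 + norm x) ^ n"
    using assms(2) unfolding poly_bounded_def by blast
  obtain D where D: "D > 0" "\<And>x::heis. (1 + norm x) ^ n \<le> D * exp (c / 2 * hnorm x)"
    using poly_le_exp_hnorm[of "c / 2" n] C(2) by auto
  have "\<bar>g x * f x\<bar> \<le> ((\<bar>B\<bar> + 1) * D * C) * exp (- (c / 2) * hnorm x)" for x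
  proof -
    have "\<bar>g x\<bar> \<le> (\<bar>B\<bar> + 1) * (1 + norm x) ^ n"
      by (rule order_trans[OF B]) (intro mult_right_mono, auto)
    also have "\<dots> \<le> (\<bar>B\<bar> + 1) * (D * exp (c / 2 * hnorm x))"
      by (intro mult_left_mono D) auto
    finally have "\<bar>g x\<bar> * \<bar>f x\<bar> \<le> (\<bar>B\<bar> + 1) * (D * exp (c / 2 * hnorm x)) * (C * exp (- c * hnorm x))"
      by (intro mult_mono C) (use D in auto)
    also have "\<dots> = ((\<bar>B\<bar> + 1) * D * C) * (exp (c / 2 * hnorm x) * exp (- c * hnorm x))" by simp
    also have "exp (c / 2 * hnorm x) * exp (- c * hnorm x) = exp (- (c / 2) * hnorm x)"
      by (simp add: exp_add[symmetric])
    finally show ?thesis by (simp add: abs_mult)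
  qed
  moreover have "(\<bar>B\<bar> + 1) * D * C > 0" using C D by simp
  ultimately show ?thesis using C(2) unfolding gauss_def by (meson half_gt_zero)
qed

lemma gauss_add:
  assumes "gauss f" "gauss g"
  shows "gauss (\<lambda>x. f x + g x)"
proof -
  obtain C c where C: "C > 0" "c > 0" "\<And>x. \<bar>f x\<bar> \<le> C * exp (- c * hnorm x)"
    using assms(1) unfolding gauss_def by blast
  obtain D d where D: "D > 0" "d > 0" "\<And>x. \<bar>g x\<bar> \<le> D * exp (- d * hnorm x)"
    using assms(2) unfolding gauss_def by blast
  have "\<bar>f x + g x\<bar> \<le> (C + D) * exp (- min c d * hnorm x)" for x
  proof -
    have "C * exp (- c * hnorm x) \<le> C * exp (- min c d * hnorm x)" 
      "D * exp (- d * hnorm x) \<le> D * exp (- min c d * hnorm x)"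
      using C D by (auto intro!: mult_left_mono mult_right_mono)
    then show ?thesis using C(3)[of x] D(3)[of x] by (simp add: distrib_right)
  qed
  moreover have "C + D > 0" "min c d > 0" using C D by auto
  ultimately show ?thesis unfolding gauss_def by blast
qed

lemma poly_bounded_add:
  assumes "poly_bounded f" "poly_bounded g"
  shows "poly_bounded (\<lambda>x. f x + g x)"
proof -
  obtain C n D m where C: "\<And>x. \<bar>f x\<bar> \<le> C * (1 + norm x) ^ n" and D: "\<And>x. \<bar>g x\<bar> \<le> D * (1 + norm x) ^ m"
    using assms unfolding poly_bounded_def by blast
  have "\<bar>f x + g x\<bar> \<le> (\<bar>C\<bar> + \<bar>D\<bar>) * (1 + norm x) ^ (n + m)" for x
  proof -
    have "C * (1 + norm x) ^ n \<le> \<bar>C\<bar> * (1 + norm x) ^ (n + m)" "D * (1 + norm x) ^ m \<le> \<bar>D\<bar> * (1 + norm x) ^ (n + m)"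
      by (intro mult_mono power_increasing; simp)+
    then show ?thesis using C[of x] D[of x] by (simp add: distrib_right)
  qed
  then show ?thesis unfolding poly_bounded_def by blast
qed

lemma poly_bounded_mult:
  assumes "poly_bounded f" "poly_bounded g"
  shows "poly_bounded (\<lambda>x. f x * g x)"
proof -
  obtain C n D m where C: "\<And>x. \<bar>f x\<bar> \<le> C * (1 + norm x) ^ n" and D: "\<And>x. \<bar>g x\<bar> \<le> D * (1 + norm x) ^ m"
    using assms unfolding poly_bounded_def by blast
  have "\<bar>f x * g x\<bar> \<le> (C * D) * (1 + norm x) ^ (n + m)" for x
    using mult_mono[OF C[of x] D[of x]] order_trans[OF abs_ge_zero C[of x]]
    by (simp add: abs_mult power_add ac_simps)
  then show ?thesis unfolding poly_bounded_def by blast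
qed

lemma poly_bounded_const: "poly_bounded (\<lambda>_. c)"
  unfolding poly_bounded_def by (rule exI[of _ "\<bar>c\<bar>"], rule exI[of _ 0]) simp

lemma poly_bounded_coord: "poly_bounded fst" "poly_bounded (\<lambda>x. fst (snd x))"
proof -
  have "\<bar>fst x\<bar> \<le> 1 * (1 + norm x) ^ 1" "\<bar>fst (snd x)\<bar> \<le> 1 * (1 + norm x) ^ 1" for x :: heis
    using coord_le_norm(1,2)[of x] by simp_all
  then show "poly_bounded fst" "poly_bounded (\<lambda>x. fst (snd x))"
    unfolding poly_bounded_def by blast+
qed

lemma gauss_imp_gaussian_decay: "gauss f \<Longrightarrow> gaussian_decay f"
proof -
  assume "gauss f"
  then obtain C c where C: "C > 0" "c > 0" "\<And>x. \<bar>f x\<bar> \<le> C * exp (- c * hnorm x)"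
    unfolding gauss_def by blast
  have "\<bar>f (p, q, t)\<bar> \<le> C * exp (- c * sqrt (p ^ 4 + q ^ 4 + t\<^sup>2))" for p q t
  proof -
    have sq: "a\<^sup>2 + b\<^sup>2 + c\<^sup>2 \<le> (a + b + c)\<^sup>2" if "0 \<le> a" "0 \<le> b" "0 \<le> c" for a b c :: real
      using that by (simp add: power2_eq_square algebra_simps)
    have "p ^ 4 + q ^ 4 + t\<^sup>2 = (p\<^sup>2)\<^sup>2 + (q\<^sup>2)\<^sup>2 + \<bar>t\<bar>\<^sup>2" by simp
    also have "\<dots> \<le> (p\<^sup>2 + q\<^sup>2 + \<bar>t\<bar>)\<^sup>2" by (rule sq) auto
    finally have "sqrt (p ^ 4 + q ^ 4 + t\<^sup>2) \<le> hnorm (p, q, t)"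
      by (intro real_le_lsqrt) (auto simp: hnorm_def)
    then have "C * exp (- c * hnorm (p, q, t)) \<le> C * exp (- c * sqrt (p ^ 4 + q ^ 4 + t\<^sup>2))"
      using C by (auto intro!: mult_left_mono)
    then show ?thesis using C(3)[of "(p, q, t)"] by linarith
  qed
  then show ?thesis unfolding gaussian_decay_def using C by blast
qed

text \<open>A displacement of length at most 1 costs half of \<open>hnorm\<close> and an additive
  constant, so Gaussian decay survives at half the rate. The quadratic case is
  \<open>(a + 2 * \<delta>)\<^sup>2 \<ge> 0\<close>, which rearranges to \<open>(a +
  \<delta>)\<^sup>2 \<ge> a\<^sup>2 / 2 - \<delta>\<^sup>2\<close>.\<close>

lemma hnorm_add_Basis:
  assumes "v \<in> Basis" "0 \<le> \<delta>" "\<delta> \<le> 1"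
  shows "hnorm x / 2 - 1 \<le> hnorm (x + \<delta> *\<^sub>R v)"
proof -
  obtain p q t where x: "x = (p, q, t)" by (cases x)
  have sq: "a\<^sup>2 / 2 - 1 \<le> (a + \<delta>)\<^sup>2" for a
  proof -
    have "\<delta>\<^sup>2 \<le> 1" using assms by (simp add: power_le_one)
    then show ?thesis using zero_le_power2[of "a + 2 * \<delta>"] by (simp add: power2_eq_square field_simps)
  qed
  have 2: "\<bar>t\<bar> / 2 - 1 \<le> \<bar>t + \<delta>\<bar>" using assms by linarith
  have 4: "hnorm x = p\<^sup>2 + q\<^sup>2 + \<bar>t\<bar>" "hnorm (x + \<delta> *\<^sub>R (1, 0, 0)) = (p + \<delta>)\<^sup>2 + q\<^sup>2 + \<bar>t\<bar>"
    "hnorm (x + \<delta> *\<^sub>R (0, 1, 0)) = p\<^sup>2 + (q + \<delta>)\<^sup>2 + \<bar>t\<bar>" "hnorm (x + \<delta> *\<^sub>R (0, 0, 1)) = p\<^sup>2 + q\<^sup>2 + \<bar>t + \<delta>\<bar>"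
    by (simp_all add: x hnorm_def)
  have "v = (1, 0, 0) \<or> v = (0, 1, 0) \<or> v = (0, 0, 1)" using assms(1) by (simp add: Basis_heis)
  then consider "x + \<delta> *\<^sub>R v = x + \<delta> *\<^sub>R (1, 0, 0)" | "x + \<delta> *\<^sub>R v = x + \<delta> *\<^sub>R (0, 1, 0)" | "x + \<delta> *\<^sub>R v = x + \<delta> *\<^sub>R (0, 0, 1)"
    by blast
  moreover have lin: "(A + B + C) / 2 - 1 \<le> D + B + C" "(B + A + C) / 2 - 1 \<le> B + D + C" "(B + C + A) / 2 - 1 \<le> B + C + D"
    if "A / 2 - 1 \<le> D" "0 \<le> B" "0 \<le> C" for A B C D :: real
    using that by (simp_all add: field_simps)
  ultimately show ?thesis
  proof cases
    case 1
    show ?thesis unfolding 1 4 by (rule lin) (use sq in auto)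
  next
    case 2
    show ?thesis unfolding 2 4 by (rule lin) (use sq in auto)
  next
    case 3
    show ?thesis unfolding 3 4 by (rule lin) (use \<open>\<bar>t\<bar> / 2 - 1 \<le> \<bar>t + \<delta>\<bar>\<close> in auto)
  qed
qed

text \<open>Landau's interpolation argument, with a step \<open>\<delta>\<close> that is itself a Gaussian.\<close>

lemma gauss_dir_deriv:
  assumes f: "smooth_on f UNIV" and "v \<in> Basis" and "gauss f" and "poly_bounded (dir_deriv v (dir_deriv v f))"
  shows "gauss (dir_deriv v f)"
proof -
  obtain C c where C: "C > 0" "c > 0" "\<And>x. \<bar>f x\<bar> \<le> C * exp (- c * hnorm x)"
    using assms(3) unfolding gauss_def by blast
  obtain B n where B: "\<And>x. \<bar>dir_deriv v (dir_deriv v f) x\<bar> \<le> B * (1 + norm x) ^ n"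
    using assms(4) unfolding poly_bounded_def by blast
  obtain D where D: "D > 0" "\<And>x::heis. (1 + norm x) ^ n \<le> D * exp (c / 8 * hnorm x)"
    using poly_le_exp_hnorm[of "c / 8" n] C(2) by auto
  define g where "g = dir_deriv v f"
  have g: "smooth_on g UNIV" unfolding g_def by (rule smooth_on_dir_deriv_Basis[OF f assms(2)])
  have df: "f differentiable (at x)" and dg: "g differentiable (at x)" for x
    using smooth_on_differentiable[OF f] smooth_on_differentiable[OF g] by auto
  have "\<bar>g x\<bar> \<le> (2 * C * exp c + \<bar>B\<bar> * 2 ^ n * D) * exp (- (c / 8) * hnorm x)" for x
  proof -
    \<comment> \<open>The rates balance as follows. \<open>f\<close> decays at rate
      \<open>c / 2\<close> at both ends of the step, so division by \<open>\<delta>\<close> leaves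
      \<open>c / 4\<close> for the mean value of the derivative. The second derivative grows at most
      at rate \<open>c / 8\<close>, so multiplication by \<open>\<delta>\<close> leaves decay at
      rate \<open>c / 8\<close> for the error.\<close>
    define \<delta> where "\<delta> = exp (- (c / 4) * hnorm x)"
    have \<delta>: "0 < \<delta>" "\<delta> \<le> 1" using C(2) by (auto simp: \<delta>_def)
    have "\<exists>s. 0 < s \<and> s < \<delta> \<and> f (x + \<delta> *\<^sub>R v) - f (x + 0 *\<^sub>R v) = (\<delta> - 0) * g (x + s *\<^sub>R v)"
      unfolding g_def by (rule MVT2[OF \<delta>(1)]) (intro has_real_derivative_line df)
    then obtain s where s: "0 < s" "s < \<delta>" "f (x + \<delta> *\<^sub>R v) - f x = \<delta> * g (x + s *\<^sub>R v)" by auto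
    have "\<exists>u. 0 < u \<and> u < s \<and> g (x + s *\<^sub>R v) - g (x + 0 *\<^sub>R v) = (s - 0) * dir_deriv v g (x + u *\<^sub>R v)"
      by (rule MVT2[OF s(1)]) (intro has_real_derivative_line dg)
    then obtain u where u: "0 < u" "u < s" "g (x + s *\<^sub>R v) - g x = s * dir_deriv v g (x + u *\<^sub>R v)" by auto
    have e1: "\<bar>f (x + \<delta> *\<^sub>R v)\<bar> \<le> C * exp c * exp (- c / 2 * hnorm x)"
    proof -
      have "- c * hnorm (x + \<delta> *\<^sub>R v) \<le> c + - c / 2 * hnorm x"
        using mult_left_mono[OF hnorm_add_Basis[OF assms(2), of \<delta> x], of c] \<delta> C(2) by (simp add: algebra_simps)
      then have "C * exp (- c * hnorm (x + \<delta> *\<^sub>R v)) \<le> C * exp (c + - c / 2 * hnorm x)"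
        using C(1) by (intro mult_left_mono) auto
      then show ?thesis using C(3)[of "x + \<delta> *\<^sub>R v"] unfolding exp_add mult.assoc by linarith
    qed
    have e2: "\<bar>f x\<bar> \<le> C * exp c * exp (- c / 2 * hnorm x)"
    proof -
      have "- c * hnorm x \<le> c + - c / 2 * hnorm x"
        using mult_nonneg_nonneg[OF less_imp_le[OF C(2)] hnorm_nonneg[of x]] C(2)
        unfolding mult_minus_left minus_divide_left[symmetric] times_divide_eq_left by linarith
      then have "C * exp (- c * hnorm x) \<le> C * exp (c + - c / 2 * hnorm x)"
        using C(1) by (intro mult_left_mono) auto
      then show ?thesis using C(3)[of "x"] unfolding exp_add mult.assoc by linarith
    qed
    have "\<bar>\<delta> * g (x + s *\<^sub>R v)\<bar> \<le> 2 * (C * exp c * exp (- c / 2 * hnorm x))"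
      using e1 e2 unfolding s(3)[symmetric] by linarith
    also have "exp (- c / 2 * hnorm x) = \<delta> * exp (- c / 4 * hnorm x)"
      unfolding \<delta>_def by (simp add: exp_add[symmetric] algebra_simps)
    finally have "\<delta> * \<bar>g (x + s *\<^sub>R v)\<bar> \<le> \<delta> * (2 * C * exp c * exp (- c / 4 * hnorm x))"
      using \<delta> by (simp add: abs_mult ac_simps)
    then have g1: "\<bar>g (x + s *\<^sub>R v)\<bar> \<le> 2 * C * exp c * exp (- c / 4 * hnorm x)"
      using \<delta> by simp
    have nv: "norm v = 1" using assms(2) by simp
    have "1 + norm (x + u *\<^sub>R v) \<le> 2 * (1 + norm x)"
    proof -
      have "norm (u *\<^sub>R v) = u" using nv u(1) by simp
      moreover have "1 + z \<le> 2 * (1 + y)" if "z \<le> y + w" "w = u" "0 \<le> y" for y z w :: real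
        using that u(2) s(2) \<delta>(2) by simp
      ultimately show ?thesis using norm_triangle_ineq[of x "u *\<^sub>R v"] norm_ge_zero[of x] by blast
    qed
    then have "(1 + norm (x + u *\<^sub>R v)) ^ n \<le> (2 * (1 + norm x)) ^ n"
      by (intro power_mono) (auto intro: add_nonneg_nonneg)
    also have "\<dots> = 2 ^ n * (1 + norm x) ^ n" by (rule power_mult_distrib)
    also have "\<dots> \<le> 2 ^ n * (D * exp (c / 8 * hnorm x))" by (intro mult_left_mono D) auto
    finally have "\<bar>B\<bar> * (1 + norm (x + u *\<^sub>R v)) ^ n \<le> \<bar>B\<bar> * (2 ^ n * (D * exp (c / 8 * hnorm x)))"
      by (intro mult_left_mono) auto
    moreover have "\<bar>dir_deriv v g (x + u *\<^sub>R v)\<bar> \<le> \<bar>B\<bar> * (1 + norm (x + u *\<^sub>R v)) ^ n"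
      unfolding g_def by (rule order_trans[OF B]) (intro mult_right_mono, auto)
    ultimately have "\<bar>dir_deriv v g (x + u *\<^sub>R v)\<bar> \<le> \<bar>B\<bar> * (2 ^ n * (D * exp (c / 8 * hnorm x)))" by linarith
    then have "s * \<bar>dir_deriv v g (x + u *\<^sub>R v)\<bar> \<le> \<delta> * (\<bar>B\<bar> * (2 ^ n * (D * exp (c / 8 * hnorm x))))"
      using s \<delta> by (intro mult_mono) auto
    also have "\<dots> = \<bar>B\<bar> * 2 ^ n * D * (\<delta> * exp (c / 8 * hnorm x))" by simp
    also have "\<delta> * exp (c / 8 * hnorm x) = exp (- (c / 8) * hnorm x)"
      unfolding \<delta>_def by (simp add: exp_add[symmetric] algebra_simps)
    finally have g2: "\<bar>g (x + s *\<^sub>R v) - g x\<bar> \<le> \<bar>B\<bar> * 2 ^ n * D * exp (- (c / 8) * hnorm x)"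
      using u s by (simp add: abs_mult)
    have "exp (- c / 4 * hnorm x) \<le> exp (- (c / 8) * hnorm x)"
      using C(2) by (simp add: field_simps)
    then have "2 * C * exp c * exp (- c / 4 * hnorm x) \<le> 2 * C * exp c * exp (- (c / 8) * hnorm x)"
      using C(1) by (intro mult_left_mono) auto
    then have "\<bar>g x\<bar> \<le> 2 * C * exp c * exp (- (c / 8) * hnorm x) + \<bar>B\<bar> * 2 ^ n * D * exp (- (c / 8) * hnorm x)"
      using g1 g2 by linarith
    then show ?thesis by (simp add: distrib_right)
  qed
  moreover have "2 * C * exp c + \<bar>B\<bar> * 2 ^ n * D > 0" using C D by (intro add_pos_nonneg) auto
  ultimately show ?thesis unfolding gauss_def g_def using C(2)
    by (intro exI[of _ "2 * C * exp c + \<bar>B\<bar> * 2 ^ n * D"] conjI exI[of _ "c / 8"]) auto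
qed

text \<open>In \<open>graded_class\<close>, \<open>Q\<close> is a growth condition stable under multiplication by \<open>p\<close> and \<open>q\<close>, and the
  first-order operators given by \<open>W\<close> have constant \<open>p\<close>- and \<open>q\<close>-components. Then the functions all of
  whose iterated derivatives along \<open>W\<close> satisfy \<open>Q\<close> form a class stable under these operations.\<close>

definition vfield :: "(heis \<Rightarrow> heis) \<Rightarrow> (heis \<Rightarrow> real) \<Rightarrow> heis \<Rightarrow> real" where
  "vfield w f x = dir_deriv (w x) f x"

locale graded_class =
  fixes W :: "(heis \<Rightarrow> heis) set" and Q :: "(heis \<Rightarrow> real) \<Rightarrow> bool"
  assumes W_smooth: "\<And>w f. w \<in> W \<Longrightarrow> smooth_on f UNIV \<Longrightarrow> smooth_on (vfield w f) UNIV"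
    and W_const: "\<And>w x. w \<in> W \<Longrightarrow> fst (w x) = fst (w 0)" "\<And>w x. w \<in> W \<Longrightarrow> fst (snd (w x)) = fst (snd (w 0))"
    and Q_add: "\<And>f g. Q f \<Longrightarrow> Q g \<Longrightarrow> Q (\<lambda>x. f x + g x)"
    and Q_cmult: "\<And>f c. Q f \<Longrightarrow> Q (\<lambda>x. c * f x)"
    and Q_p: "\<And>f. Q f \<Longrightarrow> Q (\<lambda>x. fst x * f x)"
    and Q_q: "\<And>f. Q f \<Longrightarrow> Q (\<lambda>x. fst (snd x) * f x)"
begin

fun graded :: "nat \<Rightarrow> (heis \<Rightarrow> real) \<Rightarrow> bool" where
  "graded 0 f \<longleftrightarrow> Q f"
| "graded (Suc n) f \<longleftrightarrow> Q f \<and> (\<forall>w\<in>W. graded n (vfield w f))"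

lemma graded_Q: "graded n f \<Longrightarrow> Q f"
  by (cases n) auto

lemma graded_SucD: "graded (Suc n) f \<Longrightarrow> graded n f"
  by (induction n arbitrary: f) auto

lemma graded_add:
  "smooth_on f UNIV \<Longrightarrow> smooth_on g UNIV \<Longrightarrow> graded n f \<Longrightarrow> graded n g \<Longrightarrow> graded n (\<lambda>x. f x + g x)"
proof (induction n arbitrary: f g)
  case (Suc n)
  have "vfield w (\<lambda>x. f x + g x) = (\<lambda>x. vfield w f x + vfield w g x)" for w
    using Suc.prems by (auto simp: vfield_def dir_deriv_add smooth_on_differentiable)
  then show ?case using Suc by (auto simp: Q_add W_smooth)
qed (simp add: Q_add)

lemma graded_cmult: "smooth_on f UNIV \<Longrightarrow> graded n f \<Longrightarrow> graded n (\<lambda>x. c * f x)"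
proof (induction n arbitrary: f)
  case (Suc n)
  have "vfield w (\<lambda>x. c * f x) = (\<lambda>x. c * vfield w f x)" for w
    using Suc.prems by (auto simp: vfield_def dir_deriv_mult smooth_on_differentiable)
  then show ?case using Suc by (auto simp: Q_cmult W_smooth)
qed (simp add: Q_cmult)

text \<open>The field maps the linear function \<open>a\<close> to the constant
  \<open>a (w 0)\<close>, so the Leibniz rule only produces \<open>a\<close> times a derivative and
  a multiple of \<open>f\<close>, and the induction closes.\<close>

lemma graded_mult:
  assumes "\<And>f. Q f \<Longrightarrow> Q (\<lambda>x. a x * f x)" "bounded_linear a" "\<And>w x. w \<in> W \<Longrightarrow> a (w x) = a (w 0)"
  shows "smooth_on f UNIV \<Longrightarrow> graded n f \<Longrightarrow> graded n (\<lambda>x. a x * f x)"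
proof (induction n arbitrary: f)
  case (Suc n)
  have "graded n (vfield w (\<lambda>x. a x * f x))" if "w \<in> W" for w
  proof -
    have "vfield w (\<lambda>x. a x * f x) = (\<lambda>x. a x * vfield w f x + a (w 0) * f x)"
      using Suc.prems assms(3)[OF that]
      by (auto simp: vfield_def dir_deriv_mult smooth_on_differentiable smooth_on_linear[OF assms(2)]
           bounded_linear_imp_differentiable[OF assms(2)] dir_deriv_linear[OF assms(2)])
    moreover have "graded n (\<lambda>x. a x * vfield w f x + a (w 0) * f x)"
      using Suc.prems that graded_SucD[OF Suc.prems(2)]
      by (intro graded_add Suc.IH graded_cmult smooth_on_mult smooth_on_linear[OF assms(2)] smooth_on_const W_smooth open_UNIV) auto
    ultimately show ?thesis by simp
  qed
  then show ?case using Suc.prems assms(1) by auto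
qed (simp add: assms(1))

definition tame :: "(heis \<Rightarrow> real) \<Rightarrow> bool" where
  "tame f \<longleftrightarrow> smooth_on f UNIV \<and> (\<forall>n. graded n f)"

lemma tame_smooth: "tame f \<Longrightarrow> smooth_on f UNIV"
  and tame_Q: "tame f \<Longrightarrow> Q f"
  by (auto simp: tame_def intro: graded_Q)

lemma tame_add: "tame f \<Longrightarrow> tame g \<Longrightarrow> tame (\<lambda>x. f x + g x)"
  by (auto simp: tame_def intro: graded_add smooth_on_add)

lemma tame_cmult: "tame f \<Longrightarrow> tame (\<lambda>x. c * f x)"
  by (auto simp: tame_def intro!: graded_cmult smooth_on_mult smooth_on_const)

lemma tame_p: "tame f \<Longrightarrow> tame (\<lambda>x. fst x * f x)"
  unfolding tame_def
  by (auto intro!: graded_mult[of fst] smooth_on_mult smooth_on_coords Q_p bounded_linear_coords W_const)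

lemma tame_q: "tame f \<Longrightarrow> tame (\<lambda>x. fst (snd x) * f x)"
  unfolding tame_def
  by (auto intro!: graded_mult[of "\<lambda>x. fst (snd x)"] smooth_on_mult smooth_on_coords Q_q bounded_linear_coords W_const)

lemma tame_vfield:
  assumes "tame f" "w \<in> W"
  shows "tame (vfield w f)"
proof -
  have "graded n (vfield w f)" for n
  proof -
    have "graded (Suc n) f" using assms by (auto simp: tame_def)
    then show ?thesis using assms by simp
  qed
  then show ?thesis using assms W_smooth by (auto simp: tame_def)
qed

lemma tameI:
  assumes "smooth_on f UNIV" and "\<And>ws. set ws \<subseteq> W \<Longrightarrow> Q (foldr vfield ws f)"
  shows "tame f"
proof -
  have "graded n (foldr vfield ws f)" if "set ws \<subseteq> W" for n ws
    using that
  proof (induction n arbitrary: ws)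
    case (Suc n)
    have "graded n (vfield w (foldr vfield ws f))" if "w \<in> W" for w
      using Suc.IH[of "w # ws"] Suc.prems that by simp
    then show ?case using Suc assms(2) by auto
  qed (simp add: assms(2))
  from this[of "[]"] show ?thesis using assms(1) by (auto simp: tame_def)
qed

end

definition left_vf :: "heis \<Rightarrow> heis \<Rightarrow> heis" where
  "left_vf v x = v + (0, 0, (fst x * fst (snd v) - fst (snd x) * fst v) / 2)"

lemma lfield_vfield: "lfield v f = vfield (left_vf v) f"
  by (auto simp: lfield_def vfield_def left_vf_def)

text \<open>The \<open>p\<close>- and \<open>q\<close>-components of a left-invariant field are
  constant although its central component is not; this is why multiplication by these two
  coordinates preserves the class.\<close>

interpretation left_poly: graded_class "left_vf ` Basis" poly_bounded
proof
  show "smooth_on (vfield w f) UNIV" if "w \<in> left_vf ` Basis" "smooth_on f UNIV" for w f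
    using that smooth_on_lfield by (auto simp: lfield_vfield[symmetric])
qed (auto simp: left_vf_def poly_bounded_const poly_bounded_coord intro: poly_bounded_add poly_bounded_mult)

interpretation eucl_gauss: graded_class "(\<lambda>v _. v) ` Basis" gauss
proof
  show "smooth_on (vfield w f) UNIV" if "w \<in> (\<lambda>v _. v) ` Basis" "smooth_on f UNIV" for w f
    using that smooth_on_dir_deriv_Basis by (auto simp: vfield_def[abs_def])
qed (auto intro: gauss_add gauss_poly_mult poly_bounded_const poly_bounded_coord)

text \<open>Inverts the frame: the central derivative is itself left-invariant, and
  \<open>d_p\<close>, \<open>d_q\<close> differ from left-invariant fields by multiples of it with
  coefficients linear in \<open>q\<close> and \<open>p\<close>. Here bounds on left-invariant
  derivatives turn into polynomial bounds on coordinate derivatives.\<close>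

lemma left_poly_dir_deriv:
  assumes "left_poly.tame f" "v \<in> Basis"
  shows "left_poly.tame (dir_deriv v f)"
proof -
  have d: "f differentiable (at x)" for x
    using left_poly.tame_smooth[OF assms(1)] smooth_on_differentiable by auto
  have L: "left_poly.tame (lfield v f)" if "v \<in> Basis" for v
    unfolding lfield_vfield by (rule left_poly.tame_vfield[OF assms(1)]) (use that in auto)
  have 1: "d_p f = (\<lambda>x. lfield (1, 0, 0) f x + (1/2) * (fst (snd x) * lfield (0, 0, 1) f x))"
    and 2: "d_q f = (\<lambda>x. lfield (0, 1, 0) f x + (-1/2) * (fst x * lfield (0, 0, 1) f x))"
    unfolding lfield_def by (rule ext, subst (2 3) dir_deriv_heis[OF d], simp add: zero_prod_def)+
  have 3: "d_t f = lfield (0, 0, 1) f"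
    by (simp add: lfield_def[abs_def] zero_prod_def[symmetric])
  have "left_poly.tame (d_p f)" "left_poly.tame (d_q f)" "left_poly.tame (d_t f)"
    unfolding 1 2 3
    by (intro left_poly.tame_add left_poly.tame_cmult left_poly.tame_p left_poly.tame_q L; simp add: Basis_heis)+
  then show ?thesis using assms(2) by (auto simp: Basis_heis)
qed
section \<open>Boundedness of the derivatives of the heat kernel\<close>

lemma has_bochner_integral_sum_list:
  fixes f :: "'b \<Rightarrow> 'a \<Rightarrow> real"
  assumes "\<And>x. x \<in> set L \<Longrightarrow> has_bochner_integral M (f x) (i x)"
  shows "has_bochner_integral M (\<lambda>\<omega>. \<Sum>x\<leftarrow>L. f x \<omega>) (\<Sum>x\<leftarrow>L. i x)"
  using assms by (induction L) (auto intro!: has_bochner_integral_add has_bochner_integral_zero)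

locale heis_heat =
  fixes h :: "heis \<times> real \<Rightarrow> real"
  assumes hk: "heat_kernel h"
begin

definition K :: "heis \<Rightarrow> real" where "K \<omega> = h (\<omega>, 1)"

lemma smooth_h: "smooth_on h (UNIV \<times> {0<..})"
  and heat_eq: "t > 0 \<Longrightarrow> deriv (\<lambda>s. h (\<omega>, s)) t + sub_laplacian (\<lambda>\<upsilon>. h (\<upsilon>, t)) \<omega> = 0"
  and h_nonneg: "t > 0 \<Longrightarrow> h (\<omega>, t) \<ge> 0"
  and integrable_h: "t > 0 \<Longrightarrow> integrable lborel (\<lambda>\<omega>. h (\<omega>, t))"
  and integral_h: "t > 0 \<Longrightarrow> (LINT \<omega>|lborel. h (\<omega>, t)) = 1"
  and conv_exists: "s > 0 \<Longrightarrow> t > 0 \<Longrightarrow> heis_conv_exists (\<lambda>\<omega>. h (\<omega>, s)) (\<lambda>\<omega>. h (\<omega>, t))"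
  and conv: "s > 0 \<Longrightarrow> t > 0 \<Longrightarrow> heis_conv (\<lambda>\<omega>. h (\<omega>, s)) (\<lambda>\<omega>. h (\<omega>, t)) = (\<lambda>\<omega>. h (\<omega>, s + t))"
  and homogeneous: "t > 0 \<Longrightarrow> r > 0 \<Longrightarrow> r ^ 4 * h (dilate r \<omega>, r\<^sup>2 * t) = h (\<omega>, t)"
  using hk unfolding heat_kernel_def by blast+

lemma h_inv: "t > 0 \<Longrightarrow> h (heis_inv \<omega>, t) = h (\<omega>, t)"
  using hk unfolding heat_kernel_def by metis

lemma smooth_h_slice: "t > 0 \<Longrightarrow> smooth_on (\<lambda>\<omega>. h (\<omega>, t)) UNIV"
  by (rule smooth_on_slice[OF smooth_h])

lemma smooth_K: "smooth_on K UNIV"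
  unfolding K_def[abs_def] by (rule smooth_h_slice) simp

lemma continuous_on_h_slice: "t > 0 \<Longrightarrow> continuous_on UNIV (\<lambda>\<omega>. h (\<omega>, t))"
  by (rule smooth_on_continuous[OF smooth_h_slice])

lemma measurable_h_slice: "t > 0 \<Longrightarrow> (\<lambda>\<omega>. h (\<omega>, t)) \<in> borel_measurable borel"
  by (rule borel_measurable_continuous_onI[OF continuous_on_h_slice])

text \<open>A left translation by \<open>a\<close> in the convolution integral, combined with
  symmetry of \<open>h (\<cdot>, s)\<close>, puts the semigroup law into Gram form. Unequal times
  are kept because the identity is later differentiated in each of them.\<close>

lemma conv_kernel:
  assumes "s > 0" "t > 0"
  shows "has_bochner_integral lborel (\<lambda>\<xi>. h (heis_inv \<xi> \<odot> a, s) * h (heis_inv \<xi> \<odot> b, t)) (h (heis_inv a \<odot> b, s + t))"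
proof -
  note [measurable] = measurable_h_slice[OF assms(1)] measurable_h_slice[OF assms(2)]
  define F where "F \<upsilon> = h (\<upsilon>, s) * h (heis_inv \<upsilon> \<odot> (heis_inv a \<odot> b), t)" for \<upsilon>
  have m: "F \<in> borel_measurable borel"
  proof -
    have "(\<lambda>x. h (heis_inv x \<odot> (heis_inv a \<odot> b), t)) \<in> borel_measurable borel"
      using measurable_compose[OF _ measurable_h_slice[OF assms(2)], of "\<lambda>x. heis_inv x \<odot> (heis_inv a \<odot> b)" borel]
      by measurable
    then show ?thesis unfolding F_def[abs_def] using measurable_h_slice[OF assms(1)] by (rule borel_measurable_times[rotated])
  qed
  have "integrable lborel F"
    using conv_exists[OF assms] unfolding heis_conv_exists_def F_def[abs_def] by blast
  moreover have "integral\<^sup>L lborel F = h (heis_inv a \<odot> b, s + t)"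
    using conv[OF assms] unfolding heis_conv_def F_def[abs_def] by metis
  ultimately have "integrable lborel (\<lambda>\<xi>. F (heis_inv a \<odot> \<xi>))" "(LINT \<xi>|lborel. F (heis_inv a \<odot> \<xi>)) = h (heis_inv a \<odot> b, s + t)"
    using integrable_heis_left[OF m] integral_heis_left[OF m] by auto
  moreover have "F (heis_inv a \<odot> \<xi>) = h (heis_inv \<xi> \<odot> a, s) * h (heis_inv \<xi> \<odot> b, t)" for \<xi>
    using h_inv[OF assms(1), of "heis_inv a \<odot> \<xi>"] by (simp add: F_def heis_inv_mult heis_group(1))
  ultimately show ?thesis by (simp add: has_bochner_integral_iff)
qed

lemma K_psd: "0 \<le> (\<Sum>x\<leftarrow>L. \<Sum>y\<leftarrow>L. fst x * fst y * K (heis_inv (snd x) \<odot> snd y))"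
proof -
  define H where "H \<omega> = h (\<omega>, 1/2)" for \<omega>
  have "has_bochner_integral lborel (\<lambda>\<xi>. \<Sum>x\<leftarrow>L. \<Sum>y\<leftarrow>L. fst x * fst y * (H (heis_inv \<xi> \<odot> snd x) * H (heis_inv \<xi> \<odot> snd y)))
      (\<Sum>x\<leftarrow>L. \<Sum>y\<leftarrow>L. fst x * fst y * K (heis_inv (snd x) \<odot> snd y))"
    unfolding K_def H_def
    using conv_kernel[of "1/2" "1/2"]
    by (intro has_bochner_integral_sum_list has_bochner_integral_mult_right) simp
  then have "(LINT \<xi>|lborel. (\<Sum>x\<leftarrow>L. \<Sum>y\<leftarrow>L. fst x * fst y * (H (heis_inv \<xi> \<odot> snd x) * H (heis_inv \<xi> \<odot> snd y))))
      = (\<Sum>x\<leftarrow>L. \<Sum>y\<leftarrow>L. fst x * fst y * K (heis_inv (snd x) \<odot> snd y))"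
    by (rule has_bochner_integral_integral_eq)
  moreover have "(\<Sum>x\<leftarrow>L. \<Sum>y\<leftarrow>L. fst x * fst y * (H (heis_inv \<xi> \<odot> snd x) * H (heis_inv \<xi> \<odot> snd y)))
      = (\<Sum>x\<leftarrow>L. fst x * H (heis_inv \<xi> \<odot> snd x))\<^sup>2" for \<xi>
    by (simp add: power2_eq_square sum_list_const_mult[symmetric] sum_list_mult_const[symmetric] ac_simps)
  ultimately show ?thesis
    by (metis (no_types, lifting) Bochner_Integration.integral_nonneg zero_le_power2)
qed

lemma K_inv [simp]: "K (heis_inv x) = K x"
  by (simp add: K_def h_inv)

text \<open>Adjoining the point \<open>heis_inv \<omega>\<close> with weight \<open>l\<close> to the
  list turns plain positive semidefiniteness into the bordered form; symmetry of \<open>K\<close>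
  identifies the border with \<open>K (\<omega> \<odot> g)\<close>.\<close>

lemma pd_controls_K: "pd_controls (K 0) K K"
  unfolding pd_controls_def
proof (intro allI)
  fix \<omega> l and L :: "(real \<times> heis) list"
  have "K (heis_inv g \<odot> heis_inv \<omega>) = K (\<omega> \<odot> g)" for g
    using K_inv[of "\<omega> \<odot> g"] by (simp add: heis_inv_mult)
  then have "(\<Sum>x\<leftarrow>(l, heis_inv \<omega>) # L. \<Sum>y\<leftarrow>(l, heis_inv \<omega>) # L. fst x * fst y * K (heis_inv (snd x) \<odot> snd y))
    = l\<^sup>2 * K 0 + 2 * l * (\<Sum>x\<leftarrow>L. fst x * K (\<omega> \<odot> snd x))
       + (\<Sum>x\<leftarrow>L. \<Sum>y\<leftarrow>L. fst x * fst y * K (heis_inv (snd x) \<odot> snd y))"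
    by (simp add: heis_group(4,5) sum_list_addf power2_eq_square sum_list_const_mult[symmetric] algebra_simps)
  then show "0 \<le> l\<^sup>2 * K 0 + 2 * l * (\<Sum>x\<leftarrow>L. fst x * K (\<omega> \<odot> snd x))
       + (\<Sum>x\<leftarrow>L. \<Sum>y\<leftarrow>L. fst x * fst y * K (heis_inv (snd x) \<odot> snd y))"
    using K_psd[of "(l, heis_inv \<omega>) # L"] by simp
qed

lemma left_poly_tame_K: "left_poly.tame K"
proof (rule left_poly.tameI[OF smooth_K])
  fix ws assume "set ws \<subseteq> left_vf ` Basis"
  then have "\<exists>vs. ws = map left_vf vs"
    unfolding ex_map_conv by blast
  then obtain vs where ws: "ws = map left_vf vs" by blast
  have "foldr vfield ws K = foldr lfield vs K"
    unfolding ws by (induction vs) (auto simp: lfield_vfield)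
  moreover obtain B where "\<And>x. \<bar>foldr lfield vs K x\<bar> \<le> B"
    using pd_controls_fields_bounded[OF pd_controls_K smooth_K smooth_K] by blast
  ultimately show "poly_bounded (foldr vfield ws K)"
    unfolding poly_bounded_def by (intro exI[of _ B] exI[of _ 0]) simp
qed

lemma poly_bounded_iter_deriv_K: "set vs \<subseteq> Basis \<Longrightarrow> poly_bounded (iter_deriv vs K)"
proof -
  assume "set vs \<subseteq> Basis"
  then have "left_poly.tame (iter_deriv vs K)"
    unfolding iter_deriv_def by (induction vs) (auto intro: left_poly_tame_K left_poly_dir_deriv)
  then show ?thesis by (rule left_poly.tame_Q)
qed

lemma K_bounded: obtains B where "B > 0" "\<And>x. K x \<le> B"
proof -
  have "K x \<le> max 1 (K 0)" for x
    using pd_controls_bounded[OF pd_controls_K, of x] by simp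
  then show ?thesis using that[of "max 1 (K 0)"] by auto
qed

lemma K_nonneg: "K x \<ge> 0"
  by (simp add: K_def h_nonneg)

end
section \<open>Stationarity and exponential moments\<close>

lemma integrable_continuous_compact_support:
  fixes f :: "'a::euclidean_space \<Rightarrow> real"
  assumes "continuous_on UNIV f" "\<And>x. norm x \<ge> R \<Longrightarrow> f x = 0"
  shows "integrable lborel f"
proof -
  have "integrable lborel (\<lambda>x. indicator (cball 0 R) x *\<^sub>R f x)"
    by (rule borel_integrable_compact) (auto intro: continuous_on_subset[OF assms(1)])
  also have "(\<lambda>x. indicator (cball 0 R) x *\<^sub>R f x) = f"
    using assms(2) by (force simp: fun_eq_iff indicator_def)
  finally show ?thesis .
qed

text \<open>Differentiating the translation invariance of Lebesgue measure avoids Fubini.\<close>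

lemma integral_dir_deriv_zero:
  fixes F :: "'a::euclidean_space \<Rightarrow> real"
  assumes d: "\<And>x. F differentiable (at x)" and c: "continuous_on UNIV (dir_deriv v F)"
    and R: "\<And>x. norm x \<ge> R \<Longrightarrow> F x = 0"
  shows "integrable lborel (dir_deriv v F)" "(LINT x|lborel. dir_deriv v F x) = 0"
proof -
  have cF: "continuous_on UNIV F"
    by (intro continuous_at_imp_continuous_on ballI differentiable_imp_continuous_within d)
  have iF: "integrable lborel F" by (rule integrable_continuous_compact_support[OF cF R])
  \<comment> \<open>The steps \<open>s n\<close> are at most 1, so the difference quotients vanish
    outside radius \<open>\<bar>R\<bar> + norm v\<close>, and inside it the mean value point lies at
    most \<open>norm v\<close> further out.\<close>
  have "compact (dir_deriv v F ` cball 0 (\<bar>R\<bar> + 2 * norm v))"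
    by (rule compact_continuous_image[OF continuous_on_subset[OF c]]) auto
  then obtain B where "\<forall>y\<in>dir_deriv v F ` cball 0 (\<bar>R\<bar> + 2 * norm v). norm y \<le> B"
    using compact_imp_bounded bounded_iff by blast
  then have B: "\<And>x. norm x \<le> \<bar>R\<bar> + 2 * norm v \<Longrightarrow> \<bar>dir_deriv v F x\<bar> \<le> B" by simp
  have B0: "B \<ge> 0" using B[of 0] abs_ge_zero order_trans by force
  define s where "s n = inverse (real (Suc n))" for n
  have s: "0 < s n" "s n \<le> 1" for n by (auto simp: s_def field_simps)
  define g where "g n x = (F (x + s n *\<^sub>R v) - F x) / s n" for n x
  have lim: "(\<lambda>n. g n x) \<longlonglongrightarrow> dir_deriv v F x" for x
  proof -
    have "((\<lambda>r. F (x + r *\<^sub>R v)) has_real_derivative dir_deriv v F x) (at 0)"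
      using has_real_derivative_line[where f = F and x = x and r = 0 and w = v, OF d] by simp
    then have "((\<lambda>r. (F (x + r *\<^sub>R v) - F x) / r) \<longlongrightarrow> dir_deriv v F x) (at 0)"
      by (simp add: has_field_derivative_iff)
    moreover have "filterlim s (at 0) sequentially"
      unfolding filterlim_at s_def using LIMSEQ_inverse_real_of_nat by auto
    ultimately show ?thesis unfolding g_def by (rule filterlim_compose)
  qed
  have bnd: "norm (g n x) \<le> B * indicator (cball 0 (\<bar>R\<bar> + norm v)) x" for n x
  proof (cases "norm x \<le> \<bar>R\<bar> + norm v")
    case True
    have "\<exists>z. 0 < z \<and> z < s n \<and> F (x + s n *\<^sub>R v) - F (x + 0 *\<^sub>R v) = (s n - 0) * dir_deriv v F (x + z *\<^sub>R v)"
      by (rule MVT2[OF s(1)]) (intro has_real_derivative_line d)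
    then obtain z where z: "0 < z" "z < s n" "F (x + s n *\<^sub>R v) - F x = s n * dir_deriv v F (x + z *\<^sub>R v)" by auto
    have "g n x = dir_deriv v F (x + z *\<^sub>R v)" using z(3) s(1)[of n] by (simp add: g_def)
    moreover have "norm (z *\<^sub>R v) \<le> 1 * norm v"
      using mult_right_mono[of z 1 "norm v"] z s(2)[of n] by simp
    then have "norm (x + z *\<^sub>R v) \<le> \<bar>R\<bar> + 2 * norm v"
      using norm_triangle_ineq[of x "z *\<^sub>R v"] True by (auto intro: order_trans)
    ultimately show ?thesis using B True by (simp add: indicator_def)
  next
    case False
    have "norm (s n *\<^sub>R v) \<le> 1 * norm v" using mult_right_mono[of "s n" 1 "norm v"] s[of n] by simp
    moreover have "norm x \<le> norm (x + s n *\<^sub>R v) + norm (s n *\<^sub>R v)"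
      by (metis add_diff_cancel_right' norm_triangle_ineq4)
    moreover have "R \<le> c" if "a \<le> c + b" "b \<le> 1 * w" "\<not> a \<le> \<bar>R\<bar> + w" for a b c w :: real
      using that by linarith
    ultimately have "norm (x + s n *\<^sub>R v) \<ge> R" using False by blast
    moreover have "norm x \<ge> R" using False abs_ge_self[of R] norm_ge_zero[of v] by linarith
    ultimately show ?thesis using R B0 by (simp add: g_def indicator_def)
  qed
  have meas: "dir_deriv v F \<in> borel_measurable lborel" "\<And>n. g n \<in> borel_measurable lborel"
    using borel_measurable_continuous_onI[OF c] borel_measurable_continuous_onI[OF cF]
    by (auto simp: g_def[abs_def])
  have iw: "integrable lborel (\<lambda>x. B * indicator (cball 0 (\<bar>R\<bar> + norm v)) x :: real)"
    by (intro integrable_mult_right integrable_real_indicator) (use emeasure_bounded_finite[OF bounded_cball] in auto)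
  have "(LINT x|lborel. g n x) = 0" for n
  proof -
    have "distr lborel lborel (\<lambda>x. s n *\<^sub>R v + x) = (lborel :: 'a measure)"
      using lborel_distr_plus[of "s n *\<^sub>R v"] by (metis distr_cong sets_lborel)
    then have 1: "(LINT x|lborel. F (s n *\<^sub>R v + x)) = (LINT x|lborel. F x)" and 2: "integrable lborel (\<lambda>x. F (s n *\<^sub>R v + x))"
      using integral_distr[of "\<lambda>x. s n *\<^sub>R v + x" lborel lborel F] integrable_distr_eq[of "\<lambda>x. s n *\<^sub>R v + x" lborel lborel F] iF
      by (auto simp: borel_measurable_continuous_onI[OF cF])
    have "(LINT x|lborel. g n x) = (LINT x|lborel. F (s n *\<^sub>R v + x) - F x) / s n"
      by (simp add: g_def[abs_def] add.commute)
    also have "\<dots> = 0" using 1 2 iF by simp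
    finally show ?thesis .
  qed
  moreover have "(\<lambda>n. LINT x|lborel. g n x) \<longlonglongrightarrow> (LINT x|lborel. dir_deriv v F x)"
    by (rule integral_dominated_convergence[OF meas iw]) (use lim bnd in auto)
  ultimately show "(LINT x|lborel. dir_deriv v F x) = 0" by (simp add: LIMSEQ_const_iff)
  show "integrable lborel (dir_deriv v F)"
    by (rule integrable_dominated_convergence[where s = g, OF meas iw]) (use lim bnd in auto)
qed

text \<open>Only the kink at 0 needs an argument: there the difference quotient is at most
  \<open>\<bar>z\<bar> ^ (n + 1)\<close>.\<close>

lemma has_real_derivative_pos_part_power:
  "((\<lambda>y::real. max 0 y ^ (n + 2)) has_real_derivative real (n + 2) * max 0 y ^ (n + 1)) (at y)"
proof -
  consider "y > 0" | "y < 0" | "y = 0" by linarith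
  then show ?thesis
  proof cases
    case 1
    have "((\<lambda>y::real. y ^ (n + 2)) has_real_derivative real (n + 2) * y ^ (n + 1)) (at y)"
      using DERIV_pow[of "n + 2" y UNIV] by simp
    then show ?thesis
      by (rule has_field_derivative_transform_within_open[of _ _ _ "{0<..}", THEN DERIV_cong]) (use 1 in auto)
  next
    case 2
    have "((\<lambda>y::real. 0) has_real_derivative 0) (at y)" by simp
    then show ?thesis
      by (rule has_field_derivative_transform_within_open[of _ _ _ "{..<0}", THEN DERIV_cong]) (use 2 in auto)
  next
    case 3
    have "((\<lambda>z::real. (max 0 z ^ (n + 2) - max 0 0 ^ (n + 2)) / (z - 0)) \<longlongrightarrow> 0) (at 0)"
    proof (rule Lim_null_comparison)
      show "\<forall>\<^sub>F z in at 0. norm ((max 0 z ^ (n + 2) - max 0 0 ^ (n + 2)) / (z - 0)) \<le> \<bar>z\<bar> ^ (n + 1)"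
      proof (rule always_eventually, rule allI)
        fix z :: real
        show "norm ((max 0 z ^ (n + 2) - max 0 0 ^ (n + 2)) / (z - 0)) \<le> \<bar>z\<bar> ^ (n + 1)"
        proof (cases "z > 0")
          case False
          then have "max 0 z = 0" by simp
          then show ?thesis
            unfolding \<open>max 0 z = 0\<close> max.idem diff_self div_0 norm_zero by (intro zero_le_power) simp
        qed simp
      qed
      show "((\<lambda>z::real. \<bar>z\<bar> ^ (n + 1)) \<longlongrightarrow> 0) (at 0)"
        by (rule tendsto_eq_intros refl | simp)+
    qed
    then show ?thesis unfolding 3 has_field_derivative_iff by simp
  qed
qed

lemma dir_deriv_compose_real:
  assumes "(\<theta> has_real_derivative \<theta>') (at (W x))" "W differentiable (at x)"
  shows "dir_deriv v (\<lambda>x. \<theta> (W x)) x = \<theta>' * dir_deriv v W x" "(\<lambda>x. \<theta> (W x)) differentiable (at x)"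
proof -
  have "((\<lambda>x. \<theta> (W x)) has_derivative (\<lambda>v. \<theta>' * dir_deriv v W x)) (at x)"
    using has_derivative_compose[OF has_derivative_dir_deriv[OF assms(2)], of \<theta> "(*) \<theta>'"] assms(1)
    by (simp add: has_field_derivative_def)
  then show "dir_deriv v (\<lambda>x. \<theta> (W x)) x = \<theta>' * dir_deriv v W x" "(\<lambda>x. \<theta> (W x)) differentiable (at x)"
    by (auto intro: dir_deriv_eq differentiableI)
qed

lemma dir_deriv_diff:
  assumes "f differentiable (at x)" "g differentiable (at x)"
  shows "dir_deriv v (\<lambda>x. f x - g x) x = dir_deriv v f x - dir_deriv v g x"
  by (rule dir_deriv_eq) (intro has_derivative_diff has_derivative_dir_deriv assms)

section \<open>The horizontal fields, the dilation generator and the stationarity of the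
  kernel\<close>

lemma dir_deriv_coords [simp]:
  "dir_deriv v fst x = fst v" "dir_deriv v (\<lambda>x. fst (snd x)) x = fst (snd v)"
  "dir_deriv v (\<lambda>x. snd (snd x)) x = snd (snd (v :: heis))"
  by (simp_all add: dir_deriv_linear bounded_linear_coords)

lemma differentiable_coords [simp]:
  "fst differentiable (at (x :: heis))" "(\<lambda>x. fst (snd x)) differentiable (at (x :: heis))"
  "(\<lambda>x. snd (snd x)) differentiable (at (x :: heis))"
  by (simp_all add: bounded_linear_imp_differentiable bounded_linear_coords)

lemma X_field_eq: "X_field f x = d_p f x - fst (snd x) / 2 * d_t f x"
  by (cases x) (simp add: X_field_def)

lemma Y_field_eq: "Y_field f x = d_q f x + fst x / 2 * d_t f x"
  by (cases x) (simp add: Y_field_def)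

lemma XY_field_mult:
  assumes "f differentiable (at x)" "g differentiable (at x)"
  shows "X_field (\<lambda>x. f x * g x) x = f x * X_field g x + X_field f x * g x"
    "Y_field (\<lambda>x. f x * g x) x = f x * Y_field g x + Y_field f x * g x"
  using assms by (simp_all add: X_field_eq Y_field_eq dir_deriv_mult algebra_simps)

lemma XY_field_diff:
  assumes "f differentiable (at x)" "g differentiable (at x)"
  shows "X_field (\<lambda>x. f x - g x) x = X_field f x - X_field g x"
    "Y_field (\<lambda>x. f x - g x) x = Y_field f x - Y_field g x"
  using assms by (simp_all add: X_field_eq Y_field_eq dir_deriv_diff algebra_simps)

lemma Ck_on_XY_field:
  assumes "Ck_on (Suc k) f UNIV"
  shows "Ck_on k (X_field f) UNIV" "Ck_on k (Y_field f) UNIV"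
proof -
  have d: "Ck_on k (d_p f) UNIV" "Ck_on k (d_q f) UNIV" "Ck_on k (d_t f) UNIV"
    using assms by (auto simp: Basis_heis)
  have "X_field f = (\<lambda>x. d_p f x + (- 1 / 2) * fst (snd x) * d_t f x)"
    "Y_field f = (\<lambda>x. d_q f x + (1 / 2) * fst x * d_t f x)"
    by (auto simp: X_field_eq Y_field_eq)
  then show "Ck_on k (X_field f) UNIV" "Ck_on k (Y_field f) UNIV"
    by (simp_all only:) (intro Ck_on_add Ck_on_mult Ck_on_const d Ck_on_linear[OF bounded_linear_coords(1)]
       Ck_on_linear[OF bounded_linear_coords(2)] open_UNIV)+
qed

lemma Ck_on_differentiable: "Ck_on (Suc k) f UNIV \<Longrightarrow> f differentiable (at x)"
  by simp

text \<open>The generator of the dilations; its divergence is the homogeneous dimension \<open>4\<close>.\<close>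

definition euler_field :: "(heis \<Rightarrow> real) \<Rightarrow> heis \<Rightarrow> real" where
  "euler_field f x = fst x * d_p f x + fst (snd x) * d_q f x + 2 * snd (snd x) * d_t f x"

text \<open>The formal adjoint of the operator that annihilates \<open>K\<close> in
  \<open>K_stationary\<close>: \<open>euler_field\<close> has divergence 4, so the adjoint of
  \<open>- euler_field / 2\<close> is \<open>euler_field / 2 + 2\<close>.\<close>

definition ou :: "(heis \<Rightarrow> real) \<Rightarrow> heis \<Rightarrow> real" where
  "ou f x = X_field (X_field f) x + Y_field (Y_field f) x - euler_field f x / 2"

lemma dir_deriv_zero_outside:
  assumes "\<And>x. norm x \<ge> R \<Longrightarrow> f x = 0" "norm x > R"
  shows "dir_deriv v f x = 0"
proof -
  have "dir_deriv v (\<lambda>_. 0) x = dir_deriv v f x"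
    by (rule dir_deriv_cong_open(1)[of "{x. norm x > R}"]) (use assms in \<open>auto intro: open_Collect_less continuous_intros\<close>)
  then show ?thesis by simp
qed

context heis_heat
begin

text \<open>By homogeneity, \<open>K\<close> is an invariant density of the Ornstein--Uhlenbeck type operator \<open>ou\<close>.\<close>

lemma K_stationary: "X_field (X_field K) x + Y_field (Y_field K) x + euler_field K x / 2 + 2 * K x = 0"
proof -
  obtain p q t where x: "x = (p, q, t)" by (cases x)
  \<comment> \<open>Homogeneity with \<open>r = 1 / sqrt s\<close> expresses \<open>h\<close> at all
    positive times through \<open>K\<close>. The derivative at \<open>s = 1\<close> then moves along
    the dilation orbit, which gives \<open>- euler_field K x / 2\<close>, and the factor
    \<open>1 / s\<^sup>2\<close> gives \<open>- 2 * K x\<close>.\<close>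
  have 1: "h (x, s) = K (p / sqrt s, q / sqrt s, t / s) / s\<^sup>2" if "s > 0" for s
  proof -
    have "(1 / sqrt s) ^ 4 * h (dilate (1 / sqrt s) x, (1 / sqrt s)\<^sup>2 * s) = h (x, s)"
      using that by (intro homogeneous) auto
    moreover have "(1 / sqrt s) ^ 4 = 1 / s\<^sup>2"
      using that by (simp add: power_divide power4_eq_xxxx power2_eq_square)
    moreover have "(1 / sqrt s)\<^sup>2 * s = 1" "(1 / sqrt s)\<^sup>2 = 1 / s" using that by (simp_all add: power_divide)
    ultimately show ?thesis by (simp add: K_def x)
  qed
  have dc: "((\<lambda>s. (p / sqrt s, q / sqrt s, t / s)) has_derivative (\<lambda>r. r *\<^sub>R (- p / 2, - q / 2, - t))) (at 1)"
    by (rule derivative_eq_intros refl | simp add: mult.commute)+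
  have dK: "K differentiable (at y)" for y
    by (rule smooth_on_differentiable[OF smooth_K UNIV_I])
  have "((\<lambda>s. K (p / sqrt s, q / sqrt s, t / s)) has_derivative (\<lambda>r. dir_deriv (r *\<^sub>R (- p / 2, - q / 2, - t)) K x)) (at 1)"
    using has_derivative_compose[OF dc, of K "\<lambda>v. dir_deriv v K x"] has_derivative_dir_deriv[OF dK, of x] by (simp add: x)
  then have "((\<lambda>s. K (p / sqrt s, q / sqrt s, t / s)) has_real_derivative dir_deriv (- p / 2, - q / 2, - t) K x) (at 1)"
    unfolding has_field_derivative_def linear_cmul[OF linear_dir_deriv[OF dK]] by (simp add: mult_commute_abs)
  then have "((\<lambda>s. K (p / sqrt s, q / sqrt s, t / s) / s\<^sup>2) has_real_derivative dir_deriv (- p / 2, - q / 2, - t) K x - 2 * K x) (at 1)"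
    by (auto intro!: derivative_eq_intros simp: x)
  then have "((\<lambda>s. h (x, s)) has_real_derivative dir_deriv (- p / 2, - q / 2, - t) K x - 2 * K x) (at 1)"
    by (rule has_field_derivative_transform_within_open[of _ _ _ "{0<..}"]) (auto simp: 1)
  then have "deriv (\<lambda>s. h (x, s)) 1 = dir_deriv (- p / 2, - q / 2, - t) K x - 2 * K x"
    by (rule DERIV_imp_deriv)
  also have "dir_deriv (- p / 2, - q / 2, - t) K x = - euler_field K x / 2"
    by (subst dir_deriv_heis[OF dK]) (simp add: x euler_field_def field_simps)
  finally show ?thesis
    using heat_eq[of 1 x] by (simp add: sub_laplacian_def K_def[abs_def])
qed

text \<open>Green's identity: up to a multiple of the stationarity equation,
  \<open>K x * ou \<psi> x\<close> is minus the divergence of a compactly supported continuously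
  differentiable field, whose integral vanishes.\<close>

lemma weak_stationary:
  assumes \<psi>: "Ck_on 2 \<psi> UNIV" and R: "\<And>x. norm x \<ge> R \<Longrightarrow> \<psi> x = 0"
  shows "(LINT x|lborel. K x * ou \<psi> x) = 0" "integrable lborel (\<lambda>x. K x * ou \<psi> x)"
proof -
  have \<psi>2: "Ck_on (Suc (Suc 0)) \<psi> UNIV" using \<psi> by (simp only: numeral_2_eq_2)
  have \<psi>1: "Ck_on (Suc 0) \<psi> UNIV" by (rule Ck_on_SucD[OF \<psi>2])
  have K: "Ck_on k K UNIV" for k using smooth_K by (simp add: smooth_on_def)
  note c1 = \<psi>1 K[of "Suc 0"] Ck_on_XY_field[OF \<psi>2] Ck_on_XY_field[OF K[of "Suc (Suc 0)"]]
  note d1 = c1[THEN Ck_on_differentiable]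
  define G1 where "G1 x = \<psi> x * X_field K x - K x * X_field \<psi> x" for x
  define G2 where "G2 x = \<psi> x * Y_field K x - K x * Y_field \<psi> x" for x
  define u where "u x = \<psi> x * K x" for x
  have G: "Ck_on (Suc 0) G1 UNIV" "Ck_on (Suc 0) G2 UNIV"
  proof -
    have "G1 = (\<lambda>x. \<psi> x * X_field K x + (- 1) * (K x * X_field \<psi> x))"
      "G2 = (\<lambda>x. \<psi> x * Y_field K x + (- 1) * (K x * Y_field \<psi> x))"
      by (auto simp: G1_def G2_def)
    then show "Ck_on (Suc 0) G1 UNIV" "Ck_on (Suc 0) G2 UNIV"
      by (simp_all only:) (intro Ck_on_add Ck_on_mult Ck_on_const c1 open_UNIV)+
  qed
  have u: "Ck_on (Suc 0) u UNIV" unfolding u_def[abs_def] by (intro Ck_on_mult c1 open_UNIV)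
  define c d :: real where "c = 1 / 2" and "d = - 1 / 2"
  \<comment> \<open>\<open>Fp\<close>, \<open>Fq\<close> and \<open>Ft\<close> are the coordinate
    components of the vector field \<open>G1 X + G2 Y + (u / 2) E\<close>, where \<open>E\<close> is
    the generator of the dilations.\<close>
  define Fp where "Fp x = G1 x + c * (fst x * u x)" for x
  define Fq where "Fq x = G2 x + c * (fst (snd x) * u x)" for x
  define Ft where "Ft x = d * (fst (snd x) * G1 x) + c * (fst x * G2 x) + snd (snd x) * u x" for x
  have F: "Ck_on (Suc 0) Fp UNIV" "Ck_on (Suc 0) Fq UNIV" "Ck_on (Suc 0) Ft UNIV"
    unfolding Fp_def[abs_def] Fq_def[abs_def] Ft_def[abs_def]
    by (intro Ck_on_add Ck_on_mult Ck_on_const G u bounded_linear_coords[THEN Ck_on_linear] open_UNIV)+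
  \<comment> \<open>The margin 1 arises because the derivatives of \<open>\<psi>\<close> are known
    to vanish only where \<open>norm x\<close> strictly exceeds \<open>R\<close>.\<close>
  have supp: "\<psi> x = 0" "dir_deriv v \<psi> x = 0" if "norm x \<ge> R + 1" for x v
    using dir_deriv_zero_outside[of R \<psi> x v] R that by auto
  have G0: "G1 x = 0" "G2 x = 0" "u x = 0" if "norm x \<ge> R + 1" for x
    using supp[OF that] by (auto simp: G1_def G2_def u_def X_field_eq Y_field_eq)
  have F0: "Fp x = 0" "Fq x = 0" "Ft x = 0" if "norm x \<ge> R + 1" for x
    using G0[OF that] by (auto simp: Fp_def Fq_def Ft_def)
  have ip: "integrable lborel (d_p Fp)" "(LINT x|lborel. d_p Fp x) = 0"
    and iq: "integrable lborel (d_q Fq)" "(LINT x|lborel. d_q Fq x) = 0"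
    and it: "integrable lborel (d_t Ft)" "(LINT x|lborel. d_t Ft x) = 0"
    using integral_dir_deriv_zero[of Fp "(1, 0, 0)" "R + 1"] integral_dir_deriv_zero[of Fq "(0, 1, 0)" "R + 1"]
      integral_dir_deriv_zero[of Ft "(0, 0, 1)" "R + 1"] F F0 by (auto simp: Basis_heis)
  have dG: "G1 differentiable (at x)" "G2 differentiable (at x)" "u differentiable (at x)" for x
    by (rule G[THEN Ck_on_differentiable] u[THEN Ck_on_differentiable])+
  have eq: "K x * ou \<psi> x = - (d_p Fp x + d_q Fq x + d_t Ft x)" for x
  proof -
    have "d_p Fp x + d_q Fq x + d_t Ft x = X_field G1 x + Y_field G2 x + euler_field u x / 2 + 2 * u x"
      unfolding Fp_def[abs_def] Fq_def[abs_def] Ft_def[abs_def] X_field_eq Y_field_eq euler_field_def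
      by (simp add: dir_deriv_add dir_deriv_mult dG) (simp add: c_def d_def field_simps)
    also have "X_field G1 x = \<psi> x * X_field (X_field K) x - K x * X_field (X_field \<psi>) x"
      unfolding G1_def[abs_def] by (simp add: XY_field_diff XY_field_mult d1)
    also have "Y_field G2 x = \<psi> x * Y_field (Y_field K) x - K x * Y_field (Y_field \<psi>) x"
      unfolding G2_def[abs_def] by (simp add: XY_field_diff XY_field_mult d1)
    also have "euler_field u x = \<psi> x * euler_field K x + K x * euler_field \<psi> x"
      unfolding u_def[abs_def] euler_field_def by (simp add: dir_deriv_mult d1 algebra_simps)
    finally have "d_p Fp x + d_q Fq x + d_t Ft x = \<psi> x * (X_field (X_field K) x + Y_field (Y_field K) x + euler_field K x / 2 + 2 * K x)
       - K x * ou \<psi> x"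
      by (simp add: u_def ou_def field_simps)
    then show ?thesis by (simp add: K_stationary)
  qed
  show "(LINT x|lborel. K x * ou \<psi> x) = 0" "integrable lborel (\<lambda>x. K x * ou \<psi> x)"
    unfolding eq using ip iq it by simp_all
qed

end

text \<open>A Lyapunov function of \<^const>\<open>ou\<close>, with \<open>ou lyap \<le> C - lyap / 2\<close>. Integrating concave truncations of it
  against the invariant density \<open>K\<close> bounds the exponential moments of \<open>K\<close>.\<close>

definition lyap :: "heis \<Rightarrow> real" where
  "lyap x = exp (((fst x)\<^sup>2 + (fst (snd x))\<^sup>2) / 8) * (exp (snd (snd x) / 4) + exp (- snd (snd x) / 4))"

text \<open>Four times the central derivative of \<open>lyap\<close>. The pair is closed under
  differentiation up to coefficients of degree at most one, which makes smoothness of both a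
  simultaneous induction.\<close>

definition lyap_sinh :: "heis \<Rightarrow> real" where
  "lyap_sinh x = exp (((fst x)\<^sup>2 + (fst (snd x))\<^sup>2) / 8) * (exp (snd (snd x) / 4) - exp (- snd (snd x) / 4))"

lemma has_derivative_lyap:
  "(lyap has_derivative (\<lambda>v. (fst x * fst v + fst (snd x) * fst (snd v)) / 4 * lyap x + snd (snd v) / 4 * lyap_sinh x)) (at x)"
  unfolding lyap_def[abs_def] lyap_sinh_def
  by (auto intro!: derivative_eq_intros simp: fun_eq_iff field_simps)

lemma has_derivative_lyap_sinh:
  "(lyap_sinh has_derivative (\<lambda>v. (fst x * fst v + fst (snd x) * fst (snd v)) / 4 * lyap_sinh x + snd (snd v) / 4 * lyap x)) (at x)"
  unfolding lyap_sinh_def[abs_def] lyap_def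
  by (auto intro!: derivative_eq_intros simp: fun_eq_iff field_simps)

lemma dir_deriv_lyap: "dir_deriv v lyap x = (fst x * fst v + fst (snd x) * fst (snd v)) / 4 * lyap x + snd (snd v) / 4 * lyap_sinh x"
  by (rule dir_deriv_eq[OF has_derivative_lyap])

lemma dir_deriv_lyap_sinh: "dir_deriv v lyap_sinh x = (fst x * fst v + fst (snd x) * fst (snd v)) / 4 * lyap_sinh x + snd (snd v) / 4 * lyap x"
  by (rule dir_deriv_eq[OF has_derivative_lyap_sinh])

lemma lyap_differentiable: "lyap differentiable (at x)" and lyap_sinh_differentiable: "lyap_sinh differentiable (at x)"
  by (rule differentiableI[OF has_derivative_lyap] differentiableI[OF has_derivative_lyap_sinh])+

lemma Ck_on_lyap: "Ck_on k lyap UNIV" and Ck_on_lyap_sinh: "Ck_on k lyap_sinh UNIV"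
proof -
  have "Ck_on k lyap UNIV \<and> Ck_on k lyap_sinh UNIV"
  proof (induction k)
    case 0
    show ?case unfolding lyap_def[abs_def] lyap_sinh_def[abs_def] by (auto intro!: continuous_intros)
  next
    case (Suc k)
    have 1: "dir_deriv v lyap = (\<lambda>x. (fst v / 4 * fst x + fst (snd v) / 4 * fst (snd x)) * lyap x + snd (snd v) / 4 * lyap_sinh x)"
      "dir_deriv v lyap_sinh = (\<lambda>x. (fst v / 4 * fst x + fst (snd v) / 4 * fst (snd x)) * lyap_sinh x + snd (snd v) / 4 * lyap x)" for v
      by (auto simp: dir_deriv_lyap dir_deriv_lyap_sinh field_simps)
    have "Ck_on k (dir_deriv v lyap) UNIV" "Ck_on k (dir_deriv v lyap_sinh) UNIV" for v
      unfolding 1 using Suc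
      by (intro Ck_on_add Ck_on_mult Ck_on_const bounded_linear_coords[THEN Ck_on_linear] open_UNIV; blast)+
    then show ?case by (simp add: lyap_differentiable lyap_sinh_differentiable)
  qed
  then show "Ck_on k lyap UNIV" "Ck_on k lyap_sinh UNIV" by auto
qed

text \<open>With \<open>r = p\<^sup>2 + q\<^sup>2\<close>, the second-order part contributes
  \<open>5 / 64 * r\<close> times \<open>lyap\<close> and the drift \<open>- 8 / 64 * r\<close>; the
  rates 1/8 and 1/4 in \<open>lyap\<close> are small enough for the drift to win. The mixed terms in
  \<open>p * q\<close> from the two fields cancel.\<close>

lemma ou_lyap: "ou lyap x = lyap x * (1 / 2 - 3 / 64 * ((fst x)\<^sup>2 + (fst (snd x))\<^sup>2)) - snd (snd x) * lyap_sinh x / 4"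
proof -
  define a b c d :: real where "a = 1 / 4" and "b = - 1 / 8" and "c = 1 / 4" and "d = 1 / 8"
  have X: "X_field lyap = (\<lambda>x. a * (fst x * lyap x) + b * (fst (snd x) * lyap_sinh x))"
    by (auto simp: X_field_eq dir_deriv_lyap a_def b_def)
  have Y: "Y_field lyap = (\<lambda>x. c * (fst (snd x) * lyap x) + d * (fst x * lyap_sinh x))"
    by (auto simp: Y_field_eq dir_deriv_lyap c_def d_def)
  show ?thesis
    unfolding ou_def X Y
    by (simp add: X_field_eq Y_field_eq dir_deriv_add dir_deriv_mult lyap_differentiable lyap_sinh_differentiable
       dir_deriv_lyap dir_deriv_lyap_sinh euler_field_def)
      (simp add: a_def b_def c_def d_def power2_eq_square field_simps)
qed

lemma lyap_pos: "lyap x > 0"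
  by (simp add: lyap_def add_pos_pos)

text \<open>The two exponentials in \<open>t\<close> are a smooth substitute for
  \<open>exp (\<bar>t\<bar> / 4)\<close>, which dominates
  \<open>exp (\<bar>t\<bar> / 8)\<close>.\<close>

lemma exp_hnorm_le_lyap: "exp (hnorm x / 8) \<le> lyap x"
proof -
  have "exp (hnorm x / 8) = exp (((fst x)\<^sup>2 + (fst (snd x))\<^sup>2) / 8) * exp (\<bar>snd (snd x)\<bar> / 8)"
    by (simp add: hnorm_def exp_add[symmetric] field_simps)
  also have "\<dots> \<le> lyap x"
  proof -
    have "exp (\<bar>t\<bar> / 8) \<le> exp (t / 4) + exp (- t / 4)" for t :: real
    proof (cases "t \<ge> 0")
      case True
      then have "exp (\<bar>t\<bar> / 8) \<le> exp (t / 4)" by simp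
      then show ?thesis by (simp add: add_increasing2)
    next
      case False
      then have "exp (\<bar>t\<bar> / 8) \<le> exp (- t / 4)" by simp
      then show ?thesis by (simp add: add_increasing)
    qed
    then show ?thesis unfolding lyap_def by (intro mult_left_mono) auto
  qed
  finally show ?thesis .
qed

text \<open>After adding \<open>lyap / 2\<close>, the first term is nonpositive once
  \<open>r \<ge> 64 / 3\<close>, and for \<open>\<bar>t\<bar> \<ge> 8\<close> the term with
  \<open>lyap_sinh\<close> outweighs \<open>lyap\<close>. Only a bounded region is left.\<close>

lemma ou_lyap_le: obtains C where "C > 0" "\<And>x. ou lyap x \<le> C - lyap x / 2"
proof -
  \<comment> \<open>An upper bound of \<open>lyap\<close> on the region \<open>r < 64 / 3\<close>,
    \<open>\<bar>t\<bar> < 8\<close>, where \<open>u = exp (\<bar>t\<bar> / 4)\<close> is at most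
    \<open>exp 2\<close> and \<open>u + 1 / u \<le> 2 * u\<close>.\<close>
  define C where "C = exp (64 / 3 / 8) * (2 * exp (2 :: real))"
  have "lyap x * (1 - 3 / 64 * ((fst x)\<^sup>2 + (fst (snd x))\<^sup>2)) - snd (snd x) * lyap_sinh x / 4 \<le> C" for x
  proof -
    define r t where "r = (fst x)\<^sup>2 + (fst (snd x))\<^sup>2" and "t = snd (snd x)"
    define u where "u = exp (\<bar>t\<bar> / 4)"
    have u: "u \<ge> 1" "exp (- (\<bar>t\<bar> / 4)) = 1 / u" by (simp_all add: u_def exp_minus field_simps)
    have e: "t \<ge> 0 \<and> exp (t / 4) = u \<and> exp (- t / 4) = 1 / u \<or> t < 0 \<and> exp (t / 4) = 1 / u \<and> exp (- t / 4) = u"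
      using u(2) unfolding u_def by (cases "t \<ge> 0") (simp_all add: not_le)
    have W: "lyap x = exp (r / 8) * (u + 1 / u)"
      unfolding lyap_def r_def[symmetric] t_def[symmetric] using e by (elim disjE conjE) (simp_all only: add.commute)
    have S: "t * lyap_sinh x = exp (r / 8) * (\<bar>t\<bar> * (u - 1 / u))"
      unfolding lyap_sinh_def r_def[symmetric] t_def[symmetric] using e
    proof (elim disjE conjE)
      assume *: "t < 0" "exp (t / 4) = 1 / u" "exp (- t / 4) = u"
      show "t * (exp (r / 8) * (exp (t / 4) - exp (- t / 4))) = exp (r / 8) * (\<bar>t\<bar> * (u - 1 / u))"
        unfolding *(2,3) using *(1) by (simp add: algebra_simps)
    next
      assume *: "t \<ge> 0" "exp (t / 4) = u" "exp (- t / 4) = 1 / u"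
      show "t * (exp (r / 8) * (exp (t / 4) - exp (- t / 4))) = exp (r / 8) * (\<bar>t\<bar> * (u - 1 / u))"
        unfolding *(2,3) using *(1) by simp
    qed
    have r0: "r \<ge> 0" by (simp add: r_def)
    have u1: "1 / u \<le> u" using u mult_mono[of 1 u 1 u] by (simp add: divide_le_eq)
    have C0: "C > 0" by (simp add: C_def)
    have S0: "t * lyap_sinh x \<ge> 0" unfolding S using u1 by (intro mult_nonneg_nonneg) auto
    have W0: "lyap x \<ge> 0" using lyap_pos[of x] by simp
    have "lyap x * (1 - 3 / 64 * r) - t * lyap_sinh x / 4 \<le> C"
    proof (cases "r \<ge> 64 / 3")
      case True
      then have "lyap x * (1 - 3 / 64 * r) \<le> 0" using W0 by (intro mult_nonneg_nonpos) auto
      then show ?thesis using S0 C0 by linarith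
    next
      case r: False
      have le: "lyap x * (1 - 3 / 64 * r) \<le> lyap x"
        using mult_left_mono[of "1 - 3 / 64 * r" 1 "lyap x"] W0 r0 by simp
      show ?thesis
      proof (cases "\<bar>t\<bar> \<ge> 8")
        case True
        have "u \<ge> 3" using exp_ge_add_one_self[of "\<bar>t\<bar> / 4"] True unfolding u_def by linarith
        then have "3 / u \<le> u" using mult_mono[of 3 u 1 u] by (simp add: divide_le_eq)
        then have "4 * (u + 1 / u) \<le> 8 * (u - 1 / u)" by simp
        also have "\<dots> \<le> \<bar>t\<bar> * (u - 1 / u)" using True u1 by (intro mult_right_mono) auto
        finally have "exp (r / 8) * (4 * (u + 1 / u)) \<le> t * lyap_sinh x" unfolding S by (intro mult_left_mono) auto
        then have "lyap x \<le> t * lyap_sinh x / 4" unfolding W by (simp add: algebra_simps)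
        then show ?thesis using le C0 by linarith
      next
        case False
        have "u \<le> exp 2" using False by (simp add: u_def)
        moreover have "1 / u \<le> u" by (rule u1)
        ultimately have "u + 1 / u \<le> 2 * exp 2" by linarith
        moreover have "exp (r / 8) \<le> exp (64 / 3 / 8)" using r by simp
        ultimately have "lyap x \<le> C" unfolding W C_def using u(1) by (intro mult_mono) auto
        then show ?thesis using le S0 by linarith
      qed
    qed
    then show ?thesis by (simp add: r_def t_def)
  qed
  then have "ou lyap x \<le> C - lyap x / 2" for x
    unfolding ou_lyap by (simp add: right_diff_distrib) (smt (verit) field_sum_of_halves)
  then show ?thesis using that[of C] by (simp add: C_def)
qed

section \<open>Concave truncations of the Lyapunov function\<close>

context
  fixes N :: real
  assumes N: "N > 0"
begin

text \<open>Increasing and concave, and zero from \<open>N\<close> on, so that its composition with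
  \<open>lyap\<close> has compact support. The cubic power makes it twice continuously
  differentiable. Its derivative \<open>cut1\<close> takes values in \<open>[0, 1]\<close> on the
  range of \<open>lyap\<close> and tends to 1 pointwise as \<open>N\<close> grows;
  \<open>cut2\<close> is its second derivative.\<close>

definition cut0 :: "real \<Rightarrow> real" where "cut0 w = - (N / 3) * max 0 (1 - w / N) ^ 3"
definition cut1 :: "real \<Rightarrow> real" where "cut1 w = max 0 (1 - w / N) ^ 2"
definition cut2 :: "real \<Rightarrow> real" where "cut2 w = - (2 / N) * max 0 (1 - w / N)"

lemma has_real_derivative_cut0: "(cut0 has_real_derivative cut1 w) (at w)"
proof -
  have "((\<lambda>w. 1 - w / N) has_real_derivative - 1 / N) (at w)"
    using N by (auto intro!: derivative_eq_intros)
  from DERIV_chain2[OF has_real_derivative_pos_part_power[of 1] this]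
  have "((\<lambda>w. max 0 (1 - w / N) ^ 3) has_real_derivative 3 * max 0 (1 - w / N) ^ 2 * (- 1 / N)) (at w)"
    by (simp add: numeral_eq_Suc)
  from DERIV_cmult[OF this, of "- (N / 3)"] show ?thesis
    using N unfolding cut0_def[abs_def] cut1_def by simp
qed

lemma has_real_derivative_cut1: "(cut1 has_real_derivative cut2 w) (at w)"
proof -
  have "((\<lambda>w. 1 - w / N) has_real_derivative - 1 / N) (at w)"
    using N by (auto intro!: derivative_eq_intros)
  from DERIV_chain2[OF has_real_derivative_pos_part_power[of 0] this]
  show ?thesis
    using N unfolding cut1_def[abs_def] cut2_def by (simp add: numeral_eq_Suc)
qed

lemma Ck_on_cut0_lyap: "Ck_on 2 (\<lambda>x. cut0 (lyap x)) UNIV"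
proof -
  have c: "continuous_on UNIV (\<lambda>x. cut2 (lyap x))"
    unfolding cut2_def by (intro continuous_intros Ck_on_continuous[OF Ck_on_lyap]) (use N in auto)
  have 1: "dir_deriv v (\<lambda>x. cut1 (lyap x)) = (\<lambda>x. cut2 (lyap x) * dir_deriv v lyap x)" for v
    by (auto intro!: dir_deriv_compose_real(1) has_real_derivative_cut1 lyap_differentiable)
  have 0: "dir_deriv v (\<lambda>x. cut0 (lyap x)) = (\<lambda>x. cut1 (lyap x) * dir_deriv v lyap x)" for v
    by (auto intro!: dir_deriv_compose_real(1) has_real_derivative_cut0 lyap_differentiable)
  have W: "Ck_on k (dir_deriv v lyap) UNIV" if "v \<in> Basis" for v k
    using Ck_on_lyap[of "Suc k"] that by simp
  have k1: "Ck_on (Suc 0) (\<lambda>x. cut1 (lyap x)) UNIV"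
    using dir_deriv_compose_real(2)[OF has_real_derivative_cut1 lyap_differentiable]
    by (auto simp: 1 intro!: continuous_intros c Ck_on_continuous[OF W])
  have "Ck_on (Suc 0) (dir_deriv v (\<lambda>x. cut0 (lyap x))) UNIV" if "v \<in> Basis" for v
    unfolding 0 by (intro Ck_on_mult k1 W that open_UNIV)
  then have "Ck_on (Suc (Suc 0)) (\<lambda>x. cut0 (lyap x)) UNIV"
    using dir_deriv_compose_real(2)[OF has_real_derivative_cut0 lyap_differentiable]
    by (simp only: Ck_on.simps(2)[of "Suc 0"]) blast
  then show ?thesis by (simp only: numeral_2_eq_2)
qed

lemma ou_cut0_lyap: "ou (\<lambda>x. cut0 (lyap x)) x = cut1 (lyap x) * ou lyap x + cut2 (lyap x) * ((X_field lyap x)\<^sup>2 + (Y_field lyap x)\<^sup>2)"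
proof -
  have 1: "dir_deriv v (\<lambda>x. cut1 (lyap x)) x = cut2 (lyap x) * dir_deriv v lyap x" for v x
    by (auto intro!: dir_deriv_compose_real(1) has_real_derivative_cut1 lyap_differentiable)
  have 0: "dir_deriv v (\<lambda>x. cut0 (lyap x)) x = cut1 (lyap x) * dir_deriv v lyap x" for v x
    by (auto intro!: dir_deriv_compose_real(1) has_real_derivative_cut0 lyap_differentiable)
  have d1: "(\<lambda>x. cut1 (lyap x)) differentiable (at x)" for x
    by (rule dir_deriv_compose_real(2)[OF has_real_derivative_cut1 lyap_differentiable])
  have dX: "X_field lyap differentiable (at x)" "Y_field lyap differentiable (at x)" for x
    using Ck_on_XY_field[OF Ck_on_lyap[of "Suc (Suc 0)"]] Ck_on_differentiable by blast+
  have X0: "X_field (\<lambda>x. cut0 (lyap x)) = (\<lambda>x. cut1 (lyap x) * X_field lyap x)"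
    "Y_field (\<lambda>x. cut0 (lyap x)) = (\<lambda>x. cut1 (lyap x) * Y_field lyap x)"
    by (auto simp: X_field_eq Y_field_eq 0 algebra_simps)
  have X1: "X_field (\<lambda>x. cut1 (lyap x)) x = cut2 (lyap x) * X_field lyap x"
    "Y_field (\<lambda>x. cut1 (lyap x)) x = cut2 (lyap x) * Y_field lyap x" for x
    by (auto simp: X_field_eq Y_field_eq 1 algebra_simps)
  show ?thesis
    unfolding ou_def X0 by (simp add: XY_field_mult d1 dX X1 euler_field_def 0 power2_eq_square field_simps)
qed

lemma cut_zero: "lyap x \<ge> N \<Longrightarrow> cut0 (lyap x) = 0" "lyap x \<ge> N \<Longrightarrow> cut1 (lyap x) = 0"
  using N by (simp_all add: cut0_def cut1_def)

lemma cut1_range: "0 \<le> cut1 (lyap x)" "cut1 (lyap x) \<le> 1"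
proof -
  have "max 0 (1 - lyap x / N) \<le> 1" using lyap_pos[of x] N by (simp add: less_imp_le)
  then show "cut1 (lyap x) \<le> 1" unfolding cut1_def by (intro power_le_one) auto
qed (simp add: cut1_def)

lemma cut2_nonpos: "cut2 w \<le> 0"
  using N by (simp add: cut2_def mult_nonpos_nonneg)

text \<open>Combines \<open>lyap x \<ge> 1 + hnorm x / 8\<close> with
  \<open>hnorm x \<ge> norm x - 2\<close>.\<close>

lemma lyap_large: "norm x \<ge> 8 * N + 2 \<Longrightarrow> lyap x \<ge> N"
  using exp_hnorm_le_lyap[of x] exp_ge_add_one_self[of "hnorm x / 8"] norm_le_hnorm[of x] by linarith

end
section \<open>Gaussian decay of the heat kernel\<close>

lemma continuous_on_hnorm: "continuous_on UNIV hnorm"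
  unfolding hnorm_def[abs_def] by (intro continuous_intros)

lemma measurable_hnorm [measurable]: "hnorm \<in> borel_measurable borel"
  by (rule borel_measurable_continuous_onI[OF continuous_on_hnorm])

text \<open>A quasi-triangle inequality. The factor 3 collects the 2 from squaring a sum and a
  further 1/2 from the twisting term; it accounts for the rate 1/48 = 1/(3 * 16) below.\<close>

lemma hnorm_mult_le: "hnorm (x \<odot> y) \<le> 3 * (hnorm x + hnorm y)"
proof -
  obtain a b c d e f where x: "x = (a, b, c)" and y: "y = (d, e, f)" by (metis prod_cases3)
  have 1: "(a + d)\<^sup>2 \<le> 2 * a\<^sup>2 + 2 * d\<^sup>2" "(b + e)\<^sup>2 \<le> 2 * b\<^sup>2 + 2 * e\<^sup>2"
    using zero_le_power2[of "a - d"] zero_le_power2[of "b - e"] by (simp_all add: power2_eq_square algebra_simps)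
  have 2: "\<bar>a * e\<bar> \<le> (a\<^sup>2 + e\<^sup>2) / 2" "\<bar>b * d\<bar> \<le> (b\<^sup>2 + d\<^sup>2) / 2"
    using zero_le_power2[of "\<bar>a\<bar> - \<bar>e\<bar>"] zero_le_power2[of "\<bar>b\<bar> - \<bar>d\<bar>"]
    by (simp_all add: power2_eq_square algebra_simps abs_mult)
  have 3: "\<bar>c + f + (a * e - b * d) / 2\<bar> \<le> \<bar>c\<bar> + \<bar>f\<bar> + (\<bar>a * e\<bar> + \<bar>b * d\<bar>) / 2"
  proof -
    have "\<bar>c + f + z\<bar> \<le> \<bar>c\<bar> + \<bar>f\<bar> + \<bar>z\<bar>" for z by linarith
    moreover have "\<bar>(a * e - b * d) / 2\<bar> \<le> (\<bar>a * e\<bar> + \<bar>b * d\<bar>) / 2"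
      using abs_triangle_ineq4[of "a * e" "b * d"] by simp
    ultimately show ?thesis by (meson add_left_mono order_trans)
  qed
  have 4: "hnorm (x \<odot> y) = (a + d)\<^sup>2 + (b + e)\<^sup>2 + \<bar>c + f + (a * e - b * d) / 2\<bar>"
    "hnorm x = a\<^sup>2 + b\<^sup>2 + \<bar>c\<bar>" "hnorm y = d\<^sup>2 + e\<^sup>2 + \<bar>f\<bar>" by (simp_all add: x y hnorm_def)
  have lin: "s1 + s2 + s3 \<le> 3 * (A + B + C + (D + E + F))"
    if "s1 \<le> 2 * A + 2 * D" "s2 \<le> 2 * B + 2 * E" "s3 \<le> C + F + (u + w) / 2" "u \<le> (A + E) / 2" "w \<le> (B + D) / 2"
      "0 \<le> A" "0 \<le> B" "0 \<le> C" "0 \<le> D" "0 \<le> E" "0 \<le> F" for s1 s2 s3 A B C D E F u w :: real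
    using that by (simp add: field_simps)
  show ?thesis unfolding 4 by (rule lin[OF 1 3 2]) auto
qed

lemma foldr_vfield_const: "foldr vfield (map (\<lambda>v _. v) vs) f = iter_deriv vs f"
  unfolding iter_deriv_def by (induction vs) (auto simp: vfield_def[abs_def])

lemma eucl_gauss_tame_iter: "eucl_gauss.tame f \<Longrightarrow> set vs \<subseteq> Basis \<Longrightarrow> eucl_gauss.tame (iter_deriv vs f)"
proof (induction vs)
  case (Cons v vs)
  have "eucl_gauss.tame (vfield (\<lambda>_. v) (iter_deriv vs f))"
    using Cons by (intro eucl_gauss.tame_vfield) auto
  then show ?case by (simp add: iter_deriv_def vfield_def[abs_def])
qed (simp add: iter_deriv_def)

context heis_heat
begin

text \<open>Testing stationarity with the truncated Lyapunov function gives a bound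
  \<open>2 * C\<close> on the integral of \<open>K * cut1 * lyap\<close> that does not depend on the
  truncation level. Fatou's lemma removes the truncation.\<close>

lemma K_exp_moment: "integrable lborel (\<lambda>x. exp (hnorm x / 8) * K x)"
proof -
  obtain C where C: "C > 0" "\<And>x. ou lyap x \<le> C - lyap x / 2" using ou_lyap_le by blast
  have cK: "continuous_on UNIV K" by (rule smooth_on_continuous[OF smooth_K])
  have cW: "continuous_on UNIV lyap" by (rule Ck_on_continuous[OF Ck_on_lyap])
  have [measurable]: "K \<in> borel_measurable borel" "lyap \<in> borel_measurable borel"
    using cK cW by (auto intro: borel_measurable_continuous_onI)
  have iK: "integrable lborel K" "(LINT x|lborel. K x) = 1"
    using integrable_h[of 1] integral_h[of 1] by (simp_all add: K_def[abs_def])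
  define F where "F N x = K x * (cut1 N (lyap x) * lyap x)" for N x
  have F_nonneg: "F N x \<ge> 0" if "N > 0" for N x
    unfolding F_def using K_nonneg lyap_pos[of x] cut1_range(1)[OF that] by (simp add: less_imp_le)
  have F: "integrable lborel (F N)" "(LINT x|lborel. F N x) \<le> 2 * C" if N: "N > 0" for N
  proof -
    have "continuous_on UNIV (F N)"
      unfolding F_def[abs_def] cut1_def[OF N] using N by (intro continuous_intros cK cW) auto
    moreover have "F N x = 0" if "norm x \<ge> 8 * N + 2" for x
      using cut_zero(2)[OF N lyap_large[OF N that]] by (simp add: F_def)
    ultimately show i: "integrable lborel (F N)" by (rule integrable_continuous_compact_support)
    have 0: "cut0 N (lyap x) = 0" if "norm x \<ge> 8 * N + 2" for x
      using cut_zero(1)[OF N lyap_large[OF N that]] .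
    note w = weak_stationary[OF Ck_on_cut0_lyap[OF N] 0]
    have "K x * ou (\<lambda>x. cut0 N (lyap x)) x \<le> C * K x - F N x / 2" for x
    proof -
      have "ou (\<lambda>x. cut0 N (lyap x)) x \<le> cut1 N (lyap x) * ou lyap x"
        unfolding ou_cut0_lyap[OF N] using cut2_nonpos[OF N] by (simp add: mult_nonpos_nonneg)
      also have "\<dots> \<le> cut1 N (lyap x) * (C - lyap x / 2)"
        by (intro mult_left_mono C cut1_range[OF N])
      also have "\<dots> \<le> C - cut1 N (lyap x) * lyap x / 2"
        using mult_right_mono[OF cut1_range(2)[OF N, of x], of C] C(1) by (simp add: algebra_simps)
      finally have "K x * ou (\<lambda>x. cut0 N (lyap x)) x \<le> K x * (C - cut1 N (lyap x) * lyap x / 2)"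
        by (intro mult_left_mono K_nonneg)
      then show ?thesis by (simp add: F_def algebra_simps)
    qed
    then have "(LINT x|lborel. K x * ou (\<lambda>x. cut0 N (lyap x)) x) \<le> (LINT x|lborel. C * K x - F N x / 2)"
      using w iK i by (intro integral_mono) auto
    also have "\<dots> = C - (LINT x|lborel. F N x) / 2" using iK i by simp
    finally show "(LINT x|lborel. F N x) \<le> 2 * C" using w(1) by simp
  qed
  have lim: "(\<lambda>n. F (real (Suc n)) x) \<longlonglongrightarrow> K x * lyap x" for x
  proof -
    have "(\<lambda>n. lyap x * inverse (real (Suc n))) \<longlonglongrightarrow> lyap x * 0"
      by (intro tendsto_intros LIMSEQ_inverse_real_of_nat)
    then have "(\<lambda>n. K x * (max 0 (1 - lyap x / real (Suc n)) ^ 2 * lyap x)) \<longlonglongrightarrow> K x * (max 0 (1 - 0) ^ 2 * lyap x)"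
      unfolding divide_inverse by (intro tendsto_intros) simp
    then show ?thesis by (simp add: F_def cut1_def)
  qed
  have "(\<integral>\<^sup>+x. ennreal (K x * lyap x) \<partial>lborel) = (\<integral>\<^sup>+x. liminf (\<lambda>n. ennreal (F (real (Suc n)) x)) \<partial>lborel)"
    using lim by (intro nn_integral_cong lim_imp_Liminf[symmetric] tendsto_ennrealI) auto
  also have "\<dots> \<le> liminf (\<lambda>n. \<integral>\<^sup>+x. ennreal (F (real (Suc n)) x) \<partial>lborel)"
    using F(1) by (intro nn_integral_liminf) (auto intro!: measurable_compose[OF _ measurable_ennreal] borel_measurable_integrable)
  also have "\<dots> \<le> liminf (\<lambda>n. ennreal (2 * C))"
  proof (intro Liminf_mono always_eventually allI)
    fix n
    have "(\<integral>\<^sup>+x. ennreal (F (real (Suc n)) x) \<partial>lborel) = ennreal (LINT x|lborel. F (real (Suc n)) x)"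
      by (intro nn_integral_eq_integral F AE_I2 F_nonneg) simp_all
    also have "\<dots> \<le> ennreal (2 * C)" by (intro ennreal_leI F) simp
    finally show "(\<integral>\<^sup>+x. ennreal (F (real (Suc n)) x) \<partial>lborel) \<le> ennreal (2 * C)" .
  qed
  also have "\<dots> < \<infinity>" by (simp add: Liminf_const)
  finally have "integrable lborel (\<lambda>x. K x * lyap x)"
    using K_nonneg lyap_pos by (intro integrableI_nonneg) (auto simp: less_imp_le)
  then show ?thesis
  proof (rule Bochner_Integration.integrable_bound)
    show "(\<lambda>x. exp (hnorm x / 8) * K x) \<in> borel_measurable lborel"
      by measurable
    show "AE x in lborel. norm (exp (hnorm x / 8) * K x) \<le> norm (K x * lyap x)"
    proof (intro always_eventually allI)
      fix x
      show "norm (exp (hnorm x / 8) * K x) \<le> norm (K x * lyap x)"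
        using mult_right_mono[OF exp_hnorm_le_lyap[of x] K_nonneg[of x]] K_nonneg[of x] lyap_pos[of x]
        by (simp add: abs_mult mult.commute)
    qed
  qed
qed

text \<open>Boundedness of \<open>K\<close> turns the exponential moment into integrability of
  \<open>A\<close>, the square of a weighted \<open>K\<close>. In \<open>K * K\<close> the weight
  \<open>exp (hnorm \<omega> / 48)\<close> is split between the two factors by the quasi-triangle
  inequality, and \<open>a * b \<le> (a\<^sup>2 + b\<^sup>2) / 2\<close> bounds the convolution by
  the integral of \<open>A\<close>, uniformly in \<open>\<omega>\<close>.\<close>

lemma gauss_K: "gauss K"
proof -
  obtain B where B: "B > 0" "\<And>x. K x \<le> B" using K_bounded by blast
  have [measurable]: "K \<in> borel_measurable borel"
    by (rule borel_measurable_continuous_onI[OF smooth_on_continuous[OF smooth_K]])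
  define A where "A x = (exp (hnorm x / 16) * K x)\<^sup>2" for x
  have [measurable]: "A \<in> borel_measurable borel"
    unfolding A_def[abs_def] by measurable
  have A_le: "A x \<le> B * (exp (hnorm x / 8) * K x)" for x
  proof -
    have "A x = (K x * exp (hnorm x / 8)) * K x"
      by (simp add: A_def power2_eq_square) (simp add: exp_add[symmetric] mult.assoc[symmetric])
    also have "\<dots> \<le> (K x * exp (hnorm x / 8)) * B" using K_nonneg B by (intro mult_left_mono) auto
    finally show ?thesis by (simp add: ac_simps)
  qed
  have iA: "integrable lborel A"
  proof (rule Bochner_Integration.integrable_bound[OF integrable_mult_right[OF K_exp_moment, of B]])
    show "AE x in lborel. norm (A x) \<le> norm (B * (exp (hnorm x / 8) * K x))"
      using A_le K_nonneg B(1) by (intro always_eventually allI) (simp add: abs_mult, simp add: A_def)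
  qed simp
  define I where "I = (LINT x|lborel. A x)"
  have I: "I \<ge> 0" unfolding I_def A_def by simp
  have h2: "exp (hnorm \<omega> / 48) * h (\<omega>, 2) \<le> I" for \<omega>
  proof -
    have m: "(\<lambda>x. A (x \<odot> \<omega>)) \<in> borel_measurable borel" by measurable
    have i1: "integrable lborel (\<lambda>\<xi>. A (heis_inv \<xi> \<odot> \<omega>))" "(LINT \<xi>|lborel. A (heis_inv \<xi> \<odot> \<omega>)) = I"
    proof -
      have *: "integrable lborel (\<lambda>x. A (x \<odot> \<omega>))"
      proof -
        have eq: "(\<lambda>x. A (x \<odot> \<omega>)) = (\<lambda>x. A (heis_inv (heis_inv \<omega> \<odot> heis_inv x)))" by (simp add: heis_inv_mult)
        show ?thesis unfolding eq
          using integrable_heis_inv[of "\<lambda>x. A (heis_inv (heis_inv \<omega> \<odot> x))"] integrable_heis_left[of "\<lambda>x. A (heis_inv x)" "heis_inv \<omega>"]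
            integrable_heis_inv[of A] iA by simp
      qed
      show "integrable lborel (\<lambda>\<xi>. A (heis_inv \<xi> \<odot> \<omega>))"
        using * integrable_heis_inv[OF m] by simp
      show "(LINT \<xi>|lborel. A (heis_inv \<xi> \<odot> \<omega>)) = I"
        using integral_heis_inv[OF m] integral_heis_right[of A \<omega>] by (simp add: I_def)
    qed
    have c: "has_bochner_integral lborel (\<lambda>\<xi>. K \<xi> * K (heis_inv \<xi> \<odot> \<omega>)) (h (\<omega>, 2))"
    proof -
      have "h (heis_inv \<xi> \<odot> 0, 1) = K \<xi>" for \<xi> using K_inv[of \<xi>] by (simp add: K_def)
      moreover have "heis_inv 0 \<odot> \<omega> = \<omega>" by (simp add: heis_inv_eq)
      ultimately show ?thesis using conv_kernel[of 1 1 0 \<omega>] by (simp add: K_def[symmetric])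
    qed
    have "exp (hnorm \<omega> / 48) * h (\<omega>, 2) = (LINT \<xi>|lborel. exp (hnorm \<omega> / 48) * (K \<xi> * K (heis_inv \<xi> \<odot> \<omega>)))"
      using has_bochner_integral_integral_eq[OF c] by simp
    also have "\<dots> \<le> (LINT \<xi>|lborel. A \<xi> / 2 + A (heis_inv \<xi> \<odot> \<omega>) / 2)"
    proof (rule integral_mono)
      show "integrable lborel (\<lambda>\<xi>. exp (hnorm \<omega> / 48) * (K \<xi> * K (heis_inv \<xi> \<odot> \<omega>)))"
        using c by (simp add: has_bochner_integral_iff)
      show "integrable lborel (\<lambda>\<xi>. A \<xi> / 2 + A (heis_inv \<xi> \<odot> \<omega>) / 2)" using iA i1 by simp
      fix \<xi>
      define a b where "a = exp (hnorm \<xi> / 16) * K \<xi>" and "b = exp (hnorm (heis_inv \<xi> \<odot> \<omega>) / 16) * K (heis_inv \<xi> \<odot> \<omega>)"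
      have "hnorm \<omega> \<le> 3 * (hnorm \<xi> + hnorm (heis_inv \<xi> \<odot> \<omega>))"
        using hnorm_mult_le[of \<xi> "heis_inv \<xi> \<odot> \<omega>"] by simp
      then have "exp (hnorm \<omega> / 48) \<le> exp (hnorm \<xi> / 16 + hnorm (heis_inv \<xi> \<odot> \<omega>) / 16)" by simp
      then have "exp (hnorm \<omega> / 48) * (K \<xi> * K (heis_inv \<xi> \<odot> \<omega>)) \<le> a * b"
        unfolding a_def b_def using mult_right_mono[of "exp (hnorm \<omega> / 48)" "exp (hnorm \<xi> / 16) * exp (hnorm (heis_inv \<xi> \<odot> \<omega>) / 16)" "K \<xi> * K (heis_inv \<xi> \<odot> \<omega>)"]
          K_nonneg by (simp add: exp_add ac_simps)
      also have "a * b \<le> a\<^sup>2 / 2 + b\<^sup>2 / 2"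
        using zero_le_power2[of "a - b"] by (simp add: power2_eq_square algebra_simps)
      finally show "exp (hnorm \<omega> / 48) * (K \<xi> * K (heis_inv \<xi> \<odot> \<omega>)) \<le> A \<xi> / 2 + A (heis_inv \<xi> \<odot> \<omega>) / 2"
        by (simp add: A_def a_def b_def)
    qed
    also have "\<dots> = I" using iA i1 by (simp add: I_def)
    finally show ?thesis .
  qed
  have "\<bar>K x\<bar> \<le> (4 * I + 1) * exp (- (1 / 24) * hnorm x)" for x
  proof -
    \<comment> \<open>The bound holds at time 2. Dilation by \<open>sqrt 2\<close> brings it back to
      time 1, at the price of a factor 4 and with the rate doubled, since \<open>hnorm\<close> has
      degree 2.\<close>
    define y where "y = dilate (sqrt 2) x"
    have "(1 / sqrt 2) ^ 4 * h (dilate (1 / sqrt 2) y, (1 / sqrt 2)\<^sup>2 * 2) = h (y, 2)"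
      by (intro homogeneous) auto
    moreover have "(1 / sqrt 2) ^ 4 = 1 / 4" "(1 / sqrt 2)\<^sup>2 * 2 = 1"
      by (simp_all add: power_divide power4_eq_xxxx)
    moreover have "dilate (1 / sqrt 2) y = x" by (simp add: y_def dilate_dilate)
    ultimately have Kx: "K x = 4 * h (y, 2)" by (simp add: K_def)
    have hy: "hnorm y / 48 = 1 / 24 * hnorm x" by (simp add: y_def hnorm_dilate)
    have "h (y, 2) \<le> I * exp (- (1 / 24) * hnorm x)"
      using h2[of y] unfolding hy by (simp add: exp_minus field_simps)
    then have "K x \<le> 4 * I * exp (- (1 / 24) * hnorm x)" unfolding Kx by simp
    also have "\<dots> \<le> (4 * I + 1) * exp (- (1 / 24) * hnorm x)" by (intro mult_right_mono) auto
    finally show ?thesis using K_nonneg[of x] by simp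
  qed
  moreover have "4 * I + 1 > 0" using I by simp
  ultimately show ?thesis unfolding gauss_def by (meson zero_less_divide_1_iff zero_less_numeral)
qed

text \<open>Each interpolation step combines Gaussian decay of the current derivative with
  polynomial growth two orders higher, which \<open>poly_bounded_iter_deriv_K\<close> provides at
  every order.\<close>

lemma gauss_iter_deriv_K: "set vs \<subseteq> Basis \<Longrightarrow> gauss (iter_deriv vs K)"
proof (induction vs)
  case Nil
  then show ?case by (simp add: iter_deriv_def gauss_K)
next
  case (Cons v vs)
  have "gauss (dir_deriv v (iter_deriv vs K))"
  proof (rule gauss_dir_deriv)
    show "smooth_on (iter_deriv vs K) UNIV" using Cons by (intro smooth_on_iter_deriv smooth_K) auto
    show "poly_bounded (dir_deriv v (dir_deriv v (iter_deriv vs K)))"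
      using poly_bounded_iter_deriv_K[of "v # v # vs"] Cons by (simp add: iter_deriv_def)
  qed (use Cons in auto)
  then show ?case by (simp add: iter_deriv_def)
qed

lemma eucl_gauss_tame_K: "eucl_gauss.tame K"
proof (rule eucl_gauss.tameI[OF smooth_K])
  fix ws :: "(heis \<Rightarrow> heis) list" assume ws: "set ws \<subseteq> (\<lambda>v _. v) ` Basis"
  then have "\<exists>vs. set vs \<subseteq> Basis \<and> ws = map (\<lambda>v _. v) vs"
  proof (induction ws)
    case (Cons w ws)
    then obtain vs v where "set vs \<subseteq> Basis" "ws = map (\<lambda>v _. v) vs" "v \<in> Basis" "w = (\<lambda>_. v)" by auto
    then show ?case by (intro exI[of _ "v # vs"]) auto
  qed simp
  then show "gauss (foldr vfield ws K)" using foldr_vfield_const gauss_iter_deriv_K by metis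
qed

definition \<phi> :: "heis \<Rightarrow> real" where "\<phi> = sub_laplacian K"

text \<open>The coefficients of \<open>X_field\<close> and \<open>Y_field\<close> are constant or
  linear in \<open>p\<close> and \<open>q\<close>, exactly the multipliers under which the class is
  stable. Knowing decay of \<open>\<phi>\<close> alone would not control its derivatives.\<close>

lemma eucl_gauss_tame_\<phi>: "eucl_gauss.tame \<phi>"
proof -
  have D: "eucl_gauss.tame (dir_deriv v f)" if "eucl_gauss.tame f" "v \<in> Basis" for v f
    using eucl_gauss_tame_iter[OF that(1), of "[v]"] that(2) by (simp add: iter_deriv_def)
  have "eucl_gauss.tame (X_field f)" "eucl_gauss.tame (Y_field f)" if "eucl_gauss.tame f" for f
  proof -
    have "X_field f = (\<lambda>x. d_p f x + (- 1 / 2) * (fst (snd x) * d_t f x))"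
      "Y_field f = (\<lambda>x. d_q f x + (1 / 2) * (fst x * d_t f x))"
      by (auto simp: X_field_eq Y_field_eq)
    then show "eucl_gauss.tame (X_field f)" "eucl_gauss.tame (Y_field f)"
      using that by (simp_all only:) (intro eucl_gauss.tame_add eucl_gauss.tame_cmult eucl_gauss.tame_p eucl_gauss.tame_q D;
        simp add: Basis_heis)+
  qed
  note XY = this
  have "\<phi> = (\<lambda>x. (- 1) * (X_field (X_field K) x + Y_field (Y_field K) x))"
    by (auto simp: \<phi>_def sub_laplacian_def)
  then show ?thesis
    by (simp only:) (intro eucl_gauss.tame_cmult eucl_gauss.tame_add XY eucl_gauss_tame_K)
qed

lemma gauss_iter_deriv_\<phi>: "set vs \<subseteq> Basis \<Longrightarrow> gauss (iter_deriv vs \<phi>)"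
  using eucl_gauss_tame_iter[OF eucl_gauss_tame_\<phi>] eucl_gauss.tame_Q by blast

lemma schwartz_\<phi>: "schwartz \<phi>"
  unfolding schwartz_def
proof (intro conjI allI ballI)
  show "smooth_on \<phi> UNIV" by (rule eucl_gauss.tame_smooth[OF eucl_gauss_tame_\<phi>])
  fix k :: nat and vs :: "heis list" assume "vs \<in> lists Basis"
  then have "gauss (iter_deriv vs \<phi>)" by (intro gauss_iter_deriv_\<phi>) (auto simp: lists_eq_set)
  then obtain C c where C: "C > 0" "c > 0" "\<And>x. \<bar>iter_deriv vs \<phi> x\<bar> \<le> C * exp (- c * hnorm x)"
    unfolding gauss_def by blast
  obtain D where D: "D > 0" "\<And>x::heis. (1 + norm x) ^ k \<le> D * exp (c * hnorm x)"
    using poly_le_exp_hnorm[OF C(2), of k] by blast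
  have "(1 + norm x) ^ k * \<bar>iter_deriv vs \<phi> x\<bar> \<le> D * C" for x
  proof -
    have "(1 + norm x) ^ k * \<bar>iter_deriv vs \<phi> x\<bar> \<le> (D * exp (c * hnorm x)) * (C * exp (- c * hnorm x))"
      using D(1) by (intro mult_mono C D) auto
    also have "\<dots> = D * C" by (simp add: exp_minus)
    finally show ?thesis .
  qed
  then show "\<exists>C. \<forall>x. (1 + norm x) ^ k * \<bar>iter_deriv vs \<phi> x\<bar> \<le> C" by blast
qed

end
section \<open>Approximation of square integrable functions\<close>

lemma nn_integral_inverse_1_plus_square_finite:
  "(\<integral>\<^sup>+x. ennreal (1 / (1 + (x::real)\<^sup>2)) \<partial>lborel) < \<infinity>"
proof -
  have "einterval (-\<infinity>) \<infinity> = UNIV" by (auto simp: einterval_def)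
  then have "integrable lborel (\<lambda>x::real. 1 / (1 + x\<^sup>2))"
    using integrable_inverse_1_plus_square by (simp add: set_integrable_def inverse_eq_divide)
  then show ?thesis by (simp add: integrable_iff_bounded)
qed

text \<open>The exponential factorizes over the coordinates, and each factor is dominated by a
  multiple of \<open>1 / (1 + x\<^sup>2)\<close>, whose integral over the line is finite.\<close>

lemma integrable_exp_hnorm:
  assumes "c > 0"
  shows "integrable lborel (\<lambda>x. exp (- c * hnorm x))"
proof (rule integrableI_nonneg)
  show "(\<lambda>x. exp (- c * hnorm x)) \<in> borel_measurable lborel" by measurable
  obtain C where C: "C > 0" "\<And>y::real. y \<ge> 0 \<Longrightarrow> y ^ 2 \<le> C * exp (c * y)"
    using power_le_exp[OF assms, of 2] by blast
  obtain D where D: "D > 0" "\<And>y::real. y \<ge> 0 \<Longrightarrow> y ^ 1 \<le> D * exp (c * y)"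
    using power_le_exp[OF assms, of 1] by blast
  define a where "a x = 1 / (1 + x\<^sup>2)" for x :: real
  have a: "a x > 0" for x by (simp add: a_def add_pos_nonneg)
  have "continuous_on UNIV a"
    unfolding a_def[abs_def] by (intro continuous_intros) (simp add: sum_power2_eq_zero_iff add_nonneg_eq_0_iff)
  then have ca: "continuous_on UNIV (\<lambda>x. a (g x))" if "continuous_on UNIV g" for g :: "heis \<Rightarrow> real"
    using that by (auto intro: continuous_on_compose2)
  have [measurable]: "a \<in> borel_measurable borel"
    by (rule borel_measurable_continuous_onI) fact
  have ma [measurable]: "(\<lambda>x::heis. a (fst x)) \<in> borel_measurable borel" "(\<lambda>x::heis. a (fst (snd x))) \<in> borel_measurable borel"
    "(\<lambda>x::heis. a (snd (snd x))) \<in> borel_measurable borel"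
    by (intro borel_measurable_continuous_onI ca continuous_intros)+
  have 1: "exp (- c * x\<^sup>2) \<le> (1 + D) * a x" for x
  proof -
    have "1 + x\<^sup>2 \<le> (1 + D) * exp (c * x\<^sup>2)"
      using D(2)[of "x\<^sup>2"] assms by (simp add: distrib_right add_mono)
    then show ?thesis by (simp add: a_def exp_minus field_simps add_pos_nonneg)
  qed
  have 2: "exp (- c * \<bar>x\<bar>) \<le> (1 + C) * a x" for x
  proof -
    have "1 + x\<^sup>2 \<le> (1 + C) * exp (c * \<bar>x\<bar>)"
      using C(2)[of "\<bar>x\<bar>"] assms by (simp add: distrib_right add_mono)
    then show ?thesis by (simp add: a_def exp_minus field_simps add_pos_nonneg)
  qed
  define B where "B = (1 + D) * (1 + D) * (1 + C)"
  have B: "B > 0" using C(1) D(1) by (simp add: B_def)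
  have "exp (- c * hnorm (p, q, t)) \<le> B * (a p * a q * a t)" for p q t
  proof -
    have "exp (- c * hnorm (p, q, t)) = exp (- c * p\<^sup>2) * exp (- c * q\<^sup>2) * exp (- c * \<bar>t\<bar>)"
      by (simp add: hnorm_def exp_add[symmetric] algebra_simps)
    also have "\<dots> \<le> ((1 + D) * a p) * ((1 + D) * a q) * ((1 + C) * a t)"
      using 1 2 a C(1) D(1) by (intro mult_mono) (auto intro!: mult_nonneg_nonneg less_imp_le)
    finally show ?thesis by (simp add: B_def ac_simps)
  qed
  then have "(\<integral>\<^sup>+x. ennreal (exp (- c * hnorm x)) \<partial>lborel)
      \<le> (\<integral>\<^sup>+x. ennreal (B * (a (fst x) * a (fst (snd x)) * a (snd (snd x)))) \<partial>lborel)"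
    by (intro nn_integral_mono ennreal_leI) auto
  also have "\<dots> = (\<integral>\<^sup>+p. \<integral>\<^sup>+q. \<integral>\<^sup>+t. ennreal B * (ennreal (a p) * (ennreal (a q) * ennreal (a t))) \<partial>lborel \<partial>lborel \<partial>lborel)"
    using B a by (subst nn_integral_lborel_heis) (simp_all add: ennreal_mult less_imp_le mult.assoc)
  also have "\<dots> = ennreal B * ((\<integral>\<^sup>+p. ennreal (a p) \<partial>lborel) * ((\<integral>\<^sup>+p. ennreal (a p) \<partial>lborel) * (\<integral>\<^sup>+p. ennreal (a p) \<partial>lborel)))"
    by (simp add: nn_integral_cmult nn_integral_multc)
  also have "\<dots> < \<infinity>"
    using nn_integral_inverse_1_plus_square_finite by (auto simp: a_def ennreal_mult_less_top)
  finally show "(\<integral>\<^sup>+x. ennreal (exp (- c * hnorm x)) \<partial>lborel) < \<infinity>" .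
qed auto

lemma integrable_gauss:
  assumes "gauss f" "f \<in> borel_measurable borel"
  shows "integrable lborel f"
proof -
  obtain C c where C: "C > 0" "c > 0" "\<And>x. \<bar>f x\<bar> \<le> C * exp (- c * hnorm x)"
    using assms(1) unfolding gauss_def by blast
  show ?thesis
    by (rule Bochner_Integration.integrable_bound[OF integrable_mult_right[OF integrable_exp_hnorm[OF C(2)], of C]])
      (use assms(2) C in \<open>auto simp: abs_mult\<close>)
qed

text \<open>The map is a left translation followed by inversion:
  \<open>heis_inv x \<odot> y = heis_inv (heis_inv y \<odot> x)\<close>.\<close>

lemma integrable_heis_inv_mult:
  assumes [measurable]: "f \<in> borel_measurable (borel :: heis measure)" and "integrable lborel f"
  shows "integrable lborel (\<lambda>x. f (heis_inv x \<odot> y) :: real)"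
proof -
  have eq: "(\<lambda>x. f (heis_inv x \<odot> y)) = (\<lambda>x. f (heis_inv (heis_inv y \<odot> x)))" by (simp add: heis_inv_mult)
  show ?thesis unfolding eq
    using integrable_heis_left[of "\<lambda>x. f (heis_inv x)" "heis_inv y"] integrable_heis_inv[of f] assms by simp
qed

lemma integral_heis_inv_mult:
  assumes [measurable]: "f \<in> borel_measurable (borel :: heis measure)"
  shows "(LINT x|lborel. f (heis_inv x \<odot> y)) = (LINT x|lborel. f x :: real)"
proof -
  have eq: "(\<lambda>x. f (heis_inv x \<odot> y)) = (\<lambda>x. f (heis_inv (heis_inv y \<odot> x)))" by (simp add: heis_inv_mult)
  show ?thesis unfolding eq
    using integral_heis_left[of "\<lambda>x. f (heis_inv x)" "heis_inv y"] integral_heis_inv[of f] by simp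
qed

text \<open>Cuts off both the support and the values at level \<open>n\<close>; the squared error is
  dominated by \<open>(f x)\<^sup>2\<close> and tends to 0 pointwise.\<close>

lemma square_integrable_truncation:
  fixes f :: "'a::euclidean_space \<Rightarrow> real"
  assumes [measurable]: "f \<in> borel_measurable borel" and f2: "integrable lborel (\<lambda>x. (f x)\<^sup>2)" and "\<delta> > 0"
  obtains u R M where "u \<in> borel_measurable borel" "\<And>x. norm x > R \<Longrightarrow> u x = 0" "\<And>x. \<bar>u x\<bar> \<le> M" "R \<ge> 0" "M \<ge> 0"
    "integrable lborel (\<lambda>x. (f x - u x)\<^sup>2)" "(LINT x|lborel. (f x - u x)\<^sup>2) < \<delta>"
proof -
  define u where "u n x = (if norm x \<le> real n \<and> \<bar>f x\<bar> \<le> real n then f x else 0)" for n x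
  have [measurable]: "u n \<in> borel_measurable borel" for n
    unfolding u_def[abs_def] by measurable
  have lim: "(\<lambda>n. (f x - u n x)\<^sup>2) \<longlonglongrightarrow> 0" for x
  proof -
    obtain N where N: "norm x \<le> real N" "\<bar>f x\<bar> \<le> real N"
      using real_arch_simple[of "max (norm x) \<bar>f x\<bar>"] by auto
    then have "u n x = f x" if "n \<ge> N" for n using that by (auto simp: u_def)
    then have "eventually (\<lambda>n. (f x - u n x)\<^sup>2 = 0) sequentially"
      by (intro eventually_sequentiallyI[of N]) simp
    then show ?thesis by (rule tendsto_eventually)
  qed
  have bnd: "norm ((f x - u n x)\<^sup>2) \<le> (f x)\<^sup>2" for n x by (auto simp: u_def)
  have "(\<lambda>n. LINT x|lborel. (f x - u n x)\<^sup>2) \<longlonglongrightarrow> (LINT x|(lborel::'a measure). (0::real))"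
    by (rule integral_dominated_convergence[OF _ _ f2]) (use lim bnd in auto)
  then have "eventually (\<lambda>n. (LINT x|lborel. (f x - u n x)\<^sup>2) < \<delta>) sequentially"
    by (rule order_tendstoD(2)) (use \<open>\<delta> > 0\<close> in simp)
  then obtain n where n: "(LINT x|lborel. (f x - u n x)\<^sup>2) < \<delta>"
    by (auto simp: eventually_sequentially)
  have "integrable lborel (\<lambda>x. (f x - u n x)\<^sup>2)"
    by (rule Bochner_Integration.integrable_bound[OF f2]) (use bnd in auto)
  then show ?thesis
    using n by (intro that[of "u n" "real n" "real n"]) (auto simp: u_def)
qed

text \<open>A bounded function \<open>u\<close> of bounded support is an almost everywhere limit of
  continuous functions. Clamping these to \<open>[- M, M]\<close> and multiplying by a continuous
  cutoff leaves the limit \<open>u\<close> unchanged and supplies a majorant. The two errors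
  \<open>\<delta> / 4\<close> add up to \<open>\<delta>\<close> through
  \<open>(x + y)\<^sup>2 \<le> 2 * x\<^sup>2 + 2 * y\<^sup>2\<close>.\<close>

lemma square_integrable_approx_continuous:
  fixes f :: "'a::euclidean_space \<Rightarrow> real"
  assumes f [measurable]: "f \<in> borel_measurable borel" and f2: "integrable lborel (\<lambda>x. (f x)\<^sup>2)" and "\<delta> > 0"
  obtains g R where "continuous_on UNIV g" "\<And>x. norm x \<ge> R \<Longrightarrow> g x = 0"
    "integrable lborel (\<lambda>x. (f x - g x)\<^sup>2)" "(LINT x|lborel. (f x - g x)\<^sup>2) < \<delta>"
proof -
  obtain u R M where u [measurable]: "u \<in> borel_measurable borel" and u0: "\<And>x. norm x > R \<Longrightarrow> u x = 0"
    and uM: "\<And>x. \<bar>u x\<bar> \<le> M" and RM: "R \<ge> 0" "M \<ge> 0"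
    and fu: "integrable lborel (\<lambda>x. (f x - u x)\<^sup>2)" "(LINT x|lborel. (f x - u x)\<^sup>2) < \<delta> / 4"
    using square_integrable_truncation[OF f f2, of "\<delta> / 4"] \<open>\<delta> > 0\<close> by auto
  have "u measurable_on UNIV"
    by (rule lebesgue_measurable_imp_measurable_on_real) (auto intro: measurable_completion)
  then obtain N v where N: "negligible N" and v: "\<And>n. continuous_on UNIV (v n)"
    and lim: "\<And>x. x \<notin> N \<Longrightarrow> (\<lambda>n. v n x) \<longlonglongrightarrow> u x"
    unfolding measurable_on_def by auto
  define cutoff where "cutoff x = max 0 (min 1 (R + 1 - norm x))" for x :: 'a
  define g where "g n x = max (- M) (min M (v n x)) * cutoff x" for n x
  have cg: "continuous_on UNIV (g n)" for n
    unfolding g_def cutoff_def by (intro continuous_intros v)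
  have [measurable]: "g n \<in> borel_measurable borel" for n
    by (rule borel_measurable_continuous_onI[OF cg])
  have cutoff: "0 \<le> cutoff x" "cutoff x \<le> 1" for x by (auto simp: cutoff_def)
  have g0: "g n x = 0" if "norm x \<ge> R + 1" for n x
    using that by (simp add: g_def cutoff_def)
  have gM: "\<bar>g n x\<bar> \<le> M" for n x
  proof -
    have "\<bar>max (- M) (min M (v n x))\<bar> \<le> M" using RM by auto
    then have "\<bar>max (- M) (min M (v n x))\<bar> * \<bar>cutoff x\<bar> \<le> M * 1"
      using cutoff[of x] RM by (intro mult_mono) auto
    then show ?thesis by (simp add: g_def abs_mult)
  qed
  have uc: "max (- M) (min M (u x)) * cutoff x = u x" for x
  proof (cases "norm x \<le> R")
    case True
    then have "cutoff x = 1" by (simp add: cutoff_def)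
    then show ?thesis using uM[of x] by (auto simp: abs_le_iff)
  next
    case False
    then have "u x = 0" using u0 by simp
    then show ?thesis using RM by (simp add: max_def min_def)
  qed
  have lim2: "(\<lambda>n. (u x - g n x)\<^sup>2) \<longlonglongrightarrow> 0" if "x \<notin> N" for x
  proof -
    have "(\<lambda>n. (u x - g n x)\<^sup>2) \<longlonglongrightarrow> (u x - max (- M) (min M (u x)) * cutoff x)\<^sup>2"
      unfolding g_def by (intro tendsto_intros lim that)
    then show ?thesis by (simp add: uc)
  qed
  have "AE x in lebesgue. x \<notin> N"
    using N by (intro AE_not_in) (simp add: negligible_iff_null_sets)
  then have "AE x in lborel. x \<notin> N" by (simp add: AE_completion_iff)
  then have AElim: "AE x in lborel. (\<lambda>n. (u x - g n x)\<^sup>2) \<longlonglongrightarrow> 0"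
    by eventually_elim (rule lim2)
  have bnd: "norm ((u x - g n x)\<^sup>2) \<le> (2 * M)\<^sup>2 * indicator (cball 0 (R + 1)) x" for n x
  proof (cases "norm x \<le> R + 1")
    case True
    have "\<bar>u x - g n x\<bar> \<le> 2 * M" using uM[of x] gM[of n x] by linarith
    then have "\<bar>u x - g n x\<bar>\<^sup>2 \<le> (2 * M)\<^sup>2" by (intro power_mono) auto
    then show ?thesis using True by simp
  next
    case False
    then have "u x = 0" "g n x = 0" using u0 g0 RM by auto
    then show ?thesis by simp
  qed
  have iw: "integrable lborel (\<lambda>x. (2 * M)\<^sup>2 * indicator (cball 0 (R + 1)) x :: real)"
    by (intro integrable_mult_right integrable_real_indicator) (use emeasure_bounded_finite[OF bounded_cball] in auto)
  have "(\<lambda>n. LINT x|lborel. (u x - g n x)\<^sup>2) \<longlonglongrightarrow> (LINT x|(lborel::'a measure). (0::real))"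
    by (rule integral_dominated_convergence[OF _ _ iw]) (use AElim bnd in auto)
  then have "eventually (\<lambda>n. (LINT x|lborel. (u x - g n x)\<^sup>2) < \<delta> / 4) sequentially"
    by (rule order_tendstoD(2)) (use \<open>\<delta> > 0\<close> in simp)
  then obtain n where n: "(LINT x|lborel. (u x - g n x)\<^sup>2) < \<delta> / 4"
    by (auto simp: eventually_sequentially)
  have ug: "integrable lborel (\<lambda>x. (u x - g n x)\<^sup>2)"
    by (rule Bochner_Integration.integrable_bound[OF iw]) (use bnd in auto)
  have le: "(f x - g n x)\<^sup>2 \<le> 2 * (f x - u x)\<^sup>2 + 2 * (u x - g n x)\<^sup>2" for x
    using zero_le_power2[of "(f x - u x) - (u x - g n x)"] by (simp add: power2_eq_square algebra_simps)
  have i2: "integrable lborel (\<lambda>x. 2 * (f x - u x)\<^sup>2 + 2 * (u x - g n x)\<^sup>2)" using fu ug by simp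
  have fg: "integrable lborel (\<lambda>x. (f x - g n x)\<^sup>2)"
    by (rule Bochner_Integration.integrable_bound[OF i2]) (use le in auto)
  have "(LINT x|lborel. (f x - g n x)\<^sup>2) \<le> (LINT x|lborel. 2 * (f x - u x)\<^sup>2 + 2 * (u x - g n x)\<^sup>2)"
    by (rule integral_mono[OF fg i2 le])
  also have "\<dots> < \<delta>" using fu ug n by simp
  finally show ?thesis using that[of "g n" "R + 1"] cg g0 fg by blast
qed
section \<open>Time derivatives and convolution identities\<close>

text \<open>Differentiates a scaling identity in time by uniqueness of derivatives. With
  \<open>b = r\<^sup>2\<close> each time derivative raises the degree of homogeneity by 2, from 4
  for \<open>h\<close> to 6 and 8.\<close>

lemma DERIV_scaled:
  assumes "\<And>s. s > 0 \<Longrightarrow> ((\<lambda>s. u s) has_real_derivative u' s) (at s)" "\<And>s. s > 0 \<Longrightarrow> ((\<lambda>s. w s) has_real_derivative w' s) (at s)"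
    and "\<And>s. s > 0 \<Longrightarrow> c * u (b * s) = w s" and "b > 0" "t > 0"
  shows "c * b * u' (b * t) = w' t"
proof -
  have "((\<lambda>s. u (b * s)) has_real_derivative u' (b * t) * b) (at t)"
    by (rule DERIV_chain2[OF assms(1)]) (use assms(4,5) in \<open>auto intro!: derivative_eq_intros\<close>)
  then have "((\<lambda>s. c * u (b * s)) has_real_derivative c * (u' (b * t) * b)) (at t)"
    by (rule DERIV_cmult)
  then have "(w has_real_derivative c * (u' (b * t) * b)) (at t)"
    by (rule has_field_derivative_transform_within_open[of _ _ _ "{0<..}"]) (use assms in auto)
  then show ?thesis using DERIV_unique[OF assms(2)[OF \<open>t > 0\<close>]] by (simp add: ac_simps)
qed

lemma difference_quotient_LIMSEQ:
  assumes "(u has_real_derivative u') (at s)"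
  shows "(\<lambda>n. (u (s + 1 / real (Suc n)) - u s) * real (Suc n)) \<longlonglongrightarrow> u'"
proof -
  have "((\<lambda>r. (u (s + r) - u s) / r) \<longlongrightarrow> u') (at 0)"
    using assms by (simp add: DERIV_def)
  moreover have "filterlim (\<lambda>n. 1 / real (Suc n)) (at 0) sequentially"
    unfolding filterlim_at using LIMSEQ_inverse_real_of_nat by (auto simp: inverse_eq_divide)
  ultimately have "(\<lambda>n. (u (s + 1 / real (Suc n)) - u s) / (1 / real (Suc n))) \<longlonglongrightarrow> u'"
    by (rule filterlim_compose)
  then show ?thesis by simp
qed

context heis_heat
begin

definition h_t :: "heis \<times> real \<Rightarrow> real" where "h_t = dir_deriv (0, 1) h"
definition h_tt :: "heis \<times> real \<Rightarrow> real" where "h_tt = dir_deriv (0, 1) h_t"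

lemma smooth_h_t: "smooth_on h_t (UNIV \<times> {0<..})" and smooth_h_tt: "smooth_on h_tt (UNIV \<times> {0<..})"
proof -
  have b: "(0, 1) \<in> (Basis :: (heis \<times> real) set)" by (simp add: Basis_prod_def)
  show 1: "smooth_on h_t (UNIV \<times> {0<..})" unfolding h_t_def by (rule smooth_on_dir_deriv_Basis[OF smooth_h b])
  show "smooth_on h_tt (UNIV \<times> {0<..})" unfolding h_tt_def by (rule smooth_on_dir_deriv_Basis[OF 1 b])
qed

lemma DERIV_h: "s > 0 \<Longrightarrow> ((\<lambda>s. h (x, s)) has_real_derivative h_t (x, s)) (at s)"
  unfolding h_t_def by (rule has_derivative_time[OF smooth_h])

lemma DERIV_h_t: "s > 0 \<Longrightarrow> ((\<lambda>s. h_t (x, s)) has_real_derivative h_tt (x, s)) (at s)"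
  unfolding h_tt_def by (rule has_derivative_time[OF smooth_h_t])

lemma homogeneous_h_t: "t > 0 \<Longrightarrow> r > 0 \<Longrightarrow> r ^ 6 * h_t (dilate r x, r\<^sup>2 * t) = h_t (x, t)"
  using DERIV_scaled[of "\<lambda>s. h (dilate r x, s)" "\<lambda>s. h_t (dilate r x, s)" "\<lambda>s. h (x, s)" "\<lambda>s. h_t (x, s)" "r ^ 4" "r\<^sup>2" t]
    DERIV_h homogeneous by (simp add: power_add[symmetric])

lemma homogeneous_h_tt: "t > 0 \<Longrightarrow> r > 0 \<Longrightarrow> r ^ 8 * h_tt (dilate r x, r\<^sup>2 * t) = h_tt (x, t)"
  using DERIV_scaled[of "\<lambda>s. h_t (dilate r x, s)" "\<lambda>s. h_tt (dilate r x, s)" "\<lambda>s. h_t (x, s)" "\<lambda>s. h_tt (x, s)" "r ^ 6" "r\<^sup>2" t]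
    DERIV_h_t homogeneous_h_t by (simp add: power_add[symmetric])

lemma \<phi>_eq: "\<phi> x = - h_t (x, 1)"
  using heat_eq[of 1 x] DERIV_imp_deriv[OF DERIV_h[of 1 x]] by (simp add: \<phi>_def K_def[abs_def])

lemma continuous_on_\<phi>: "continuous_on UNIV \<phi>"
  by (rule smooth_on_continuous[OF eucl_gauss.tame_smooth[OF eucl_gauss_tame_\<phi>]])

lemma measurable_\<phi> [measurable]: "\<phi> \<in> borel_measurable borel"
  by (rule borel_measurable_continuous_onI[OF continuous_on_\<phi>])

lemma measurable_K [measurable]: "K \<in> borel_measurable borel"
  by (rule borel_measurable_continuous_onI[OF smooth_on_continuous[OF smooth_K]])

lemma gauss_\<phi>: "gauss \<phi>"
  using gauss_iter_deriv_\<phi>[of "[]"] by (simp add: iter_deriv_def)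

lemma integrable_\<phi>: "integrable lborel \<phi>"
  by (rule integrable_gauss[OF gauss_\<phi> measurable_\<phi>])

lemma \<phi>_bounded: obtains B where "B > 0" "\<And>x. \<bar>\<phi> x\<bar> \<le> B"
proof -
  obtain C c where C: "C > 0" "c > 0" "\<And>x. \<bar>\<phi> x\<bar> \<le> C * exp (- c * hnorm x)"
    using gauss_\<phi> unfolding gauss_def by blast
  have "\<bar>\<phi> x\<bar> \<le> C * 1" for x
    by (rule order_trans[OF C(3)], rule mult_left_mono) (use C in auto)
  then have "\<bar>\<phi> x\<bar> \<le> C" for x by simp
  then show ?thesis using that C(1) by blast
qed

lemma integrable_\<phi>_sq: "integrable lborel (\<lambda>x. (\<phi> x)\<^sup>2)"
proof -
  obtain B where B: "B > 0" "\<And>x. \<bar>\<phi> x\<bar> \<le> B" using \<phi>_bounded by blast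
  show ?thesis
  proof (rule Bochner_Integration.integrable_bound[OF integrable_mult_right[OF integrable_\<phi>, of B]])
    show "AE x in lborel. norm ((\<phi> x)\<^sup>2) \<le> norm (B * \<phi> x)"
    proof (intro always_eventually allI)
      fix x
      show "norm ((\<phi> x)\<^sup>2) \<le> norm (B * \<phi> x)"
        using mult_right_mono[OF B(2)[of x], of "\<bar>\<phi> x\<bar>"] B(1) by (simp add: power2_eq_square abs_mult)
    qed
  qed simp
qed

text \<open>Forward difference quotients in time at 1, along a sequence of steps as dominated
  convergence needs. The steps are at most 1, which keeps the times between 1 and 2.\<close>

definition dq :: "nat \<Rightarrow> heis \<Rightarrow> real" where
  "dq n x = (h (x, 1 + 1 / real (Suc n)) - h (x, 1)) * real (Suc n)"

lemma dq_LIMSEQ: "(\<lambda>n. dq n x) \<longlonglongrightarrow> - \<phi> x"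
  unfolding dq_def \<phi>_eq using difference_quotient_LIMSEQ[OF DERIV_h[of 1 x]] by simp

lemma measurable_dq [measurable]: "dq n \<in> borel_measurable borel"
  unfolding dq_def[abs_def] using measurable_h_slice[of "1 + 1 / real (Suc n)"] measurable_h_slice[of 1]
  by (intro borel_measurable_times borel_measurable_diff) (auto simp: add_pos_pos)

lemma h_t_scale: "s > 0 \<Longrightarrow> h_t (x, s) = - \<phi> (dilate (1 / sqrt s) x) / s ^ 3"
proof -
  assume s: "s > 0"
  have "(1 / sqrt s) ^ 6 = ((1 / sqrt s)\<^sup>2) ^ 3" by (simp add: power_mult[symmetric])
  also have "\<dots> = 1 / s ^ 3" using s by (simp add: power_divide)
  finally have "(1 / sqrt s) ^ 6 = 1 / s ^ 3" .
  then show ?thesis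
    using homogeneous_h_t[of s "1 / sqrt s" x] s by (simp add: \<phi>_eq power_divide)
qed

text \<open>By the mean value theorem the quotient equals \<open>h_t\<close> at some time
  \<open>z\<close> between 1 and 2, a dilate of \<open>\<phi>\<close> by \<open>1 / sqrt z\<close>.
  At most half of the decay rate is lost, uniformly in \<open>n\<close>.\<close>

lemma dq_bound:
  obtains C c where "C > 0" "c > 0" "\<And>n x. \<bar>dq n x\<bar> \<le> C * exp (- c * hnorm x)"
proof -
  obtain C c where C: "C > 0" "c > 0" "\<And>x. \<bar>\<phi> x\<bar> \<le> C * exp (- c * hnorm x)"
    using gauss_\<phi> unfolding gauss_def by blast
  have "\<bar>dq n x\<bar> \<le> C * exp (- (c / 2) * hnorm x)" for n x
  proof -
    define r where "r = 1 / real (Suc n)"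
    have r: "0 < r" "r \<le> 1" by (auto simp: r_def)
    have "\<exists>z. 1 < z \<and> z < 1 + r \<and> h (x, 1 + r) - h (x, 1) = (1 + r - 1) * h_t (x, z)"
      by (rule MVT2) (use r DERIV_h in auto)
    then obtain z where z: "1 < z" "z < 1 + r" "h (x, 1 + r) - h (x, 1) = r * h_t (x, z)" by auto
    have "dq n x = h_t (x, z)"
      using z(3) r by (simp add: dq_def r_def)
    also have "\<bar>h_t (x, z)\<bar> = \<bar>\<phi> (dilate (1 / sqrt z) x)\<bar> / z ^ 3"
      using z by (simp add: h_t_scale)
    also have "\<dots> \<le> \<bar>\<phi> (dilate (1 / sqrt z) x)\<bar> / 1"
      using z by (intro divide_left_mono one_le_power) auto
    also have "\<dots> \<le> C * exp (- c * (1 / z * hnorm x))"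
      using C(3)[of "dilate (1 / sqrt z) x"] z by (simp add: hnorm_dilate power_divide)
    also have "\<dots> \<le> C * exp (- (c / 2) * hnorm x)"
    proof -
      have "1 / 2 * hnorm x \<le> 1 / z * hnorm x" using z r by (intro mult_right_mono) (auto simp: field_simps)
      then have "c * (1 / 2 * hnorm x) \<le> c * (1 / z * hnorm x)" using C(2) by (intro mult_left_mono) auto
      then show ?thesis using C(1) by simp
    qed
    finally show ?thesis .
  qed
  then show ?thesis using that[of C "c / 2"] C by auto
qed

text \<open>Conservation of mass, differentiated in time.\<close>

lemma integral_\<phi>: "(LINT x|lborel. \<phi> x) = 0"
proof -
  obtain C c where C: "C > 0" "c > 0" "\<And>n x. \<bar>dq n x\<bar> \<le> C * exp (- c * hnorm x)" using dq_bound by blast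
  have "(\<lambda>n. LINT x|lborel. dq n x) \<longlonglongrightarrow> (LINT x|lborel. - \<phi> x)"
    by (rule integral_dominated_convergence[OF _ _ integrable_mult_right[OF integrable_exp_hnorm[OF C(2)], of C]])
      (use C dq_LIMSEQ in auto)
  moreover have "(LINT x|lborel. dq n x) = 0" for n
    unfolding dq_def using integrable_h[of "1 + 1 / real (Suc n)"] integrable_h[of 1]
      integral_h[of "1 + 1 / real (Suc n)"] integral_h[of 1] by (simp add: add_pos_pos)
  ultimately show ?thesis by (simp add: LIMSEQ_const_iff)
qed

text \<open>One factor carries the Gaussian majorant and the other is only bounded. It is used with
  the kernel itself and with \<open>\<phi>\<close> as the second factor.\<close>

lemma dominated_kernel:
  assumes [measurable]: "w \<in> borel_measurable borel" and B: "\<And>x. \<bar>w x\<bar> \<le> B" and "B \<ge> 0"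
  shows "integrable lborel (\<lambda>\<xi>. \<phi> (heis_inv \<xi> \<odot> a) * w (heis_inv \<xi> \<odot> b))"
    "(\<lambda>n. LINT \<xi>|lborel. dq n (heis_inv \<xi> \<odot> a) * w (heis_inv \<xi> \<odot> b))
       \<longlonglongrightarrow> - (LINT \<xi>|lborel. \<phi> (heis_inv \<xi> \<odot> a) * w (heis_inv \<xi> \<odot> b))"
proof -
  obtain C c where C: "C > 0" "c > 0" "\<And>n x. \<bar>dq n x\<bar> \<le> C * exp (- c * hnorm x)" using dq_bound by blast
  have i1: "integrable lborel (\<lambda>\<xi>. exp (- c * hnorm (heis_inv \<xi> \<odot> a)))"
    by (rule integrable_heis_inv_mult[OF _ integrable_exp_hnorm[OF C(2)]]) measurable
  have iw: "integrable lborel (\<lambda>\<xi>. (C * B) * exp (- c * hnorm (heis_inv \<xi> \<odot> a)))"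
    by (rule integrable_mult_right[OF i1])
  have bnd: "norm (dq n (heis_inv \<xi> \<odot> a) * w (heis_inv \<xi> \<odot> b)) \<le> (C * B) * exp (- c * hnorm (heis_inv \<xi> \<odot> a))" for n \<xi>
  proof -
    have "\<bar>dq n (heis_inv \<xi> \<odot> a)\<bar> * \<bar>w (heis_inv \<xi> \<odot> b)\<bar> \<le> (C * exp (- c * hnorm (heis_inv \<xi> \<odot> a))) * B"
      using C(1) by (intro mult_mono C B) auto
    then show ?thesis by (simp add: abs_mult ac_simps)
  qed
  have "(\<lambda>n. LINT \<xi>|lborel. dq n (heis_inv \<xi> \<odot> a) * w (heis_inv \<xi> \<odot> b))
       \<longlonglongrightarrow> (LINT \<xi>|lborel. - \<phi> (heis_inv \<xi> \<odot> a) * w (heis_inv \<xi> \<odot> b))"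
  proof (rule integral_dominated_convergence[OF _ _ iw])
    show "AE x in lborel. (\<lambda>n. dq n (heis_inv x \<odot> a) * w (heis_inv x \<odot> b)) \<longlonglongrightarrow> - \<phi> (heis_inv x \<odot> a) * w (heis_inv x \<odot> b)"
      by (intro always_eventually allI tendsto_mult_right dq_LIMSEQ)
  qed (use bnd in auto)
  then show "(\<lambda>n. LINT \<xi>|lborel. dq n (heis_inv \<xi> \<odot> a) * w (heis_inv \<xi> \<odot> b))
       \<longlonglongrightarrow> - (LINT \<xi>|lborel. \<phi> (heis_inv \<xi> \<odot> a) * w (heis_inv \<xi> \<odot> b))" by simp
  have i2: "integrable lborel (\<lambda>\<xi>. B * \<phi> (heis_inv \<xi> \<odot> a))"
    by (intro integrable_mult_right integrable_heis_inv_mult integrable_\<phi> measurable_\<phi>)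
  show "integrable lborel (\<lambda>\<xi>. \<phi> (heis_inv \<xi> \<odot> a) * w (heis_inv \<xi> \<odot> b))"
  proof (rule Bochner_Integration.integrable_bound[OF i2])
    show "AE x in lborel. norm (\<phi> (heis_inv x \<odot> a) * w (heis_inv x \<odot> b)) \<le> norm (B * \<phi> (heis_inv x \<odot> a))"
    proof (intro always_eventually allI)
      fix x
      show "norm (\<phi> (heis_inv x \<odot> a) * w (heis_inv x \<odot> b)) \<le> norm (B * \<phi> (heis_inv x \<odot> a))"
        using mult_left_mono[OF B[of "heis_inv x \<odot> b"], of "\<bar>\<phi> (heis_inv x \<odot> a)\<bar>"] \<open>B \<ge> 0\<close>
        by (simp add: abs_mult mult.commute)
    qed
  qed simp
qed

lemma h_bounded:
  assumes "t > 0"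
  obtains B where "B \<ge> 0" "\<And>x. \<bar>h (x, t)\<bar> \<le> B"
proof -
  obtain B where B: "B > 0" "\<And>x. K x \<le> B" using K_bounded by blast
  have "\<bar>h (x, t)\<bar> \<le> (1 / sqrt t) ^ 4 * B" for x
  proof -
    have "h (x, t) = (1 / sqrt t) ^ 4 * K (dilate (1 / sqrt t) x)"
      using homogeneous[of t "1 / sqrt t" x] assms by (simp add: K_def power_divide)
    moreover have "\<dots> \<le> (1 / sqrt t) ^ 4 * B" using assms by (intro mult_left_mono B) auto
    ultimately show ?thesis using h_nonneg[OF assms, of x] by linarith
  qed
  then show ?thesis using that[of "(1 / sqrt t) ^ 4 * B"] B assms by auto
qed

text \<open>The semigroup law in Gram form, differentiated in the time of the first factor at
  1.\<close>

lemma integral_\<phi>_h: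
  assumes t: "t > 0"
  shows "(LINT \<xi>|lborel. \<phi> (heis_inv \<xi> \<odot> a) * h (heis_inv \<xi> \<odot> b, t)) = - h_t (heis_inv a \<odot> b, 1 + t)"
    "integrable lborel (\<lambda>\<xi>. \<phi> (heis_inv \<xi> \<odot> a) * h (heis_inv \<xi> \<odot> b, t))"
proof -
  obtain B where B: "B \<ge> 0" "\<And>x. \<bar>h (x, t)\<bar> \<le> B" using h_bounded[OF t] by blast
  note d = dominated_kernel[OF measurable_h_slice[OF t] B(2,1), of a b]
  show "integrable lborel (\<lambda>\<xi>. \<phi> (heis_inv \<xi> \<odot> a) * h (heis_inv \<xi> \<odot> b, t))" by (rule d(1))
  have "(LINT \<xi>|lborel. dq n (heis_inv \<xi> \<odot> a) * h (heis_inv \<xi> \<odot> b, t))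
     = (h (heis_inv a \<odot> b, (1 + t) + 1 / real (Suc n)) - h (heis_inv a \<odot> b, 1 + t)) * real (Suc n)" for n
  proof -
    have "has_bochner_integral lborel (\<lambda>\<xi>. (h (heis_inv \<xi> \<odot> a, 1 + 1 / real (Suc n)) * h (heis_inv \<xi> \<odot> b, t)
        - h (heis_inv \<xi> \<odot> a, 1) * h (heis_inv \<xi> \<odot> b, t)) * real (Suc n))
      ((h (heis_inv a \<odot> b, (1 + 1 / real (Suc n)) + t) - h (heis_inv a \<odot> b, 1 + t)) * real (Suc n))"
      by (intro has_bochner_integral_mult_left has_bochner_integral_diff conv_kernel t) (auto simp: add_pos_pos)
    then have "(LINT \<xi>|lborel. (h (heis_inv \<xi> \<odot> a, 1 + 1 / real (Suc n)) * h (heis_inv \<xi> \<odot> b, t)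
        - h (heis_inv \<xi> \<odot> a, 1) * h (heis_inv \<xi> \<odot> b, t)) * real (Suc n)) =
      ((h (heis_inv a \<odot> b, (1 + 1 / real (Suc n)) + t) - h (heis_inv a \<odot> b, 1 + t)) * real (Suc n))"
      by (rule has_bochner_integral_integral_eq)
    moreover have "dq n (heis_inv \<xi> \<odot> a) * h (heis_inv \<xi> \<odot> b, t) = (h (heis_inv \<xi> \<odot> a, 1 + 1 / real (Suc n)) * h (heis_inv \<xi> \<odot> b, t)
        - h (heis_inv \<xi> \<odot> a, 1) * h (heis_inv \<xi> \<odot> b, t)) * real (Suc n)" for \<xi>
      by (simp add: dq_def algebra_simps)
    moreover have "1 + t + 1 / real (Suc n) = 1 + 1 / real (Suc n) + t" by simp
    ultimately show ?thesis by (simp only:)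
  qed
  moreover have "(\<lambda>n. (h (heis_inv a \<odot> b, (1 + t) + 1 / real (Suc n)) - h (heis_inv a \<odot> b, 1 + t)) * real (Suc n)) \<longlonglongrightarrow> h_t (heis_inv a \<odot> b, 1 + t)"
    using t by (intro difference_quotient_LIMSEQ DERIV_h) simp
  ultimately show "(LINT \<xi>|lborel. \<phi> (heis_inv \<xi> \<odot> a) * h (heis_inv \<xi> \<odot> b, t)) = - h_t (heis_inv a \<odot> b, 1 + t)"
    using d(2) LIMSEQ_unique by fastforce
qed

text \<open>Differentiates the preceding identity in the time of the second factor at 1, so the
  quotients now sit at \<open>b\<close> and the roles of \<open>a\<close> and \<open>b\<close> in
  \<open>dominated_kernel\<close> are exchanged. The two minus signs cancel.\<close>

lemma integral_\<phi>_\<phi>: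
  "integrable lborel (\<lambda>\<xi>. \<phi> (heis_inv \<xi> \<odot> a) * \<phi> (heis_inv \<xi> \<odot> b))"
  "(LINT \<xi>|lborel. \<phi> (heis_inv \<xi> \<odot> a) * \<phi> (heis_inv \<xi> \<odot> b)) = h_tt (heis_inv a \<odot> b, 2)"
proof -
  obtain B where B: "B > 0" "\<And>x. \<bar>\<phi> x\<bar> \<le> B" using \<phi>_bounded by blast
  note d = dominated_kernel[OF measurable_\<phi> B(2) less_imp_le[OF B(1)]]
  show "integrable lborel (\<lambda>\<xi>. \<phi> (heis_inv \<xi> \<odot> a) * \<phi> (heis_inv \<xi> \<odot> b))" by (rule d(1))
  have "(LINT \<xi>|lborel. dq n (heis_inv \<xi> \<odot> b) * \<phi> (heis_inv \<xi> \<odot> a))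
     = - ((h_t (heis_inv a \<odot> b, 2 + 1 / real (Suc n)) - h_t (heis_inv a \<odot> b, 2)) * real (Suc n))" for n
  proof -
    define r where "r = 1 / real (Suc n)"
    have r: "1 + r > 0" by (simp add: r_def add_pos_pos)
    have "(LINT \<xi>|lborel. dq n (heis_inv \<xi> \<odot> b) * \<phi> (heis_inv \<xi> \<odot> a))
      = (LINT \<xi>|lborel. (\<phi> (heis_inv \<xi> \<odot> a) * h (heis_inv \<xi> \<odot> b, 1 + r) - \<phi> (heis_inv \<xi> \<odot> a) * h (heis_inv \<xi> \<odot> b, 1)) * real (Suc n))"
      by (simp add: dq_def r_def algebra_simps)
    also have "\<dots> = (- h_t (heis_inv a \<odot> b, 1 + (1 + r)) - - h_t (heis_inv a \<odot> b, 1 + 1)) * real (Suc n)"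
      using integral_\<phi>_h[OF r, of a b] integral_\<phi>_h[of 1 a b] by simp
    also have "\<dots> = - ((h_t (heis_inv a \<odot> b, 2 + r) - h_t (heis_inv a \<odot> b, 2)) * real (Suc n))"
      by (simp add: algebra_simps)
    finally show ?thesis by (simp add: r_def)
  qed
  moreover have "(\<lambda>n. - ((h_t (heis_inv a \<odot> b, 2 + 1 / real (Suc n)) - h_t (heis_inv a \<odot> b, 2)) * real (Suc n))) \<longlonglongrightarrow> - h_tt (heis_inv a \<odot> b, 2)"
    by (intro tendsto_minus difference_quotient_LIMSEQ DERIV_h_t) simp
  ultimately have "- h_tt (heis_inv a \<odot> b, 2) = - (LINT \<xi>|lborel. \<phi> (heis_inv \<xi> \<odot> b) * \<phi> (heis_inv \<xi> \<odot> a))"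
    using d(2)[of b a] LIMSEQ_unique by fastforce
  then show "(LINT \<xi>|lborel. \<phi> (heis_inv \<xi> \<odot> a) * \<phi> (heis_inv \<xi> \<odot> b)) = h_tt (heis_inv a \<odot> b, 2)"
    by (simp add: mult.commute)
qed

end
section \<open>The Calderon formula for continuous functions\<close>

lemma lborel_integral_eq_integral_cbox:
  fixes F :: "'a::euclidean_space \<Rightarrow> real"
  assumes "integrable lborel F" "\<And>z. z \<notin> cbox a b \<Longrightarrow> F z = 0"
  shows "(LINT z|lborel. F z) = integral (cbox a b) F"
proof -
  have "(\<lambda>x. if x \<in> cbox a b then F x else 0) = F" using assms(2) by auto
  then show ?thesis
    using integral_lborel[OF assms(1)] integral_restrict_UNIV[of "cbox a b" F] by simp
qed

lemma integrable_lborel_product: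
  fixes f g :: "'a::euclidean_space \<Rightarrow> real"
  assumes "continuous_on UNIV f" "\<And>x. norm x \<ge> R \<Longrightarrow> f x = 0"
    and "continuous_on UNIV g"
  shows "integrable lborel (\<lambda>x. f x * g x)"
  by (rule integrable_continuous_compact_support[of _ R]) (use assms in \<open>auto intro!: continuous_intros\<close>)

lemma dilate_inv_mult: "dilate a (heis_inv x \<odot> y) = heis_inv (dilate a x) \<odot> dilate a y"
  by (simp add: dilate_mult dilate_inv)

context heis_heat
begin

definition V :: "(heis \<Rightarrow> real) \<Rightarrow> heis \<Rightarrow> real \<Rightarrow> real" where
  "V f \<omega> a = (LINT \<upsilon>|lborel. f \<upsilon> * (\<phi> (dilate (1 / a) (heis_inv \<omega> \<odot> \<upsilon>)) / a\<^sup>2))"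

lemma continuous_on_\<phi>_comp: "continuous_on S u \<Longrightarrow> continuous_on S (\<lambda>x. \<phi> (u x))"
  using continuous_on_compose2[OF continuous_on_\<phi>] by auto

text \<open>The exponent 12 is 4 from the Jacobian of the dilation plus 8 from the homogeneity of
  \<open>h_tt\<close>. The last two claims supply the \<open>L\<^sup>1\<close> bound that Fubini
  needs later.\<close>

lemma kernel_products:
  assumes "a > 0"
  shows "integrable lborel (\<lambda>\<omega>. \<phi> (dilate (1 / a) (heis_inv \<omega> \<odot> x)) * \<phi> (dilate (1 / a) (heis_inv \<omega> \<odot> y)))" (is ?A)
    and "(LINT \<omega>|lborel. \<phi> (dilate (1 / a) (heis_inv \<omega> \<odot> x)) * \<phi> (dilate (1 / a) (heis_inv \<omega> \<odot> y))) = a ^ 12 * h_tt (heis_inv x \<odot> y, 2 * a\<^sup>2)" (is ?B)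
    and "integrable lborel (\<lambda>\<omega>. \<phi> (dilate (1 / a) (heis_inv \<omega> \<odot> x)))" (is ?C)
    and "(LINT \<omega>|lborel. \<bar>\<phi> (dilate (1 / a) (heis_inv \<omega> \<odot> x))\<bar>) = a ^ 4 * (LINT \<omega>|lborel. \<bar>\<phi> \<omega>\<bar>)" (is ?D)
proof -
  define F where "F \<xi> = \<phi> (heis_inv \<xi> \<odot> dilate (1 / a) x) * \<phi> (heis_inv \<xi> \<odot> dilate (1 / a) y)" for \<xi>
  have [measurable]: "F \<in> borel_measurable borel" unfolding F_def[abs_def] by measurable
  have F: "F (dilate (1 / a) \<omega>) = \<phi> (dilate (1 / a) (heis_inv \<omega> \<odot> x)) * \<phi> (dilate (1 / a) (heis_inv \<omega> \<odot> y))" for \<omega>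
    by (simp add: F_def dilate_inv_mult)
  have a': "1 / a > 0" using assms by simp
  show ?A
    using integral_\<phi>_\<phi>(1)[of "dilate (1 / a) x" "dilate (1 / a) y"] integrable_dilate[of F "1 / a"] a'
    by (simp add: F F_def[symmetric])
  have "a ^ 8 * h_tt (heis_inv x \<odot> y, 2 * a\<^sup>2) = h_tt (dilate (1 / a) (heis_inv x \<odot> y), 2)"
    using homogeneous_h_tt[of 2 a "dilate (1 / a) (heis_inv x \<odot> y)"] assms
    by (simp add: dilate_dilate mult.commute)
  moreover have "a ^ 12 = a ^ 4 * a ^ 8" by (simp flip: power_add)
  ultimately have "a ^ 12 * h_tt (heis_inv x \<odot> y, 2 * a\<^sup>2) = a ^ 4 * h_tt (dilate (1 / a) (heis_inv x \<odot> y), 2)"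
    by (metis mult.assoc)
  moreover have "(LINT \<omega>|lborel. F (dilate (1 / a) \<omega>)) = a ^ 4 * (LINT \<omega>|lborel. F \<omega>)"
    using integral_dilate[of F "1 / a"] a' by (simp add: power_divide)
  moreover have "(LINT \<omega>|lborel. F \<omega>) = h_tt (dilate (1 / a) (heis_inv x \<odot> y), 2)"
    unfolding F_def dilate_inv_mult by (rule integral_\<phi>_\<phi>)
  ultimately show ?B by (simp only: F)
  define H where "H \<xi> = \<phi> (heis_inv \<xi> \<odot> dilate (1 / a) x)" for \<xi>
  have [measurable]: "H \<in> borel_measurable borel" unfolding H_def[abs_def] by measurable
  have H: "H (dilate (1 / a) \<omega>) = \<phi> (dilate (1 / a) (heis_inv \<omega> \<odot> x))" for \<omega>
    by (simp add: H_def dilate_inv_mult)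
  show ?C
    using integrable_heis_inv_mult[OF measurable_\<phi> integrable_\<phi>, of "dilate (1 / a) x"] integrable_dilate[of H "1 / a"] a'
    by (simp add: H H_def[symmetric])
  show ?D
    using integral_heis_inv_mult[of "\<lambda>x. \<bar>\<phi> x\<bar>" "dilate (1 / a) x"] integral_dilate[of "\<lambda>x. \<bar>H x\<bar>" "1 / a"] a' assms
    by (simp add: H H_def[symmetric] power_divide)
qed

text \<open>The primitive \<open>h_prim = u \<partial>\<^sub>u h - h\<close> of \<open>u \<partial>\<^sub>u \<partial>\<^sub>u h\<close> is, up to sign, the dilation of the function \<open>\<kappa>\<close> of mass one,
  hence an approximate identity as \<open>u \<longrightarrow> 0\<close>. This evaluates the Calderon integral.\<close>

definition \<kappa> :: "heis \<Rightarrow> real" where "\<kappa> x = \<phi> x + K x"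

definition h_prim :: "heis \<Rightarrow> real \<Rightarrow> real" where "h_prim x u = u * h_t (x, u) - h (x, u)"

lemma DERIV_h_prim: "u > 0 \<Longrightarrow> ((\<lambda>u. h_prim x u) has_real_derivative u * h_tt (x, u)) (at u)"
  unfolding h_prim_def by (auto intro!: derivative_eq_intros DERIV_h DERIV_h_t)

lemma h_prim_scale:
  assumes "u > 0"
  shows "h_prim x u = - \<kappa> (dilate (1 / sqrt u) x) / u\<^sup>2"
proof -
  have "(1 / sqrt u) ^ 4 = 1 / u\<^sup>2"
    using assms by (simp add: power_divide power4_eq_xxxx power2_eq_square)
  then have "h (x, u) = K (dilate (1 / sqrt u) x) / u\<^sup>2"
    using homogeneous[of u "1 / sqrt u" x] assms by (simp add: K_def power_divide)
  moreover have "u * h_t (x, u) = - \<phi> (dilate (1 / sqrt u) x) / u\<^sup>2"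
    using h_t_scale[OF assms, of x] assms by (simp add: power3_eq_cube power2_eq_square)
  ultimately show ?thesis by (simp add: h_prim_def \<kappa>_def add_divide_distrib diff_divide_distrib)
qed

lemma continuous_on_time_comp:
  assumes "g = h \<or> g = h_t \<or> g = h_tt" "continuous_on S u" "continuous_on S v" "\<And>x. x \<in> S \<Longrightarrow> v x > 0"
  shows "continuous_on S (\<lambda>x. g (u x, v x))"
proof -
  have "continuous_on (UNIV \<times> {0<..}) g"
    using assms(1) smooth_on_continuous smooth_h smooth_h_t smooth_h_tt by auto
  then show ?thesis
    by (rule continuous_on_compose2[of _ _ _ "\<lambda>x. (u x, v x)"]) (use assms in \<open>auto intro!: continuous_intros\<close>)
qed

lemma measurable_\<kappa> [measurable]: "\<kappa> \<in> borel_measurable borel"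
  unfolding \<kappa>_def[abs_def] by measurable

lemma integrable_\<kappa>: "integrable lborel \<kappa>" and integral_\<kappa>: "(LINT x|lborel. \<kappa> x) = 1"
  using integrable_\<phi> integral_\<phi> integrable_h[of 1] integral_h[of 1] unfolding \<kappa>_def[abs_def]
  by (simp_all add: K_def[abs_def])

lemma \<kappa>_bounded: obtains D where "D \<ge> 0" "\<And>x. \<bar>\<kappa> x\<bar> \<le> D"
proof -
  obtain B where B: "B > 0" "\<And>x. \<bar>\<phi> x\<bar> \<le> B" using \<phi>_bounded by blast
  obtain C where C: "C > 0" "\<And>x. K x \<le> C" using K_bounded by blast
  have "\<bar>\<kappa> x\<bar> \<le> B + C" for x
    using B(2)[of x] C(2)[of x] K_nonneg[of x] by (simp add: \<kappa>_def)
  then show ?thesis using that[of "B + C"] B C by simp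
qed

section \<open>The formula for one continuous compactly supported function\<close>

context
  fixes f :: "heis \<Rightarrow> real" and R :: real
  assumes cf: "continuous_on UNIV f" and f0: "\<And>x. norm x \<ge> R \<Longrightarrow> f x = 0"
begin

lemma continuous_on_f_comp: "continuous_on S u \<Longrightarrow> continuous_on S (\<lambda>x. f (u x))"
  using continuous_on_compose2[OF cf] by auto

lemma measurable_f: "f \<in> borel_measurable borel"
  by (rule borel_measurable_continuous_onI[OF cf])

lemma f_bounded: obtains B where "B \<ge> 0" "\<And>x. \<bar>f x\<bar> \<le> B"
proof -
  have "compact (f ` cball 0 \<bar>R\<bar>)"
    by (rule compact_continuous_image[OF continuous_on_subset[OF cf]]) auto
  then obtain B where B: "\<forall>y\<in>f ` cball 0 \<bar>R\<bar>. norm y \<le> B"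
    using compact_imp_bounded bounded_iff by blast
  have "\<bar>f x\<bar> \<le> \<bar>B\<bar>" for x
  proof (cases "norm x \<le> \<bar>R\<bar>")
    case True
    then have "norm (f x) \<le> B" using B by simp
    then show ?thesis by simp
  next
    case False
    then show ?thesis using f0[of x] by simp
  qed
  then show ?thesis using that[of "\<bar>B\<bar>"] by simp
qed

definition ff :: "heis \<times> heis \<Rightarrow> real" where "ff z = f (fst z) * f (snd z)"

lemma continuous_on_ff: "continuous_on S ff"
  unfolding ff_def[abs_def] by (intro continuous_intros continuous_on_f_comp)

lemma ff_zero: "norm z \<ge> 2 * \<bar>R\<bar> \<Longrightarrow> ff z = 0"
proof -
  assume z: "norm z \<ge> 2 * \<bar>R\<bar>"
  have "norm z \<le> norm (fst z) + norm (snd z)" using norm_Pair_le[of "fst z" "snd z"] by simp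
  then have "norm (fst z) \<ge> R \<or> norm (snd z) \<ge> R" using z by linarith
  then show ?thesis by (elim disjE) (simp_all add: ff_def f0)
qed

lemma integrable_ff_mult: "continuous_on UNIV w \<Longrightarrow> integrable lborel (\<lambda>z. ff z * w z)"
  by (rule integrable_lborel_product[OF continuous_on_ff ff_zero])

lemma integrable_ff: "integrable lborel ff"
  using integrable_ff_mult[of "\<lambda>_. 1"] by simp

text \<open>The quadratic form of \<open>h_tt\<close> at time \<open>2 * a\<^sup>2\<close>,
  evaluated at \<open>f\<close>; by \<open>V_sq\<close> it is the squared norm of the coefficients
  at scale \<open>a\<close>, divided by \<open>a ^ 8\<close>.\<close>

definition energy :: "real \<Rightarrow> real" where
  "energy a = (LINT z|lborel. ff z * h_tt (heis_inv (fst z) \<odot> snd z, 2 * a\<^sup>2))"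

text \<open>Fubini for \<open>f x * f y\<close> times two kernels: integrating out \<open>x\<close>
  and \<open>y\<close> gives the square of \<open>V\<close>, integrating out \<open>\<omega>\<close>
  gives \<open>h_tt\<close>. Absolute integrability holds since one kernel is bounded, the other has
  \<open>L\<^sup>1\<close> norm independent of its centre, and \<open>ff\<close> is
  integrable.\<close>

lemma V_sq:
  assumes a: "a > 0"
  shows "integrable lborel (\<lambda>\<omega>. (V f \<omega> a)\<^sup>2)" "(LINT \<omega>|lborel. (V f \<omega> a)\<^sup>2) = a ^ 8 * energy a"
proof -
  define k where "k x \<omega> = \<phi> (dilate (1 / a) (heis_inv \<omega> \<odot> x))" for x \<omega>
  have ck: "continuous_on S (\<lambda>z. k (u z) (v z))" if "continuous_on S u" "continuous_on S v" for S u v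
    unfolding k_def by (intro continuous_on_\<phi>_comp continuous_intros that)
  obtain B where B: "B > 0" "\<And>x. \<bar>\<phi> x\<bar> \<le> B" using \<phi>_bounded by blast
  define P where "P zw = ff (fst zw) * (k (fst (fst zw)) (snd zw) * k (snd (fst zw)) (snd zw))" for zw :: "(heis \<times> heis) \<times> heis"
  have cP: "continuous_on UNIV P"
    unfolding P_def ff_def by (intro continuous_intros continuous_on_f_comp ck)
  have mP: "P \<in> borel_measurable (lborel \<Otimes>\<^sub>M lborel)"
    using borel_measurable_continuous_onI[OF cP] by (simp add: lborel_prod)
  have ik: "integrable lborel (\<lambda>\<omega>. k x \<omega> * k y \<omega>)" for x y
    unfolding k_def by (rule kernel_products(1)[OF a])
  have nk: "(LINT \<omega>|lborel. \<bar>k x \<omega> * k y \<omega>\<bar>) \<le> B * (a ^ 4 * (LINT \<omega>|lborel. \<bar>\<phi> \<omega>\<bar>))" for x y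
  proof -
    have "(LINT \<omega>|lborel. \<bar>k x \<omega> * k y \<omega>\<bar>) \<le> (LINT \<omega>|lborel. B * \<bar>k x \<omega>\<bar>)"
    proof (rule integral_mono)
      show "integrable lborel (\<lambda>\<omega>. \<bar>k x \<omega> * k y \<omega>\<bar>)" using ik[of x y] by simp
      show "integrable lborel (\<lambda>\<omega>. B * \<bar>k x \<omega>\<bar>)" using kernel_products(3)[OF a, of x] by (simp add: k_def)
      show "\<bar>k x \<omega> * k y \<omega>\<bar> \<le> B * \<bar>k x \<omega>\<bar>" for \<omega>
        using mult_left_mono[OF B(2)[of "dilate (1 / a) (heis_inv \<omega> \<odot> y)"], of "\<bar>k x \<omega>\<bar>"] by (simp add: k_def abs_mult mult.commute)
    qed
    then show ?thesis using kernel_products(4)[OF a, of x] by (simp add: k_def)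
  qed
  have iP: "integrable (lborel \<Otimes>\<^sub>M lborel) P"
  proof (rule lborel_pair.Fubini_integrable[OF mP])
    show "integrable lborel (\<lambda>z. LINT \<omega>|lborel. norm (P (z, \<omega>)))"
    proof (rule Bochner_Integration.integrable_bound[OF integrable_mult_right[OF integrable_ff, of "B * (a ^ 4 * (LINT \<omega>|lborel. \<bar>\<phi> \<omega>\<bar>))"]])
      show "(\<lambda>z. LINT \<omega>|lborel. norm (P (z, \<omega>))) \<in> borel_measurable lborel"
        using mP by (intro lborel.borel_measurable_lebesgue_integral) simp
      show "AE z in lborel. norm (LINT \<omega>|lborel. norm (P (z, \<omega>))) \<le> norm (B * (a ^ 4 * (LINT \<omega>|lborel. \<bar>\<phi> \<omega>\<bar>)) * ff z)"
      proof (intro always_eventually allI)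
        fix z
        have nn: "(LINT \<omega>|lborel. \<bar>\<phi> \<omega>\<bar>) \<ge> 0" by simp
        have "(LINT \<omega>|lborel. norm (P (z, \<omega>))) = \<bar>ff z\<bar> * (LINT \<omega>|lborel. \<bar>k (fst z) \<omega> * k (snd z) \<omega>\<bar>)"
          by (simp add: P_def abs_mult)
        also have "\<dots> \<le> \<bar>ff z\<bar> * (B * (a ^ 4 * (LINT \<omega>|lborel. \<bar>\<phi> \<omega>\<bar>)))"
          by (intro mult_left_mono nk) auto
        finally show "norm (LINT \<omega>|lborel. norm (P (z, \<omega>))) \<le> norm (B * (a ^ 4 * (LINT \<omega>|lborel. \<bar>\<phi> \<omega>\<bar>)) * ff z)"
          using B(1) a nn by (simp add: abs_mult ac_simps)
      qed
    qed
    show "AE z in lborel. integrable lborel (\<lambda>\<omega>. P (z, \<omega>))"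
      unfolding P_def using ik by (intro always_eventually allI) simp
  qed
  have V: "(LINT z|lborel. P (z, \<omega>)) = a ^ 4 * (V f \<omega> a)\<^sup>2" for \<omega>
  proof -
    have i: "integrable lborel (\<lambda>z. P (z, \<omega>))"
      unfolding P_def by (simp, intro integrable_ff_mult continuous_intros ck)
    have "(LINT z|lborel. P (z, \<omega>)) = (LINT z|(lborel \<Otimes>\<^sub>M lborel). P (z, \<omega>))" by (simp add: lborel_prod)
    also have "\<dots> = (LINT x|lborel. LINT y|lborel. P ((x, y), \<omega>))"
      by (rule lborel_pair.integral_fst'[symmetric]) (use i in \<open>simp add: lborel_prod\<close>)
    also have "\<dots> = (LINT x|lborel. LINT y|lborel. (f x * k x \<omega>) * (f y * k y \<omega>))"
      by (simp add: P_def ff_def ac_simps)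
    also have "\<dots> = (LINT x|lborel. f x * k x \<omega>) * (LINT y|lborel. f y * k y \<omega>)" by simp
    also have "(LINT x|lborel. f x * k x \<omega>) = a\<^sup>2 * V f \<omega> a"
    proof -
      have "V f \<omega> a = (LINT x|lborel. f x * k x \<omega> / a\<^sup>2)" by (simp add: V_def k_def)
      then show ?thesis using a by simp
    qed
    finally show ?thesis by (simp add: power2_eq_square power4_eq_xxxx)
  qed
  have "integrable lborel (\<lambda>\<omega>. LINT z|lborel. P (z, \<omega>))"
    using lborel_pair.integrable_snd[of "\<lambda>z \<omega>. P (z, \<omega>)"] iP by simp
  then have "integrable lborel (\<lambda>\<omega>. (1 / a ^ 4) * (LINT z|lborel. P (z, \<omega>)))" by (rule integrable_mult_right)
  then show "integrable lborel (\<lambda>\<omega>. (V f \<omega> a)\<^sup>2)" unfolding V using a by simp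
  have eq: "(LINT \<omega>|lborel. LINT z|lborel. P (z, \<omega>)) = (LINT z|lborel. LINT \<omega>|lborel. P (z, \<omega>))"
    using lborel_pair.Fubini_integral[of "\<lambda>z \<omega>. P (z, \<omega>)"] iP by simp
  have P: "(LINT \<omega>|lborel. P (z, \<omega>)) = a ^ 12 * (ff z * h_tt (heis_inv (fst z) \<odot> snd z, 2 * a\<^sup>2))" for z
    using kernel_products(2)[OF a] by (simp add: P_def k_def)
  have "a ^ 4 * (LINT \<omega>|lborel. (V f \<omega> a)\<^sup>2) = a ^ 12 * energy a"
    using eq unfolding V P energy_def by simp
  moreover have "a ^ 12 = a ^ 4 * a ^ 8" by (simp flip: power_add)
  ultimately have "a ^ 4 * (LINT \<omega>|lborel. (V f \<omega> a)\<^sup>2) = a ^ 4 * (a ^ 8 * energy a)" by (metis mult.assoc)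
  moreover have "a ^ 4 \<noteq> 0" using a by simp
  ultimately show "(LINT \<omega>|lborel. (V f \<omega> a)\<^sup>2) = a ^ 8 * energy a" by (metis mult_left_cancel)
qed

lemma energy_nonneg: "a > 0 \<Longrightarrow> energy a \<ge> 0"
proof -
  assume a: "a > 0"
  have "0 \<le> (LINT \<omega>|lborel. (V f \<omega> a)\<^sup>2)" by simp
  then show ?thesis using V_sq(2)[OF a] a by (simp add: zero_le_mult_iff)
qed

text \<open>The divisor 8 comes from the substitution \<open>u = 2 * a\<^sup>2\<close>: here
  \<open>u\<close> times \<open>du / da\<close> equals \<open>8 * a ^ 3\<close>, while
  \<open>a ^ 3\<close> is the weight wanted.\<close>

definition energy_prim :: "real \<Rightarrow> real" where
  "energy_prim a = (LINT z|lborel. ff z * h_prim (heis_inv (fst z) \<odot> snd z) (2 * a\<^sup>2)) / 8"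

text \<open>Since \<open>ff\<close> has compact support, both integrals are taken over a fixed box,
  where differentiation under the integral sign and continuity in the parameter only need joint
  continuity of the integrand.\<close>

lemma
  shows DERIV_energy_prim: "a > 0 \<Longrightarrow> (energy_prim has_real_derivative a ^ 3 * energy a) (at a)"
    and isCont_energy: "a > 0 \<Longrightarrow> isCont energy a"
proof -
  obtain A where A: "cball 0 (2 * \<bar>R\<bar>) \<subseteq> cbox (- A) (A :: heis \<times> heis)"
    using bounded_subset_cbox_symmetric[OF bounded_cball] by blast
  have ff0: "ff z = 0" if "z \<notin> cbox (- A) A" for z
    using that A by (intro ff_zero) (auto simp: subset_eq)
  have cm: "continuous_on UNIV (\<lambda>z. h_prim (heis_inv (fst z) \<odot> snd z) (2 * a\<^sup>2))" if "a > 0" for a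
    unfolding h_prim_def using that by (intro continuous_intros continuous_on_time_comp) auto
  have cg2: "continuous_on UNIV (\<lambda>z. h_tt (heis_inv (fst z) \<odot> snd z, 2 * a\<^sup>2))" if "a > 0" for a
    using that by (intro continuous_intros continuous_on_time_comp) auto
  have Ge: "energy_prim a = integral (cbox (- A) A) (\<lambda>z. ff z * h_prim (heis_inv (fst z) \<odot> snd z) (2 * a\<^sup>2)) / 8" if "a > 0" for a
    unfolding energy_prim_def using ff0 by (subst lborel_integral_eq_integral_cbox[OF integrable_ff_mult[OF cm[OF that]]]) auto
  have Ie: "energy a = integral (cbox (- A) A) (\<lambda>z. ff z * h_tt (heis_inv (fst z) \<odot> snd z, 2 * a\<^sup>2))" if "a > 0" for a
    unfolding energy_def using ff0 by (subst lborel_integral_eq_integral_cbox[OF integrable_ff_mult[OF cg2[OF that]]]) auto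
  have cI: "continuous_on ({0<..} \<times> cbox (- A) A) (\<lambda>(a, z). ff z * h_tt (heis_inv (fst z) \<odot> snd z, 2 * a\<^sup>2))"
    unfolding case_prod_beta
    by (intro continuous_intros continuous_on_time_comp continuous_on_compose2[OF continuous_on_ff]) auto
  have "continuous_on {0<..} (\<lambda>a. integral (cbox (- A) A) (\<lambda>z. ff z * h_tt (heis_inv (fst z) \<odot> snd z, 2 * a\<^sup>2)))"
    by (rule integral_continuous_on_param[OF cI])
  then have "continuous_on {0<..} energy"
    by (rule continuous_on_eq) (simp add: Ie)
  then show "isCont energy a" if "a > 0" for a
    using that by (simp add: continuous_on_eq_continuous_at)
  show "(energy_prim has_real_derivative a ^ 3 * energy a) (at a)" if a: "a > 0"
  proof -
    have "((\<lambda>a. integral (cbox (- A) A) (\<lambda>z. ff z * h_prim (heis_inv (fst z) \<odot> snd z) (2 * a\<^sup>2))) has_real_derivative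
        integral (cbox (- A) A) (\<lambda>z. ff z * (2 * a\<^sup>2 * h_tt (heis_inv (fst z) \<odot> snd z, 2 * a\<^sup>2) * (4 * a)))) (at a within {0<..})"
    proof (rule leibniz_rule_field_derivative)
      fix x z assume "x \<in> {0::real<..}"
      then have x: "x > 0" by simp
      have "((\<lambda>x. 2 * x\<^sup>2) has_real_derivative 4 * x) (at x)" by (auto intro!: derivative_eq_intros)
      from DERIV_chain2[OF DERIV_h_prim this, of "heis_inv (fst z) \<odot> snd z"] x
      have "((\<lambda>x. h_prim (heis_inv (fst z) \<odot> snd z) (2 * x\<^sup>2)) has_real_derivative 2 * x\<^sup>2 * h_tt (heis_inv (fst z) \<odot> snd z, 2 * x\<^sup>2) * (4 * x)) (at x)" by simp
      from DERIV_cmult[OF this, of "ff z"]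
      show "((\<lambda>x. ff z * h_prim (heis_inv (fst z) \<odot> snd z) (2 * x\<^sup>2)) has_real_derivative ff z * (2 * x\<^sup>2 * h_tt (heis_inv (fst z) \<odot> snd z, 2 * x\<^sup>2) * (4 * x))) (at x within {0<..})"
        by (rule has_field_derivative_at_within)
    next
      fix x assume "x \<in> {0::real<..}"
      then show "(\<lambda>z. ff z * h_prim (heis_inv (fst z) \<odot> snd z) (2 * x\<^sup>2)) integrable_on cbox (- A) A"
        by (intro integrable_continuous continuous_intros continuous_on_ff continuous_on_subset[OF cm]) auto
    next
      show "continuous_on ({0<..} \<times> cbox (- A) A) (\<lambda>(x, z). ff z * (2 * x\<^sup>2 * h_tt (heis_inv (fst z) \<odot> snd z, 2 * x\<^sup>2) * (4 * x)))"
        unfolding case_prod_beta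
        by (intro continuous_intros continuous_on_time_comp continuous_on_compose2[OF continuous_on_ff]) auto
    qed (use a in auto)
    then have "((\<lambda>a. integral (cbox (- A) A) (\<lambda>z. ff z * h_prim (heis_inv (fst z) \<odot> snd z) (2 * a\<^sup>2))) has_real_derivative
        integral (cbox (- A) A) (\<lambda>z. ff z * (2 * a\<^sup>2 * h_tt (heis_inv (fst z) \<odot> snd z, 2 * a\<^sup>2) * (4 * a)))) (at a)"
      using a by (simp add: at_within_open[of a "{0<..}"])
    from DERIV_cdivide[OF this, of 8]
    have "((\<lambda>a. integral (cbox (- A) A) (\<lambda>z. ff z * h_prim (heis_inv (fst z) \<odot> snd z) (2 * a\<^sup>2)) / 8) has_real_derivative
        integral (cbox (- A) A) (\<lambda>z. ff z * (2 * a\<^sup>2 * h_tt (heis_inv (fst z) \<odot> snd z, 2 * a\<^sup>2) * (4 * a))) / 8) (at a)" .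
    moreover have "integral (cbox (- A) A) (\<lambda>z. ff z * (2 * a\<^sup>2 * h_tt (heis_inv (fst z) \<odot> snd z, 2 * a\<^sup>2) * (4 * a))) / 8 = a ^ 3 * energy a"
    proof -
      have "(\<lambda>z. ff z * (2 * a\<^sup>2 * h_tt (heis_inv (fst z) \<odot> snd z, 2 * a\<^sup>2) * (4 * a)))
        = (\<lambda>z. (8 * a ^ 3) * (ff z * h_tt (heis_inv (fst z) \<odot> snd z, 2 * a\<^sup>2)))"
        by (auto simp: power2_eq_square power3_eq_cube)
      then show ?thesis by (simp only: integral_mult_right Ie[OF a])
    qed
    ultimately have "((\<lambda>a. integral (cbox (- A) A) (\<lambda>z. ff z * h_prim (heis_inv (fst z) \<odot> snd z) (2 * a\<^sup>2)) / 8) has_real_derivative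
        a ^ 3 * energy a) (at a)" by (simp only:)
    then show ?thesis
    proof (rule has_field_derivative_transform_within_open[of _ _ _ "{0<..}"])
      fix a assume "a \<in> {0::real<..}"
      then have "a > 0" by simp
      then show "integral (cbox (- A) A) (\<lambda>z. ff z * h_prim (heis_inv (fst z) \<odot> snd z) (2 * a\<^sup>2)) / 8 = energy_prim a"
        by (rule Ge[symmetric])
    qed (use a in auto)
  qed
qed

text \<open>\<open>\<kappa>\<close> is bounded, so by scaling \<open>h_prim\<close> at time
  \<open>2 * a\<^sup>2\<close> is of order \<open>a\<^sup>-\<^sup>4\<close> uniformly in
  space.\<close>

lemma energy_prim_at_top: "(energy_prim \<longlongrightarrow> 0) at_top"
proof -
  obtain D where D: "D \<ge> 0" "\<And>x. \<bar>\<kappa> x\<bar> \<le> D" using \<kappa>_bounded by blast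
  define C where "C = D * (LINT z|lborel. \<bar>ff z\<bar>) / 32"
  have "norm (energy_prim a) \<le> C / a ^ 4" if "a > 0" for a
  proof -
    have "norm (LINT z|lborel. ff z * h_prim (heis_inv (fst z) \<odot> snd z) (2 * a\<^sup>2)) \<le> (LINT z|lborel. \<bar>ff z\<bar> * (D / (2 * a\<^sup>2)\<^sup>2))"
    proof (rule Bochner_Integration.integral_norm_bound_integral)
      show "integrable lborel (\<lambda>z. ff z * h_prim (heis_inv (fst z) \<odot> snd z) (2 * a\<^sup>2))"
        unfolding h_prim_def using that by (intro integrable_ff_mult continuous_intros continuous_on_time_comp) auto
      show "integrable lborel (\<lambda>z. \<bar>ff z\<bar> * (D / (2 * a\<^sup>2)\<^sup>2))"
        using integrable_ff by (intro integrable_mult_left) simp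
      fix z
      have "\<bar>h_prim (heis_inv (fst z) \<odot> snd z) (2 * a\<^sup>2)\<bar> \<le> D / (2 * a\<^sup>2)\<^sup>2"
      proof -
        have "\<bar>h_prim (heis_inv (fst z) \<odot> snd z) (2 * a\<^sup>2)\<bar>
            = \<bar>\<kappa> (dilate (1 / sqrt (2 * a\<^sup>2)) (heis_inv (fst z) \<odot> snd z))\<bar> / (2 * a\<^sup>2)\<^sup>2"
          using that by (subst h_prim_scale) (simp_all del: power_mult_distrib)
        then show ?thesis using divide_right_mono[OF D(2)] by simp
      qed
      then show "norm (ff z * h_prim (heis_inv (fst z) \<odot> snd z) (2 * a\<^sup>2)) \<le> \<bar>ff z\<bar> * (D / (2 * a\<^sup>2)\<^sup>2)"
        unfolding real_norm_def abs_mult by (intro mult_left_mono) auto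
    qed
    also have "\<dots> = (LINT z|lborel. \<bar>ff z\<bar>) * (D / (2 * a\<^sup>2)\<^sup>2)" by simp
    finally show ?thesis by (simp add: energy_prim_def C_def power2_eq_square power4_eq_xxxx mult.commute[of D])
  qed
  then have "eventually (\<lambda>a. norm (energy_prim a) \<le> C / a ^ 4) at_top"
    using eventually_gt_at_top[of 0] by (rule eventually_mono[rotated])
  moreover have "((\<lambda>a. C / a ^ 4) \<longlongrightarrow> 0) at_top"
    by (rule tendsto_divide_0[OF tendsto_const]) (auto intro!: filterlim_at_top_imp_at_infinity filterlim_pow_at_top filterlim_ident)
  ultimately show ?thesis by (rule Lim_null_comparison)
qed

text \<open>The substitution \<open>y = x \<odot> dilate s \<xi>\<close> with
  \<open>s = sqrt 2 * a\<close> has Jacobian \<open>s ^ 4\<close>, which cancels the factor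
  \<open>1 / u\<^sup>2\<close> in the scaling of \<open>h_prim\<close>. The parameter
  \<open>a\<close> now occurs only inside \<open>f\<close>.\<close>

lemma energy_prim_alt:
  assumes a: "a > 0"
  shows "energy_prim a = - (LINT x|lborel. f x * (LINT \<xi>|lborel. f (x \<odot> dilate (sqrt 2 * a) \<xi>) * \<kappa> \<xi>)) / 8"
proof -
  define s where "s = sqrt 2 * a"
  have s: "s > 0" "sqrt (2 * a\<^sup>2) = s" "s ^ 4 = (2 * a\<^sup>2)\<^sup>2"
    using a by (simp_all add: s_def real_sqrt_mult power_mult_distrib power4_eq_xxxx power2_eq_square)
  note [measurable] = measurable_f
  have cm: "continuous_on UNIV (\<lambda>z. h_prim (heis_inv (fst z) \<odot> snd z) (2 * a\<^sup>2))"
    unfolding h_prim_def using a by (intro continuous_intros continuous_on_time_comp) auto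
  note i = integrable_ff_mult[OF cm]
  have "(LINT z|lborel. ff z * h_prim (heis_inv (fst z) \<odot> snd z) (2 * a\<^sup>2))
      = (LINT z|(lborel \<Otimes>\<^sub>M lborel). ff z * h_prim (heis_inv (fst z) \<odot> snd z) (2 * a\<^sup>2))" by (simp add: lborel_prod)
  also have "\<dots> = (LINT x|lborel. LINT y|lborel. ff (x, y) * h_prim (heis_inv (fst (x, y)) \<odot> snd (x, y)) (2 * a\<^sup>2))"
    by (rule lborel_pair.integral_fst'[symmetric]) (use i in \<open>simp add: lborel_prod\<close>)
  also have "\<dots> = (LINT x|lborel. f x * (LINT y|lborel. f y * h_prim (heis_inv x \<odot> y) (2 * a\<^sup>2)))"
    by (simp add: ff_def mult.assoc)
  finally have eq: "(LINT z|lborel. ff z * h_prim (heis_inv (fst z) \<odot> snd z) (2 * a\<^sup>2))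
      = (LINT x|lborel. f x * (LINT y|lborel. f y * h_prim (heis_inv x \<odot> y) (2 * a\<^sup>2)))" .
  have "(LINT y|lborel. f y * h_prim (heis_inv x \<odot> y) (2 * a\<^sup>2)) = - (LINT \<xi>|lborel. f (x \<odot> dilate s \<xi>) * \<kappa> \<xi>)" for x
  proof -
    define F where "F w = f (x \<odot> w) * \<kappa> (dilate (1 / s) w)" for w
    have [measurable]: "F \<in> borel_measurable borel" unfolding F_def[abs_def] by measurable
    have [measurable]: "(\<lambda>y. F (heis_inv x \<odot> y)) \<in> borel_measurable borel" by measurable
    have "(LINT y|lborel. f y * h_prim (heis_inv x \<odot> y) (2 * a\<^sup>2)) = (LINT y|lborel. - (1 / s ^ 4) * F (heis_inv x \<odot> y))"
      unfolding F_def using a s by (intro Bochner_Integration.integral_cong) (auto simp: h_prim_scale)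
    also have "\<dots> = - ((1 / s ^ 4) * (LINT w|lborel. F w))"
      using integral_heis_left[of F "heis_inv x"] by simp
    also have "(1 / s ^ 4) * (LINT w|lborel. F w) = (LINT \<xi>|lborel. F (dilate s \<xi>))"
      using integral_dilate[of F s] s(1) by simp
    finally show ?thesis using s(1) by (simp add: F_def dilate_dilate)
  qed
  then show ?thesis unfolding energy_prim_def eq by (simp add: s_def)
qed

text \<open>Two dominated convergences: the inner one uses continuity and boundedness of
  \<open>f\<close> against the integrable \<open>\<kappa>\<close> of mass one, the outer one a
  uniform bound on the inner integral against the integrable \<open>f\<close>.\<close>

lemma energy_prim_at_0: "(energy_prim \<longlongrightarrow> - (LINT x|lborel. (f x)\<^sup>2) / 8) (at_right 0)"
proof (rule tendsto_at_right_sequentially[of 0 1])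
  fix S :: "nat \<Rightarrow> real"
  assume S: "\<And>n. 0 < S n" "S \<longlonglongrightarrow> 0"
  note [measurable] = measurable_f
  obtain B where B: "B \<ge> 0" "\<And>x. \<bar>f x\<bar> \<le> B" using f_bounded by blast
  define J where "J n x = (LINT \<xi>|lborel. f (x \<odot> dilate (sqrt 2 * S n) \<xi>) * \<kappa> \<xi>)" for n x
  have iB: "integrable lborel (\<lambda>\<xi>. B * \<bar>\<kappa> \<xi>\<bar>)" using integrable_\<kappa> by simp
  have bnd: "norm (f y * \<kappa> \<xi>) \<le> B * \<bar>\<kappa> \<xi>\<bar>" for y \<xi>
    using mult_right_mono[OF B(2)[of y], of "\<bar>\<kappa> \<xi>\<bar>"] by (simp add: abs_mult)
  have lim: "(\<lambda>n. J n x) \<longlonglongrightarrow> f x" for x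
  proof -
    have c: "continuous_on UNIV (\<lambda>s. f (x \<odot> dilate (sqrt 2 * s) \<xi>))" for \<xi>
      by (intro continuous_on_f_comp continuous_intros)
    have "(\<lambda>n. J n x) \<longlonglongrightarrow> (LINT \<xi>|lborel. f x * \<kappa> \<xi>)"
      unfolding J_def
    proof (rule integral_dominated_convergence[OF _ _ iB])
      show "AE \<xi> in lborel. (\<lambda>n. f (x \<odot> dilate (sqrt 2 * S n) \<xi>) * \<kappa> \<xi>) \<longlonglongrightarrow> f x * \<kappa> \<xi>"
      proof (intro always_eventually allI tendsto_mult_right)
        fix \<xi>
        show "(\<lambda>n. f (x \<odot> dilate (sqrt 2 * S n) \<xi>)) \<longlonglongrightarrow> f x"
          using continuous_on_tendsto_compose[OF c S(2)] by simp
      qed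
    qed (use bnd in auto)
    then show ?thesis by (simp add: integral_\<kappa>)
  qed
  have mJ: "J n \<in> borel_measurable borel" for n
    unfolding J_def[abs_def] by measurable
  have bJ: "\<bar>J n x\<bar> \<le> B * (LINT \<xi>|lborel. \<bar>\<kappa> \<xi>\<bar>)" for n x
  proof -
    have "norm (J n x) \<le> (LINT \<xi>|lborel. B * \<bar>\<kappa> \<xi>\<bar>)"
      unfolding J_def
    proof (rule Bochner_Integration.integral_norm_bound_integral)
      show "integrable lborel (\<lambda>\<xi>. f (x \<odot> dilate (sqrt 2 * S n) \<xi>) * \<kappa> \<xi>)"
        by (rule Bochner_Integration.integrable_bound[OF iB]) (use bnd B(1) in \<open>auto simp: abs_mult\<close>)
    qed (use bnd iB in auto)
    then show ?thesis by simp
  qed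
  have "integrable lborel f" by (rule integrable_continuous_compact_support[OF cf f0])
  then have iw: "integrable lborel (\<lambda>x. \<bar>f x\<bar> * (B * (LINT \<xi>|lborel. \<bar>\<kappa> \<xi>\<bar>)))" by (intro integrable_mult_left) simp
  have "(\<lambda>n. LINT x|lborel. f x * J n x) \<longlonglongrightarrow> (LINT x|lborel. f x * f x)"
  proof (rule integral_dominated_convergence[OF _ _ iw])
    show "AE x in lborel. (\<lambda>n. f x * J n x) \<longlonglongrightarrow> f x * f x"
      by (intro always_eventually allI tendsto_mult_left lim)
    show "AE x in lborel. norm (f x * J n x) \<le> \<bar>f x\<bar> * (B * (LINT \<xi>|lborel. \<bar>\<kappa> \<xi>\<bar>))" for n
      unfolding real_norm_def abs_mult by (intro always_eventually allI mult_left_mono bJ) auto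
  qed (use mJ in auto)
  then have "(\<lambda>n. - (LINT x|lborel. f x * J n x) / 8) \<longlonglongrightarrow> - (LINT x|lborel. f x * f x) / 8"
    by (intro tendsto_intros) auto
  then show "(\<lambda>n. energy_prim (S n)) \<longlonglongrightarrow> - (LINT x|lborel. (f x)\<^sup>2) / 8"
    using S(1) by (simp add: energy_prim_alt J_def power2_eq_square)
qed simp

text \<open>The exponent 8 from \<open>V_sq\<close> and the weight \<open>a\<^sup>-\<^sup>5\<close>
  leave \<open>a ^ 3 * energy a\<close>. As this is nonnegative, the improper fundamental theorem
  yields integrability together with the value.\<close>

lemma calderon_continuous:
  "(\<integral>\<^sup>+a. (\<integral>\<^sup>+\<omega>. ennreal ((V f \<omega> a)\<^sup>2) \<partial>lborel) * (ennreal (1 / a ^ 5) * indicator {0<..} a) \<partial>lborel)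
    = ennreal ((LINT x|lborel. (f x)\<^sup>2) / 8)"
proof -
  have e: "einterval 0 \<infinity> = {0::real<..}" by (auto simp: einterval_def)
  have z: "(0::ereal) = ereal 0" by (simp add: zero_ereal_def)
  have "set_integrable lborel (einterval 0 \<infinity>) (\<lambda>a. a ^ 3 * energy a) \<and>
    (LBINT a=0..\<infinity>. a ^ 3 * energy a) = 0 - (- (LINT x|lborel. (f x)\<^sup>2) / 8)"
  proof (intro conjI)
    have 1: "((energy_prim \<circ> real_of_ereal) \<longlongrightarrow> - (LINT x|lborel. (f x)\<^sup>2) / 8) (at_right 0)"
      unfolding z ereal_tendsto_simps using energy_prim_at_0 .
    have 2: "((energy_prim \<circ> real_of_ereal) \<longlongrightarrow> 0) (at_left \<infinity>)"
      unfolding ereal_tendsto_simps using energy_prim_at_top .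
    have 3: "AE x in lborel. 0 < ereal x \<longrightarrow> ereal x < \<infinity> \<longrightarrow> 0 \<le> x ^ 3 * energy x"
      using energy_nonneg by (intro always_eventually) auto
    note FTC = interval_integral_FTC_nonneg[of 0 \<infinity> energy_prim "\<lambda>a. a ^ 3 * energy a", OF _ _ _ 3 1 2]
    show "set_integrable lborel (einterval 0 \<infinity>) (\<lambda>a. a ^ 3 * energy a)"
      by (rule FTC(1)) (auto intro!: DERIV_energy_prim continuous_intros isCont_energy)
    show "(LBINT a=0..\<infinity>. a ^ 3 * energy a) = 0 - (- (LINT x|lborel. (f x)\<^sup>2) / 8)"
      by (rule FTC(2)) (auto intro!: DERIV_energy_prim continuous_intros isCont_energy)
  qed
  then have i: "integrable lborel (\<lambda>a. indicator {0<..} a * (a ^ 3 * energy a))"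
    and v: "(LINT a|lborel. indicator {0<..} a * (a ^ 3 * energy a)) = (LINT x|lborel. (f x)\<^sup>2) / 8"
    by (simp_all add: set_integrable_def interval_lebesgue_integral_def set_lebesgue_integral_def e)
  have "(\<integral>\<^sup>+\<omega>. ennreal ((V f \<omega> a)\<^sup>2) \<partial>lborel) * (ennreal (1 / a ^ 5) * indicator {0<..} a) = ennreal (indicator {0<..} a * (a ^ 3 * energy a))" for a
  proof (cases "a > 0")
    case True
    have "(\<integral>\<^sup>+\<omega>. ennreal ((V f \<omega> a)\<^sup>2) \<partial>lborel) = ennreal (a ^ 8 * energy a)"
      using nn_integral_eq_integral[OF V_sq(1)[OF True]] V_sq(2)[OF True] by simp
    moreover have "a ^ 8 * energy a * (1 / a ^ 5) = a ^ 3 * energy a"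
    proof -
      have "a ^ 8 = a ^ 5 * a ^ 3" by (simp flip: power_add)
      moreover have "a ^ 5 * z * (1 / a ^ 5) = z" for z using True by simp
      ultimately show ?thesis by (metis mult.assoc)
    qed
    ultimately show ?thesis using True energy_nonneg[OF True]
      by (simp add: ennreal_mult[symmetric])
  qed simp
  then have "(\<integral>\<^sup>+a. (\<integral>\<^sup>+\<omega>. ennreal ((V f \<omega> a)\<^sup>2) \<partial>lborel) * (ennreal (1 / a ^ 5) * indicator {0<..} a) \<partial>lborel)
    = (\<integral>\<^sup>+a. ennreal (indicator {0<..} a * (a ^ 3 * energy a)) \<partial>lborel)" by simp
  also have "\<dots> = ennreal ((LINT x|lborel. (f x)\<^sup>2) / 8)"
    using nn_integral_eq_integral[OF i] energy_nonneg v by (auto simp: indicator_def)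
  finally show ?thesis .
qed

end

end
section \<open>Admissibility\<close>

definition sq_integrable :: "'a measure \<Rightarrow> ('a \<Rightarrow> real) \<Rightarrow> bool" where
  "sq_integrable M f \<longleftrightarrow> f \<in> borel_measurable M \<and> integrable M (\<lambda>x. (f x)\<^sup>2)"

lemma sq_integrable_mult:
  assumes "sq_integrable M f" "sq_integrable M g"
  shows "integrable M (\<lambda>x. f x * g x)"
proof -
  have [measurable]: "f \<in> borel_measurable M" "g \<in> borel_measurable M" using assms by (auto simp: sq_integrable_def)
  have "integrable M (\<lambda>x. ((f x)\<^sup>2 + (g x)\<^sup>2) / 2)" using assms by (simp add: sq_integrable_def)
  then show ?thesis
  proof (rule Bochner_Integration.integrable_bound)
    show "AE x in M. norm (f x * g x) \<le> norm (((f x)\<^sup>2 + (g x)\<^sup>2) / 2)"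
    proof (intro always_eventually allI)
      fix x
      show "norm (f x * g x) \<le> norm (((f x)\<^sup>2 + (g x)\<^sup>2) / 2)"
        using zero_le_power2[of "\<bar>f x\<bar> - \<bar>g x\<bar>"] by (simp add: power2_eq_square abs_mult algebra_simps)
    qed
  qed measurable
qed

lemma sq_integrable_add:
  assumes "sq_integrable M f" "sq_integrable M g"
  shows "sq_integrable M (\<lambda>x. f x + g x)"
proof -
  have "integrable M (\<lambda>x. (f x)\<^sup>2 + (g x)\<^sup>2 + 2 * (f x * g x))"
    using assms sq_integrable_mult[OF assms] by (auto simp: sq_integrable_def)
  then show ?thesis using assms by (auto simp: sq_integrable_def power2_sum algebra_simps)
qed

lemma sq_integrable_diff:
  assumes "sq_integrable M f" "sq_integrable M g"
  shows "sq_integrable M (\<lambda>x. f x - g x)"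
  using sq_integrable_add[of M f "\<lambda>x. - g x"] assms by (auto simp: sq_integrable_def)

lemma Cauchy_Schwarz_integral:
  assumes f: "sq_integrable M f" and g: "sq_integrable M g"
  shows "(LINT x|M. f x * g x)\<^sup>2 \<le> (LINT x|M. (f x)\<^sup>2) * (LINT x|M. (g x)\<^sup>2)"
proof -
  define F G I where "F = (LINT x|M. (f x)\<^sup>2)" and "G = (LINT x|M. (g x)\<^sup>2)" and "I = (LINT x|M. f x * g x)"
  have i: "integrable M (\<lambda>x. (f x)\<^sup>2)" "integrable M (\<lambda>x. (g x)\<^sup>2)" "integrable M (\<lambda>x. f x * g x)"
    using f g sq_integrable_mult by (auto simp: sq_integrable_def)
  have q: "0 \<le> F - 2 * t * I + t\<^sup>2 * G" for t
  proof -
    have "0 \<le> (LINT x|M. (f x)\<^sup>2 - (2 * t) * (f x * g x) + t\<^sup>2 * (g x)\<^sup>2)"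
    proof (rule Bochner_Integration.integral_nonneg)
      fix x
      have "(f x)\<^sup>2 - (2 * t) * (f x * g x) + t\<^sup>2 * (g x)\<^sup>2 = (f x - t * g x)\<^sup>2"
        by (simp add: power2_eq_square algebra_simps)
      then show "0 \<le> (f x)\<^sup>2 - (2 * t) * (f x * g x) + t\<^sup>2 * (g x)\<^sup>2" by simp
    qed
    also have "\<dots> = F - 2 * t * I + t\<^sup>2 * G" using i by (simp add: F_def G_def I_def)
    finally show ?thesis .
  qed
  have G0: "G \<ge> 0" by (simp add: G_def)
  have "I\<^sup>2 \<le> F * G"
  proof (cases "G = 0")
    case True
    have "I = 0"
    proof (rule ccontr)
      assume "I \<noteq> 0"
      \<comment> \<open>In the degenerate case the quadratic in \<open>t\<close> is affine, and this
        \<open>t\<close> would give it the value -1.\<close>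
      then have "2 * ((F + 1) / (2 * I)) * I = F + 1" by simp
      then show False using q[of "(F + 1) / (2 * I)"] True by simp
    qed
    then show ?thesis using True by simp
  next
    case False
    then have "F - 2 * (I / G) * I + (I / G)\<^sup>2 * G = (F * G - I\<^sup>2) / G"
      by (simp add: power2_eq_square field_simps)
    then have "0 \<le> (F * G - I\<^sup>2) / G" using q[of "I / G"] by simp
    then show ?thesis using G0 False by (simp add: zero_le_divide_iff)
  qed
  then show ?thesis by (simp add: F_def G_def I_def)
qed

text \<open>With \<open>g n = f - d n\<close> the square expands into three terms; Cauchy-Schwarz
  sends the mixed one to 0.\<close>

lemma sq_integrable_LIMSEQ:
  assumes f: "sq_integrable M f" and g: "\<And>n. sq_integrable M (g n)"
    and lim: "(\<lambda>n. LINT x|M. (f x - g n x)\<^sup>2) \<longlonglongrightarrow> 0"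
  shows "(\<lambda>n. LINT x|M. (g n x)\<^sup>2) \<longlonglongrightarrow> (LINT x|M. (f x)\<^sup>2)"
proof -
  define d where "d n x = f x - g n x" for n x
  have d: "sq_integrable M (d n)" for n unfolding d_def by (rule sq_integrable_diff[OF f g])
  define I where "I n = (LINT x|M. f x * d n x)" for n
  have "(\<lambda>n. (LINT x|M. (f x)\<^sup>2) * (LINT x|M. (d n x)\<^sup>2)) \<longlonglongrightarrow> (LINT x|M. (f x)\<^sup>2) * 0"
    using lim unfolding d_def by (rule tendsto_mult_left)
  then have "(\<lambda>n. (I n)\<^sup>2) \<longlonglongrightarrow> 0"
    by (intro tendsto_sandwich[OF _ _ tendsto_const, of 0 "\<lambda>n. (I n)\<^sup>2"])
       (auto simp: I_def intro!: always_eventually Cauchy_Schwarz_integral[OF f d])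
  then have I: "I \<longlonglongrightarrow> 0"
    using tendsto_real_sqrt[of "\<lambda>n. (I n)\<^sup>2" 0 sequentially] by (simp add: tendsto_rabs_zero_iff)
  have eq: "(LINT x|M. (g n x)\<^sup>2) = (LINT x|M. (f x)\<^sup>2) - 2 * I n + (LINT x|M. (d n x)\<^sup>2)" for n
  proof -
    have "(LINT x|M. (g n x)\<^sup>2) = (LINT x|M. (f x)\<^sup>2 - 2 * (f x * d n x) + (d n x)\<^sup>2)"
      by (rule Bochner_Integration.integral_cong) (auto simp: d_def power2_eq_square algebra_simps)
    also have "\<dots> = (LINT x|M. (f x)\<^sup>2) - 2 * I n + (LINT x|M. (d n x)\<^sup>2)"
      using f d[of n] sq_integrable_mult[OF f d, of n] by (simp add: I_def sq_integrable_def)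
    finally show ?thesis .
  qed
  have "(\<lambda>n. (LINT x|M. (f x)\<^sup>2) - 2 * I n + (LINT x|M. (d n x)\<^sup>2)) \<longlonglongrightarrow> (LINT x|M. (f x)\<^sup>2) - 2 * 0 + 0"
    using lim unfolding d_def[symmetric] by (intro tendsto_intros I)
  then show ?thesis by (simp add: eq)
qed

section \<open>Integration over the semidirect product\<close>

lemma UNIV_times_measurable [measurable]: "UNIV \<times> {0<..} \<in> sets (borel :: (heis \<times> real) measure)"
  by (intro borel_open open_Times) auto

lemma space_haar_G: "space haar_G = UNIV \<times> {0<..}"
  by (simp add: haar_G_def space_restrict_space)

lemma sets_haar_G: "sets haar_G = sets (restrict_space borel (UNIV \<times> {0<..}))"
  by (simp add: haar_G_def cong: sets_restrict_space_cong)

lemma haar_G_measurable: "F \<in> borel_measurable borel \<Longrightarrow> F \<in> borel_measurable haar_G"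
  using measurable_cong_sets[OF sets_haar_G refl] measurable_restrict_space1 by blast

lemma haar_G_alt: "haar_G = density (restrict_space lborel (UNIV \<times> {0<..})) (\<lambda>z. ennreal (1 / snd z ^ 5))"
  unfolding haar_G_def by (simp add: case_prod_beta')

lemma measurable_weight: "(\<lambda>z::heis \<times> real. 1 / snd z ^ 5) \<in> borel_measurable (restrict_space lborel (UNIV \<times> {0<..}))"
proof (rule measurable_restrict_space1)
  have [measurable]: "(snd :: heis \<times> real \<Rightarrow> real) \<in> borel_measurable borel"
    by (intro borel_measurable_continuous_onI continuous_intros)
  show "(\<lambda>z::heis \<times> real. 1 / snd z ^ 5) \<in> borel_measurable lborel" by measurable
qed

text \<open>The scale is the outer variable here, the order in which the Calderon formula is
  computed.\<close>

lemma nn_integral_haar_G: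
  assumes F: "F \<in> borel_measurable (borel :: (heis \<times> real) measure)"
  shows "(\<integral>\<^sup>+z. F z \<partial>haar_G) = (\<integral>\<^sup>+a. (\<integral>\<^sup>+\<omega>. F (\<omega>, a) \<partial>lborel) * (ennreal (1 / a ^ 5) * indicator {0<..} a) \<partial>lborel)"
proof -
  have [measurable]: "(snd :: heis \<times> real \<Rightarrow> real) \<in> borel_measurable borel"
    by (intro borel_measurable_continuous_onI continuous_intros)
  note [measurable] = F
  define H where "H z = F z * (ennreal (1 / snd z ^ 5) * indicator {0<..} (snd z))" for z :: "heis \<times> real"
  have [measurable]: "H \<in> borel_measurable borel" unfolding H_def[abs_def] by measurable
  have "(\<integral>\<^sup>+z. F z \<partial>haar_G) = (\<integral>\<^sup>+z. ennreal (1 / snd z ^ 5) * F z \<partial>restrict_space lborel (UNIV \<times> {0<..}))"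
    unfolding haar_G_alt
    by (rule nn_integral_density) (auto intro!: measurable_compose[OF measurable_weight] measurable_restrict_space1 F)
  also have "\<dots> = (\<integral>\<^sup>+z. ennreal (1 / snd z ^ 5) * F z * indicator (UNIV \<times> {0<..}) z \<partial>lborel)"
    by (rule nn_integral_restrict_space) simp
  also have "\<dots> = (\<integral>\<^sup>+z. H z \<partial>(lborel \<Otimes>\<^sub>M lborel))"
    unfolding lborel_prod H_def by (intro nn_integral_cong) (auto simp: indicator_def ac_simps)
  also have "\<dots> = (\<integral>\<^sup>+a. \<integral>\<^sup>+\<omega>. H (\<omega>, a) \<partial>lborel \<partial>lborel)"
    by (rule lborel_pair.nn_integral_snd[symmetric]) (simp add: lborel_prod)
  also have "\<dots> = (\<integral>\<^sup>+a. (\<integral>\<^sup>+\<omega>. F (\<omega>, a) \<partial>lborel) * (ennreal (1 / a ^ 5) * indicator {0<..} a) \<partial>lborel)"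
    unfolding H_def snd_conv by (intro nn_integral_cong nn_integral_multc) measurable
  finally show ?thesis .
qed

text \<open>The opposite order, with the group variable outside as in \<open>admissible\<close>;
  integrability on the product justifies it.\<close>

lemma integral_haar_G:
  fixes F :: "heis \<times> real \<Rightarrow> real"
  assumes F: "F \<in> borel_measurable borel" and i: "integrable haar_G F"
  shows "(LINT z|haar_G. F z) = (LINT \<omega>|lborel. (LINT a:{0<..}|lborel. F (\<omega>, a) * (1 / a ^ 5)))"
proof -
  note w = measurable_weight
  have nn: "AE z in restrict_space lborel (UNIV \<times> {0<..}). 0 \<le> 1 / snd (z :: heis \<times> real) ^ 5"
    by (rule AE_I2) (auto simp: space_restrict_space)
  have mF: "F \<in> borel_measurable (restrict_space lborel (UNIV \<times> {0<..}))"
    by (rule measurable_restrict_space1) (use F in simp)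
  define H where "H z = indicator (UNIV \<times> {0<..}) z *\<^sub>R ((1 / snd z ^ 5) *\<^sub>R F z)" for z :: "heis \<times> real"
  have "integrable (restrict_space lborel (UNIV \<times> {0<..})) (\<lambda>z. (1 / snd z ^ 5) *\<^sub>R F z)"
    using i unfolding haar_G_alt by (subst (asm) integrable_density[OF mF w nn])
  then have iH: "integrable lborel H"
    unfolding H_def by (subst (asm) integrable_restrict_space) simp_all
  have "(LINT z|haar_G. F z) = (LINT z|restrict_space lborel (UNIV \<times> {0<..}). (1 / snd z ^ 5) *\<^sub>R F z)"
    unfolding haar_G_alt by (rule integral_density[OF mF w nn])
  also have "\<dots> = (LINT z|(lborel \<Otimes>\<^sub>M lborel). H z)"
    unfolding lborel_prod H_def by (rule integral_restrict_space) simp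
  also have "\<dots> = (LINT \<omega>|lborel. LINT a|lborel. H (\<omega>, a))"
    by (rule lborel_pair.integral_fst'[symmetric]) (use iH in \<open>simp add: lborel_prod\<close>)
  also have "\<dots> = (LINT \<omega>|lborel. (LINT a:{0<..}|lborel. F (\<omega>, a) * (1 / a ^ 5)))"
    unfolding set_lebesgue_integral_def H_def
    by (intro Bochner_Integration.integral_cong refl) (auto simp: indicator_def)
  finally show ?thesis .
qed

section \<open>From continuous to square integrable and complex functions\<close>

context heis_heat
begin

text \<open>The real-valued form of \<open>quasi_regular \<omega> a \<phi>\<close>.\<close>

definition atom :: "heis \<Rightarrow> real \<Rightarrow> heis \<Rightarrow> real" where
  "atom \<omega> a \<upsilon> = \<phi> (dilate (1 / a) (heis_inv \<omega> \<odot> \<upsilon>)) / a\<^sup>2"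

lemma V_atom: "V f \<omega> a = (LINT \<upsilon>|lborel. f \<upsilon> * atom \<omega> a \<upsilon>)"
  by (simp add: V_def atom_def)

lemma measurable_atom [measurable]: "atom \<omega> a \<in> borel_measurable borel"
  unfolding atom_def[abs_def] by measurable

text \<open>Unitarity of the quasi-regular representation: the squared normalization
  \<open>1 / a ^ 4\<close> cancels the Jacobian of the dilation.\<close>

lemma sq_integrable_atom:
  assumes "a > 0"
  shows "sq_integrable lborel (atom \<omega> a)" "(LINT \<upsilon>|lborel. (atom \<omega> a \<upsilon>)\<^sup>2) = (LINT \<upsilon>|lborel. (\<phi> \<upsilon>)\<^sup>2)"
proof -
  define F where "F x = (\<phi> (dilate (1 / a) x))\<^sup>2" for x
  have [measurable]: "F \<in> borel_measurable borel" unfolding F_def[abs_def] by measurable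
  have a': "1 / a > 0" using assms by simp
  have iF: "integrable lborel F" "(LINT x|lborel. F x) = a ^ 4 * (LINT x|lborel. (\<phi> x)\<^sup>2)"
    using integrable_dilate[of "\<lambda>x. (\<phi> x)\<^sup>2" "1 / a"] integral_dilate[of "\<lambda>x. (\<phi> x)\<^sup>2" "1 / a"] a' integrable_\<phi>_sq
    by (simp_all add: F_def[abs_def] power_divide)
  have eq: "(atom \<omega> a \<upsilon>)\<^sup>2 = (1 / a ^ 4) * F (heis_inv \<omega> \<odot> \<upsilon>)" for \<upsilon>
    by (simp add: atom_def F_def power_divide)
  have "integrable lborel (\<lambda>\<upsilon>. (1 / a ^ 4) * F (heis_inv \<omega> \<odot> \<upsilon>))"
    using integrable_heis_left[of F "heis_inv \<omega>"] iF by (intro integrable_mult_right) simp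
  then show "sq_integrable lborel (atom \<omega> a)"
    unfolding sq_integrable_def eq by simp
  show "(LINT \<upsilon>|lborel. (atom \<omega> a \<upsilon>)\<^sup>2) = (LINT \<upsilon>|lborel. (\<phi> \<upsilon>)\<^sup>2)"
    unfolding eq using integral_heis_left[of F "heis_inv \<omega>"] iF assms by simp
qed

lemma V_diff:
  assumes "sq_integrable lborel f" "sq_integrable lborel g" "a > 0"
  shows "V (\<lambda>x. f x - g x) \<omega> a = V f \<omega> a - V g \<omega> a"
  unfolding V_atom left_diff_distrib
  by (rule Bochner_Integration.integral_diff; rule sq_integrable_mult) (use assms sq_integrable_atom in auto)

text \<open>The bound is uniform in \<open>\<omega>\<close> and \<open>a\<close>, so convergence of
  \<open>f\<close> in the mean forces pointwise convergence of the coefficients, as Fatou's lemma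
  needs.\<close>

lemma V_bound:
  assumes "sq_integrable lborel f" "a > 0"
  shows "(V f \<omega> a)\<^sup>2 \<le> (LINT x|lborel. (f x)\<^sup>2) * (LINT x|lborel. (\<phi> x)\<^sup>2)"
  using Cauchy_Schwarz_integral[OF assms(1) sq_integrable_atom(1)[OF assms(2)], of \<omega>] sq_integrable_atom(2)[OF assms(2)]
  by (simp add: V_atom)

lemma measurable_V:
  assumes f: "f \<in> borel_measurable borel"
  shows "(\<lambda>z. V f (fst z) (snd z)) \<in> borel_measurable borel"
proof -
  note [measurable] = f
  have [measurable]: "(fst :: heis \<times> real \<Rightarrow> heis) \<in> borel_measurable borel" "(snd :: heis \<times> real \<Rightarrow> real) \<in> borel_measurable borel"
    by (intro borel_measurable_continuous_onI continuous_intros)+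
  show ?thesis unfolding V_def by measurable
qed

lemma calderon_nn:
  assumes "continuous_on UNIV f" "\<And>x. norm x \<ge> R \<Longrightarrow> f x = 0"
  shows "(\<integral>\<^sup>+z. ennreal ((V f (fst z) (snd z))\<^sup>2) \<partial>haar_G) = ennreal ((LINT x|lborel. (f x)\<^sup>2) / 8)"
proof -
  have [measurable]: "(\<lambda>z. V f (fst z) (snd z)) \<in> borel_measurable borel"
    by (rule measurable_V[OF borel_measurable_continuous_onI[OF assms(1)]])
  show ?thesis
    using calderon_continuous[OF assms] by (subst nn_integral_haar_G) simp_all
qed

text \<open>Fatou's lemma gives the upper bound for every square integrable function, and the equality then
  follows by approximation.\<close>

lemma calderon_real:
  assumes f: "sq_integrable lborel f"
  shows "sq_integrable haar_G (\<lambda>z. V f (fst z) (snd z))"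
    "(LINT z|haar_G. (V f (fst z) (snd z))\<^sup>2) = (LINT x|lborel. (f x)\<^sup>2) / 8"
proof -
  have approx: "\<exists>g. (\<forall>n. continuous_on UNIV (g n) \<and> (\<exists>R. \<forall>x. norm x \<ge> R \<longrightarrow> g n x = 0)) \<and> (\<lambda>n. LINT x|lborel. (f x - g n x)\<^sup>2) \<longlonglongrightarrow> 0"
    if f: "sq_integrable lborel f" for f :: "heis \<Rightarrow> real"
  proof -
    have "\<exists>g. continuous_on UNIV g \<and> (\<exists>R. \<forall>x. norm x \<ge> R \<longrightarrow> g x = 0) \<and> (LINT x|lborel. (f x - g x)\<^sup>2) < inverse (real (Suc n))" for n
    proof -
      have "f \<in> borel_measurable borel" "integrable lborel (\<lambda>x. (f x)\<^sup>2)" "inverse (real (Suc n)) > 0"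
        using f by (auto simp: sq_integrable_def)
      then show ?thesis
      proof (rule square_integrable_approx_continuous)
        fix g :: "heis \<Rightarrow> real" and R
        assume "continuous_on UNIV g" "\<And>x. norm x \<ge> R \<Longrightarrow> g x = 0" "(LINT x|lborel. (f x - g x)\<^sup>2) < inverse (real (Suc n))"
        then show ?thesis by (intro exI[of _ g] conjI exI[of _ R] allI impI)
      qed
    qed
    then obtain g where g: "\<And>n. continuous_on UNIV (g n)" "\<And>n. \<exists>R. \<forall>x. norm x \<ge> R \<longrightarrow> g n x = 0"
      "\<And>n. (LINT x|lborel. (f x - g n x)\<^sup>2) < inverse (real (Suc n))" by metis
    have "(\<lambda>n. LINT x|lborel. (f x - g n x)\<^sup>2) \<longlonglongrightarrow> 0"
      by (rule tendsto_sandwich[OF _ _ tendsto_const LIMSEQ_inverse_real_of_nat])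
        (use g(3) in \<open>auto intro!: always_eventually less_imp_le\<close>)
    then show ?thesis using g by blast
  qed
  have sqc: "sq_integrable lborel g" if cg: "continuous_on UNIV g" and supp: "\<exists>R. \<forall>x. norm x \<ge> R \<longrightarrow> g x = 0" for g :: "heis \<Rightarrow> real"
  proof -
    obtain R where "\<And>x. norm x \<ge> R \<Longrightarrow> g x = 0" using supp by blast
    then have "integrable lborel (\<lambda>x. (g x)\<^sup>2)"
      using cg by (intro integrable_continuous_compact_support[of _ R] continuous_intros) auto
    then show ?thesis using borel_measurable_continuous_onI[OF cg] by (simp add: sq_integrable_def)
  qed
  have mV: "(\<lambda>z. V f (fst z) (snd z)) \<in> borel_measurable borel" if "sq_integrable lborel f" for f
    using that measurable_V by (simp add: sq_integrable_def)
  \<comment> \<open>Quantified anew over \<open>f\<close>, because it is applied below to the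
    differences \<open>f - g n\<close> as well; there it shows that the coefficients converge in the
    norm of \<open>haar_G\<close>.\<close>
  have upper: "(\<integral>\<^sup>+z. ennreal ((V f (fst z) (snd z))\<^sup>2) \<partial>haar_G) \<le> ennreal ((LINT x|lborel. (f x)\<^sup>2) / 8)"
    if f: "sq_integrable lborel f" for f
  proof -
    obtain g where g: "\<And>n. continuous_on UNIV (g n)" "\<And>n. \<exists>R. \<forall>x. norm x \<ge> R \<longrightarrow> g n x = 0"
      and lim: "(\<lambda>n. LINT x|lborel. (f x - g n x)\<^sup>2) \<longlonglongrightarrow> 0" using approx[OF f] by blast
    have sg: "sq_integrable lborel (g n)" for n using sqc g by blast
    have limV: "(\<lambda>n. V (g n) (fst z) (snd z)) \<longlonglongrightarrow> V f (fst z) (snd z)" if z: "z \<in> space haar_G" for z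
    proof -
      have a: "snd z > 0" using z by (auto simp: space_haar_G)
      have "(\<lambda>n. (V (\<lambda>x. f x - g n x) (fst z) (snd z))\<^sup>2) \<longlonglongrightarrow> 0"
      proof (rule tendsto_sandwich[OF _ _ tendsto_const])
        show "(\<lambda>n. (LINT x|lborel. (f x - g n x)\<^sup>2) * (LINT x|lborel. (\<phi> x)\<^sup>2)) \<longlonglongrightarrow> 0"
          using tendsto_mult_right[OF lim, of "LINT x|lborel. (\<phi> x)\<^sup>2"] by simp
        show "\<forall>\<^sub>F n in sequentially. (V (\<lambda>x. f x - g n x) (fst z) (snd z))\<^sup>2 \<le> (LINT x|lborel. (f x - g n x)\<^sup>2) * (LINT x|lborel. (\<phi> x)\<^sup>2)"
          by (intro always_eventually allI V_bound sq_integrable_diff f sg a)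
      qed simp
      then have "(\<lambda>n. V f (fst z) (snd z) - V (g n) (fst z) (snd z)) \<longlonglongrightarrow> 0"
        using tendsto_real_sqrt[of "\<lambda>n. (V (\<lambda>x. f x - g n x) (fst z) (snd z))\<^sup>2" 0 sequentially]
        by (simp add: V_diff[OF f sg a] tendsto_rabs_zero_iff)
      then have "(\<lambda>n. V f (fst z) (snd z) - (V f (fst z) (snd z) - V (g n) (fst z) (snd z))) \<longlonglongrightarrow> V f (fst z) (snd z) - 0"
        by (intro tendsto_intros)
      then show ?thesis by simp
    qed
    have "(\<integral>\<^sup>+z. ennreal ((V f (fst z) (snd z))\<^sup>2) \<partial>haar_G)
        = (\<integral>\<^sup>+z. liminf (\<lambda>n. ennreal ((V (g n) (fst z) (snd z))\<^sup>2)) \<partial>haar_G)"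
    proof (rule nn_integral_cong)
      fix z assume z: "z \<in> space haar_G"
      have "(\<lambda>n. ennreal ((V (g n) (fst z) (snd z))\<^sup>2)) \<longlonglongrightarrow> ennreal ((V f (fst z) (snd z))\<^sup>2)"
        by (intro tendsto_ennrealI tendsto_power limV z)
      from lim_imp_Liminf[OF _ this]
      show "ennreal ((V f (fst z) (snd z))\<^sup>2) = liminf (\<lambda>n. ennreal ((V (g n) (fst z) (snd z))\<^sup>2))" by simp
    qed
    also have "\<dots> \<le> liminf (\<lambda>n. \<integral>\<^sup>+z. ennreal ((V (g n) (fst z) (snd z))\<^sup>2) \<partial>haar_G)"
    proof (rule nn_integral_liminf)
      fix n
      note [measurable] = mV[OF sg, of n]
      show "(\<lambda>z. ennreal ((V (g n) (fst z) (snd z))\<^sup>2)) \<in> borel_measurable haar_G"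
        by (rule haar_G_measurable) measurable
    qed
    also have "\<dots> = liminf (\<lambda>n. ennreal ((LINT x|lborel. (g n x)\<^sup>2) / 8))"
    proof -
      have "(\<integral>\<^sup>+z. ennreal ((V (g n) (fst z) (snd z))\<^sup>2) \<partial>haar_G) = ennreal ((LINT x|lborel. (g n x)\<^sup>2) / 8)" for n
      proof -
        obtain R where "\<And>x. norm x \<ge> R \<Longrightarrow> g n x = 0" using g(2) by blast
        then show ?thesis by (rule calderon_nn[OF g(1)])
      qed
      then show ?thesis by simp
    qed
    also have "\<dots> = ennreal ((LINT x|lborel. (f x)\<^sup>2) / 8)"
      by (intro lim_imp_Liminf tendsto_ennrealI tendsto_divide sq_integrable_LIMSEQ f sg lim tendsto_const) auto
    finally show ?thesis .
  qed
  have sV: "sq_integrable haar_G (\<lambda>z. V f (fst z) (snd z))" if f: "sq_integrable lborel f" for f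
  proof -
    note [measurable] = haar_G_measurable[OF mV[OF f]]
    have "integrable haar_G (\<lambda>z. (V f (fst z) (snd z))\<^sup>2)"
      using upper[OF f] by (intro integrableI_nonneg) (auto intro: le_less_trans)
    then show ?thesis by (simp add: sq_integrable_def)
  qed
  have int_V: "ennreal (LINT z|haar_G. (V f (fst z) (snd z))\<^sup>2) = (\<integral>\<^sup>+z. ennreal ((V f (fst z) (snd z))\<^sup>2) \<partial>haar_G)"
    if "sq_integrable lborel f" for f
    using nn_integral_eq_integral[of haar_G "\<lambda>z. (V f (fst z) (snd z))\<^sup>2"] sV[OF that] by (simp add: sq_integrable_def)
  show "sq_integrable haar_G (\<lambda>z. V f (fst z) (snd z))" by (rule sV[OF f])
  obtain g where g: "\<And>n. continuous_on UNIV (g n)" "\<And>n. \<exists>R. \<forall>x. norm x \<ge> R \<longrightarrow> g n x = 0"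
    and lim: "(\<lambda>n. LINT x|lborel. (f x - g n x)\<^sup>2) \<longlonglongrightarrow> 0" using approx[OF f] by blast
  have sg: "sq_integrable lborel (g n)" for n using sqc g by blast
  have "(\<lambda>n. LINT z|haar_G. (V f (fst z) (snd z) - V (g n) (fst z) (snd z))\<^sup>2) \<longlonglongrightarrow> 0"
  proof (rule tendsto_sandwich[OF _ _ tendsto_const])
    show "(\<lambda>n. (LINT x|lborel. (f x - g n x)\<^sup>2) / 8) \<longlonglongrightarrow> 0"
      using tendsto_divide[OF lim tendsto_const[of 8]] by simp
    show "\<forall>\<^sub>F n in sequentially. (LINT z|haar_G. (V f (fst z) (snd z) - V (g n) (fst z) (snd z))\<^sup>2) \<le> (LINT x|lborel. (f x - g n x)\<^sup>2) / 8"
    proof (intro always_eventually allI)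
      fix n
      have s: "sq_integrable lborel (\<lambda>x. f x - g n x)" by (rule sq_integrable_diff[OF f sg])
      have "(LINT z|haar_G. (V f (fst z) (snd z) - V (g n) (fst z) (snd z))\<^sup>2) = (LINT z|haar_G. (V (\<lambda>x. f x - g n x) (fst z) (snd z))\<^sup>2)"
        by (rule Bochner_Integration.integral_cong) (auto simp: space_haar_G V_diff[OF f sg])
      also have "\<dots> \<le> (LINT x|lborel. (f x - g n x)\<^sup>2) / 8"
      proof -
        have "ennreal (LINT z|haar_G. (V (\<lambda>x. f x - g n x) (fst z) (snd z))\<^sup>2) \<le> ennreal ((LINT x|lborel. (f x - g n x)\<^sup>2) / 8)"
          unfolding int_V[OF s] by (rule upper[OF s])
        then show ?thesis by (subst (asm) ennreal_le_iff) simp_all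
      qed
      finally show "(LINT z|haar_G. (V f (fst z) (snd z) - V (g n) (fst z) (snd z))\<^sup>2) \<le> (LINT x|lborel. (f x - g n x)\<^sup>2) / 8" .
    qed
  qed simp
  then have V_lim: "(\<lambda>n. LINT z|haar_G. (V (g n) (fst z) (snd z))\<^sup>2) \<longlonglongrightarrow> (LINT z|haar_G. (V f (fst z) (snd z))\<^sup>2)"
    by (intro sq_integrable_LIMSEQ[OF sV[OF f] sV[OF sg]])
  have V_eq: "(LINT z|haar_G. (V (g n) (fst z) (snd z))\<^sup>2) = (LINT x|lborel. (g n x)\<^sup>2) / 8" for n
  proof -
    obtain R where "\<And>x. norm x \<ge> R \<Longrightarrow> g n x = 0" using g(2) by blast
    from calderon_nn[OF g(1) this] int_V[OF sg, of n] show ?thesis by simp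
  qed
  have "(\<lambda>n. (LINT x|lborel. (g n x)\<^sup>2) / 8) \<longlonglongrightarrow> (LINT x|lborel. (f x)\<^sup>2) / 8"
    by (intro tendsto_divide sq_integrable_LIMSEQ f sg lim tendsto_const) auto
  with V_lim show "(LINT z|haar_G. (V f (fst z) (snd z))\<^sup>2) = (LINT x|lborel. (f x)\<^sup>2) / 8"
    unfolding V_eq by (rule LIMSEQ_unique)
qed

lemma wavelet_transform_eq:
  assumes "sq_integrable lborel (\<lambda>x. Re (f x))" "sq_integrable lborel (\<lambda>x. Im (f x))" "a > 0"
  shows "wavelet_transform (\<lambda>\<omega>. complex_of_real (\<phi> \<omega>)) f (\<omega>, a) = Complex (V (\<lambda>x. Re (f x)) \<omega> a) (V (\<lambda>x. Im (f x)) \<omega> a)"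
proof -
  note i = sq_integrable_mult[OF assms(1) sq_integrable_atom(1)[OF assms(3)], of \<omega>]
    sq_integrable_mult[OF assms(2) sq_integrable_atom(1)[OF assms(3)], of \<omega>]
  have "f x * cnj (quasi_regular \<omega> a (\<lambda>\<omega>. complex_of_real (\<phi> \<omega>)) x)
      = complex_of_real (Re (f x) * atom \<omega> a x) + \<i> * complex_of_real (Im (f x) * atom \<omega> a x)" for x
    by (auto simp: complex_eq_iff quasi_regular_def atom_def)
  then have "wavelet_transform (\<lambda>\<omega>. complex_of_real (\<phi> \<omega>)) f (\<omega>, a)
      = (LINT x|lborel. complex_of_real (Re (f x) * atom \<omega> a x) + \<i> * complex_of_real (Im (f x) * atom \<omega> a x))"
    by (simp add: wavelet_transform_def L2_inner_def)
  also have "\<dots> = complex_of_real (V (\<lambda>x. Re (f x)) \<omega> a) + \<i> * complex_of_real (V (\<lambda>x. Im (f x)) \<omega> a)"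
    unfolding V_atom using i
    by (subst Bochner_Integration.integral_add) (auto simp del: of_real_mult)
  finally show ?thesis by (simp add: Complex_eq)
qed

text \<open>Since \<open>\<phi>\<close> is real, the real and imaginary parts of the transform are
  those of \<open>f\<close> transformed separately, and the squared moduli add up. The witness 8 is
  the reciprocal of the constant in \<open>calderon_real\<close>.\<close>

lemma admissible_\<phi>: "admissible (\<lambda>\<omega>. complex_of_real (\<phi> \<omega>))"
  unfolding admissible_def
proof (intro conjI exI[of _ 8] ballI)
  show "(\<lambda>\<omega>. complex_of_real (\<phi> \<omega>)) \<in> L2 lborel"
    using integrable_\<phi>_sq by (simp add: L2_def)
  fix f :: "heis \<Rightarrow> complex" assume "f \<in> L2 lborel"
  then have mf [measurable]: "f \<in> borel_measurable borel" and f2: "integrable lborel (\<lambda>x. (cmod (f x))\<^sup>2)"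
    by (auto simp: L2_def)
  define u v where "u x = Re (f x)" and "v x = Im (f x)" for x
  have [measurable]: "u \<in> borel_measurable borel" "v \<in> borel_measurable borel"
    unfolding u_def[abs_def] v_def[abs_def]
    by (intro borel_measurable_continuous_on[OF _ mf] continuous_intros)+
  have uv: "sq_integrable lborel u" "sq_integrable lborel v"
    unfolding sq_integrable_def
    by (auto simp: u_def[symmetric] v_def[symmetric] cmod_power2 intro!: Bochner_Integration.integrable_bound[OF f2])
  note su = calderon_real[OF uv(1)] and sv = calderon_real[OF uv(2)]
  define F where "F z = (V u (fst z) (snd z))\<^sup>2 + (V v (fst z) (snd z))\<^sup>2" for z
  have W: "wavelet_transform (\<lambda>\<omega>. complex_of_real (\<phi> \<omega>)) f z = Complex (V u (fst z) (snd z)) (V v (fst z) (snd z))"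
    if "snd z > 0" for z
    using wavelet_transform_eq[of f "snd z" "fst z"] uv that by (simp add: u_def[abs_def] v_def[abs_def])
  have WF: "(cmod (wavelet_transform (\<lambda>\<omega>. complex_of_real (\<phi> \<omega>)) f z))\<^sup>2 = F z" if "snd z > 0" for z
    by (simp add: W[OF that] F_def cmod_power2)
  have [measurable]: "(\<lambda>z. V u (fst z) (snd z)) \<in> borel_measurable borel" "(\<lambda>z. V v (fst z) (snd z)) \<in> borel_measurable borel"
    using uv measurable_V by (auto simp: sq_integrable_def)
  have mF: "F \<in> borel_measurable borel" unfolding F_def[abs_def] by measurable
  have iF: "integrable haar_G F" unfolding F_def using su sv by (simp add: sq_integrable_def)
  show "wavelet_transform (\<lambda>\<omega>. complex_of_real (\<phi> \<omega>)) f \<in> L2 haar_G"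
    unfolding L2_def
  proof (intro CollectI conjI)
    have "(\<lambda>z. complex_of_real (V u (fst z) (snd z)) + \<i> * complex_of_real (V v (fst z) (snd z))) \<in> borel_measurable haar_G"
      by (rule haar_G_measurable) measurable
    then show "wavelet_transform (\<lambda>\<omega>. complex_of_real (\<phi> \<omega>)) f \<in> borel_measurable haar_G"
      by (rule measurable_cong[THEN iffD1, rotated]) (auto simp: space_haar_G W Complex_eq)
    show "integrable haar_G (\<lambda>x. (cmod (wavelet_transform (\<lambda>\<omega>. complex_of_real (\<phi> \<omega>)) f x))\<^sup>2)"
      using iF by (rule Bochner_Integration.integrable_cong[THEN iffD1, rotated -1]) (auto simp: space_haar_G WF)
  qed
  have "(L2_norm lborel f)\<^sup>2 = (LINT x|lborel. (cmod (f x))\<^sup>2)"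
    by (simp add: L2_norm_def)
  also have "\<dots> = (LINT x|lborel. (u x)\<^sup>2) + (LINT x|lborel. (v x)\<^sup>2)"
    using uv by (simp add: cmod_power2 u_def v_def sq_integrable_def)
  also have "\<dots> = 8 * (LINT z|haar_G. F z)"
    unfolding F_def using su sv by (simp add: sq_integrable_def)
  also have "(LINT z|haar_G. F z) = (LINT \<omega>|lborel. (LINT a:{0<..}|lborel. F (\<omega>, a) * (1 / a ^ 5)))"
    by (rule integral_haar_G[OF mF iF])
  also have "\<dots> = (LINT \<omega>|lborel. (LINT a:{0<..}|lborel.
                 ((cmod (wavelet_transform (\<lambda>\<omega>. complex_of_real (\<phi> \<omega>)) f (\<omega>, a)))\<^sup>2 * (1 / a ^ 5))))"
    by (intro Bochner_Integration.integral_cong set_lebesgue_integral_cong refl allI impI) (auto simp: WF)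
  finally show "(L2_norm lborel f)\<^sup>2 = 8 * (LINT \<omega>|lborel. (LINT a:{0<..}|lborel.
                 ((cmod (wavelet_transform (\<lambda>\<omega>. complex_of_real (\<phi> \<omega>)) f (\<omega>, a)))\<^sup>2 * (1 / a ^ 5))))" .
qed simp

end

theorem theorem3p2:
  fixes h :: "heis \<times> real \<Rightarrow> real" and \<phi> :: "heis \<Rightarrow> real"
  assumes "heat_kernel h"
    and "\<phi> = (\<lambda>\<omega>. sub_laplacian (\<lambda>\<upsilon>. h (\<upsilon>, 1)) \<omega>)"
  shows "schwartz \<phi> \<and>
    admissible (\<lambda>\<omega>. complex_of_real (\<phi> \<omega>)) \<and>
    (\<forall>vs\<in>lists Basis. gaussian_decay (iter_deriv vs \<phi>))"
proof -
  interpret H: heis_heat h by unfold_locales (rule assms(1))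
  have "\<phi> = H.\<phi>"
    unfolding assms(2) H.\<phi>_def by (simp add: H.K_def[abs_def])
  then show ?thesis
    using H.schwartz_\<phi> H.admissible_\<phi> H.gauss_iter_deriv_\<phi> gauss_imp_gaussian_decay
    by (auto simp: lists_eq_set)
qed

end
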